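(* Let $X:\Box_+^{op}\to\mathrm{Set}$ be a semi-cubical set and $\mathcal{A}$ an AB4-category. Let $S:\Box/Lan^{J^{op}}X\to\Box_+/X$ be the functor taking each cube $(\gamma,\tilde x)$ to the cube $\tilde x$, and each morphism $(\alpha,\mu)$ to the morphism $\mu$. Then for every functor $F:(\Box_+/X)^{op}\to\mathcal{A}$ there are natural isomorphisms $H_n(Lan^{J^{op}}X,F\circ S^{op})\to H^+_n(X,F)$ for all $n\ge0$.
   Context: **AB4-category.** An Abelian category with all small coproducts in which coproducts are exact (Grothendieck's axioms AB3, AB4). **Cube categories.** $\Box$ has objects $\mathbb{I}^n=\{0,1\}^n$, $n\ge 0$ (with the product order); its morphisms are all compositions of the maps $\delta_i^{k,\varepsilon}:\mathbb{I}^{k-1}\to\mathbb{I}^k$, $\delta_i^{k,\varepsilon}(x_1,\dots,x_{k-1})=(x_1,\dots,x_{i-1},\varepsilon,x_i,\dots,x_{k-1})$ and $\sigma_i^k:\mathbb{I}^k\to\mathbb{I}^{k-1}$, $\sigma^k_i(x_1,\dots,x_k)=(x_1,\dots,x_{i-1},x_{i+1},\dots,x_k)$ ($k\ge1$, $1\le i\le k$, $\varepsilon\in\{0,1\}$) (and identities). $\Box_+\subset\Box$ is the subcategory with the same objects and all monomorphisms of $\Box$; $J:\Box_+\to\Box$ is the inclusion. A cubical set is a functor $\Box^{op}\to\mathrm{Set}$; a semi-cubical set is a functor $\Box_+^{op}\to\mathrm{Set}$; $X_n=X(\mathbb{I}^n)$. Every morphism $\alpha$ of $\Box$ factors uniquely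 as $\alpha=i_\alpha\circ i(\alpha)$ with $i(\alpha)$ an epimorphism and $i_\alpha$ a monomorphism of $\Box$. **Categories of cubes.** For a cubical set $Y$, $\Box/Y$ has as objects the elements $x\in\coprod_nY_n$; for $y\in Y_m$, $x\in Y_n$, morphisms $y\to x$ are $\alpha\in\Box(\mathbb{I}^m,\mathbb{I}^n)$ with $Y(\alpha)(x)=y$. $\Box_+/X$ is defined in the same way with $\Box_+$ instead of $\Box$; its objects are denoted $\tilde x$, $x\in X_n$. **The universal cubical set.** $Lan^{J^{op}}X$ is the left Kan extension of $X$ along $J^{op}:\Box_+^{op}\to\Box^{op}$. Explicitly, $(Lan^{J^{op}}X)_n=\coprod_{\gamma:\mathbb{I}^n\twoheadrightarrow\mathbb{I}^k}X_k$ (over epimorphisms $\gamma$ of $\Box$), with elements pairs $(\gamma,x)$, $x\in X_k$, and $\alpha:\mathbb{I}^m\to\mathbb{I}^n$ acts by $(\gamma,x)\mapsto(i(\gamma\alpha),X(i_{\gamma\alpha})(x))$. Thus objects of $\Box/Lan^{J^{op}}X$ are pairs $(\gamma,\tilde x)$, and morphisms from $(\beta:\mathbb{I}^m\twoheadrightarrow\mathbb{I}^p,\tilde y)$ to $(\gamma:\mathbb{I}^n\twoheadrightarrow\mathbb{I}^k,\tilde x)$ are pairs $(\alpha,\mu)$ with $\alpha\in\Box(\mathbb{I}^m,\mathbb{I}^n)$, $\mu:\mathbb{I}^p\to\mathbb{I}^k$ a monomorphism, $\mu\beta=\gamma\alpha$ and $X(\mu)(x)=y$. **Homology of a cubical set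 $Y$.** For $G:(\Box/Y)^{op}\to\mathcal{A}$ put $C_n(Y,G)=\bigoplus_{x\in Y_n}G(x)$ with injections $in_x$; define $d_i^{n,\varepsilon}:C_n\to C_{n-1}$ by $d_i^{n,\varepsilon}\circ in_x=in_{Y(\delta_i^{n,\varepsilon})x}\circ G(\delta_i^{n,\varepsilon})$, and $s_i^n:C_{n-1}\to C_n$ by $s_i^n\circ in_x=in_{Y(\sigma_i^n)x}\circ G(\sigma_i^n)$. Let $C^{N}_n(Y,G)=\mathrm{Coker}\big((s_1^n,\dots,s_n^n):C_{n-1}(Y,G)^{\oplus n}\to C_n(Y,G)\big)$ with differentials induced by $\sum_{i=1}^n(-1)^i(d_i^{n,0}-d_i^{n,1})$. $H_n(Y,G)$ is the $n$-th homology of $C^N_*(Y,G)$. **Homology of a semi-cubical set $X$.** For $F:(\Box_+/X)^{op}\to\mathcal{A}$, $H^+_n(X,F)$ is the $n$-th homology of the complex $\bigoplus_{x\in X_n}F(x)$ with differential $\sum_{i=1}^n(-1)^i(d_i^{n,0}-d_i^{n,1})$, where $d_i^{n,\varepsilon}\circ in_x=in_{X(\delta_i^{n,\varepsilon})x}\circ F(\delta_i^{n,\varepsilon})$. Equivalently $H_n^+(X,F)\cong\varinjlim_n^{(\Box_+/X)^{op}}F$ (left satellites of the colimit). *)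

theory Defs
  imports Main "HOL-Library.FuncSet" "HOL-Algebra.FiniteProduct"
begin

section \<open>Categories, functors, presheaves\<close>

record ('o, 'm) cat =
  Obj :: "'o set"
  Arr :: "'m set"
  Dom :: "'m \<Rightarrow> 'o"
  Cod :: "'m \<Rightarrow> 'o"
  Idt :: "'o \<Rightarrow> 'm"
  Comp :: "'m \<Rightarrow> 'm \<Rightarrow> 'm"  (infixl "\<cdot>\<index>" 70)

definition Hom :: "('o, 'm, 'z) cat_scheme \<Rightarrow> 'o \<Rightarrow> 'o \<Rightarrow> 'm set" where
  "Hom C a b = {f \<in> Arr C. Dom C f = a \<and> Cod C f = b}"

locale category =
  fixes C :: "('o, 'm, 'z) cat_scheme" (structure)
  assumes dom_closed: "f \<in> Arr C \<Longrightarrow> Dom C f \<in> Obj C"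
    and cod_closed: "f \<in> Arr C \<Longrightarrow> Cod C f \<in> Obj C"
    and id_closed: "a \<in> Obj C \<Longrightarrow> Idt C a \<in> Hom C a a"
    and comp_closed: "\<lbrakk>f \<in> Hom C a b; g \<in> Hom C b c\<rbrakk> \<Longrightarrow> g \<cdot> f \<in> Hom C a c"
    and comp_assoc: "\<lbrakk>f \<in> Hom C a b; g \<in> Hom C b c; h \<in> Hom C c d\<rbrakk>
      \<Longrightarrow> (h \<cdot> g) \<cdot> f = h \<cdot> (g \<cdot> f)"
    and id_left: "f \<in> Hom C a b \<Longrightarrow> Idt C b \<cdot> f = f"
    and id_right: "f \<in> Hom C a b \<Longrightarrow> f \<cdot> Idt C a = f"

definition op_cat :: "('o, 'm, 'z) cat_scheme \<Rightarrow> ('o, 'm) cat" where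
  "op_cat C = \<lparr>Obj = Obj C, Arr = Arr C, Dom = Cod C, Cod = Dom C, Idt = Idt C,
     Comp = (\<lambda>g f. Comp C f g)\<rparr>"

definition is_mono :: "('o, 'm, 'z) cat_scheme \<Rightarrow> 'm \<Rightarrow> bool" where
  "is_mono C f \<longleftrightarrow> f \<in> Arr C \<and>
     (\<forall>a. \<forall>g \<in> Hom C a (Dom C f). \<forall>h \<in> Hom C a (Dom C f).
        f \<cdot>\<^bsub>C\<^esub> g = f \<cdot>\<^bsub>C\<^esub> h \<longrightarrow> g = h)"

definition is_epi :: "('o, 'm, 'z) cat_scheme \<Rightarrow> 'm \<Rightarrow> bool" where
  "is_epi C f \<longleftrightarrow> f \<in> Arr C \<and>
     (\<forall>b. \<forall>g \<in> Hom C (Cod C f) b. \<forall>h \<in> Hom C (Cod C f) b.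
        g \<cdot>\<^bsub>C\<^esub> f = h \<cdot>\<^bsub>C\<^esub> f \<longrightarrow> g = h)"

definition is_isomorphism :: "('o, 'm, 'z) cat_scheme \<Rightarrow> 'm \<Rightarrow> bool" where
  "is_isomorphism C f \<longleftrightarrow> f \<in> Arr C \<and>
     (\<exists>g \<in> Hom C (Cod C f) (Dom C f).
        g \<cdot>\<^bsub>C\<^esub> f = Idt C (Dom C f) \<and> f \<cdot>\<^bsub>C\<^esub> g = Idt C (Cod C f))"

text \<open>A functor is given by its two maps only; source and target are arguments of the
  predicate. Hence a functor and its opposite have the same underlying data.\<close>

record ('o, 'm, 'p, 'q) fctr =
  Fobj :: "'o \<Rightarrow> 'p"
  Farr :: "'m \<Rightarrow> 'q"

definition is_functor ::
  "('o, 'm, 'y) cat_scheme \<Rightarrow> ('p, 'q, 'z) cat_scheme \<Rightarrow> ('o, 'm, 'p, 'q) fctr \<Rightarrow> bool" where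
  "is_functor C D F \<longleftrightarrow>
     (\<forall>a \<in> Obj C. Fobj F a \<in> Obj D) \<and>
     (\<forall>f \<in> Arr C. Farr F f \<in> Hom D (Fobj F (Dom C f)) (Fobj F (Cod C f))) \<and>
     (\<forall>a \<in> Obj C. Farr F (Idt C a) = Idt D (Fobj F a)) \<and>
     (\<forall>f \<in> Arr C. \<forall>g \<in> Arr C. Cod C f = Dom C g \<longrightarrow>
        Farr F (g \<cdot>\<^bsub>C\<^esub> f) = Farr F g \<cdot>\<^bsub>D\<^esub> Farr F f)"

definition fctr_comp ::
  "('p, 'q, 'r, 's) fctr \<Rightarrow> ('o, 'm, 'p, 'q) fctr \<Rightarrow> ('o, 'm, 'r, 's) fctr" where
  "fctr_comp G F = \<lparr>Fobj = Fobj G \<circ> Fobj F, Farr = Farr G \<circ> Farr F\<rparr>"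

definition op_fctr :: "('o, 'm, 'p, 'q) fctr \<Rightarrow> ('o, 'm, 'p, 'q) fctr" where
  "op_fctr F = F"

definition is_nat_trans ::
  "('o, 'm, 'y) cat_scheme \<Rightarrow> ('p, 'q, 'z) cat_scheme \<Rightarrow>
   ('o, 'm, 'p, 'q) fctr \<Rightarrow> ('o, 'm, 'p, 'q) fctr \<Rightarrow> ('o \<Rightarrow> 'q) \<Rightarrow> bool" where
  "is_nat_trans C D F F' \<tau> \<longleftrightarrow>
     is_functor C D F \<and> is_functor C D F' \<and>
     (\<forall>a \<in> Obj C. \<tau> a \<in> Hom D (Fobj F a) (Fobj F' a)) \<and>
     (\<forall>f \<in> Arr C. \<tau> (Cod C f) \<cdot>\<^bsub>D\<^esub> Farr F f = Farr F' f \<cdot>\<^bsub>D\<^esub> \<tau> (Dom C f))"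

definition whisker :: "('p \<Rightarrow> 'q) \<Rightarrow> ('o, 'm, 'p, 'r) fctr \<Rightarrow> ('o \<Rightarrow> 'q)" where
  "whisker \<tau> S = \<tau> \<circ> Fobj S"

text \<open>Functors from the opposite of \<open>C\<close> to sets (of elements of a type \<open>'x\<close>); \<open>Act P f\<close>
  is only meaningful on \<open>At P (Cod C f)\<close>.\<close>

record ('o, 'm, 'x) psh =
  At :: "'o \<Rightarrow> 'x set"
  Act :: "'m \<Rightarrow> 'x \<Rightarrow> 'x"

definition is_presheaf :: "('o, 'm, 'z) cat_scheme \<Rightarrow> ('o, 'm, 'x) psh \<Rightarrow> bool" where
  "is_presheaf C P \<longleftrightarrow>
     (\<forall>f \<in> Arr C. \<forall>x \<in> At P (Cod C f). Act P f x \<in> At P (Dom C f)) \<and>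
     (\<forall>a \<in> Obj C. \<forall>x \<in> At P a. Act P (Idt C a) x = x) \<and>
     (\<forall>f \<in> Arr C. \<forall>g \<in> Arr C. Cod C f = Dom C g \<longrightarrow>
        (\<forall>x \<in> At P (Cod C g). Act P (g \<cdot>\<^bsub>C\<^esub> f) x = Act P f (Act P g x)))"

text \<open>The category \<open>C/P\<close>. The element \<open>x \<in> P(c)\<close> is the object \<open>(c, x)\<close>, and
  \<open>\<alpha> : y \<rightarrow> x\<close> is the triple \<open>(y, \<alpha>, x)\<close>.\<close>

definition elements ::
  "('o, 'm, 'z) cat_scheme \<Rightarrow> ('o, 'm, 'x) psh
   \<Rightarrow> ('o \<times> 'x, ('o \<times> 'x) \<times> 'm \<times> ('o \<times> 'x)) cat" where
  "elements C P =
    \<lparr>Obj = {(c, x). c \<in> Obj C \<and> x \<in> At P c},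
     Arr = {((b, y), \<alpha>, (c, x)).
              b \<in> Obj C \<and> y \<in> At P b \<and> c \<in> Obj C \<and> x \<in> At P c \<and>
              \<alpha> \<in> Hom C b c \<and> Act P \<alpha> x = y},
     Dom = (\<lambda>(y, \<alpha>, x). y),
     Cod = (\<lambda>(y, \<alpha>, x). x),
     Idt = (\<lambda>(c, x). ((c, x), Idt C c, (c, x))),
     Comp = (\<lambda>(y', \<beta>, x') (y, \<alpha>, x). (y, \<beta> \<cdot>\<^bsub>C\<^esub> \<alpha>, x'))\<rparr>"


section \<open>AB4-categories\<close>

record ('o, 'm) ab_cat = "('o, 'm) cat" +
  Plus :: "'m \<Rightarrow> 'm \<Rightarrow> 'm"
  Zero :: "'o \<Rightarrow> 'o \<Rightarrow> 'm"

text \<open>The additive group of arrows, as a (multiplicatively written) group of HOL-Algebra: sums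
  are \<open>finprod\<close>, integer multiples are \<open>[^]\<close>.\<close>

definition hom_group :: "('o, 'm, 'z) ab_cat_scheme \<Rightarrow> 'o \<Rightarrow> 'o \<Rightarrow> 'm monoid" where
  "hom_group A a b = \<lparr>carrier = Hom A a b, mult = Plus A, one = Zero A a b\<rparr>"

locale preadditive_category = category A
  for A :: "('o, 'm, 'z) ab_cat_scheme" (structure) +
  assumes hom_comm_group: "\<lbrakk>a \<in> Obj A; b \<in> Obj A\<rbrakk> \<Longrightarrow> comm_group (hom_group A a b)"
    and comp_plus_left: "\<lbrakk>f \<in> Hom A a b; g \<in> Hom A b c; h \<in> Hom A b c\<rbrakk>
      \<Longrightarrow> Plus A g h \<cdot> f = Plus A (g \<cdot> f) (h \<cdot> f)"
    and comp_plus_right: "\<lbrakk>f \<in> Hom A a b; g \<in> Hom A a b; h \<in> Hom A b c\<rbrakk>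
      \<Longrightarrow> h \<cdot> Plus A f g = Plus A (h \<cdot> f) (h \<cdot> g)"

definition is_zero_obj :: "('o, 'm, 'z) cat_scheme \<Rightarrow> 'o \<Rightarrow> bool" where
  "is_zero_obj C z \<longleftrightarrow> z \<in> Obj C \<and>
     (\<forall>a \<in> Obj C. (\<exists>!f. f \<in> Hom C a z) \<and> (\<exists>!f. f \<in> Hom C z a))"

definition is_kernel :: "('o, 'm, 'z) ab_cat_scheme \<Rightarrow> 'm \<Rightarrow> 'm \<Rightarrow> bool" where
  "is_kernel A f k \<longleftrightarrow> f \<in> Arr A \<and> k \<in> Arr A \<and> Cod A k = Dom A f \<and>
     f \<cdot>\<^bsub>A\<^esub> k = Zero A (Dom A k) (Cod A f) \<and>
     (\<forall>a. \<forall>g \<in> Hom A a (Dom A f). f \<cdot>\<^bsub>A\<^esub> g = Zero A a (Cod A f) \<longrightarrow>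
        (\<exists>!h. h \<in> Hom A a (Dom A k) \<and> k \<cdot>\<^bsub>A\<^esub> h = g))"

definition is_cokernel :: "('o, 'm, 'z) ab_cat_scheme \<Rightarrow> 'm \<Rightarrow> 'm \<Rightarrow> bool" where
  "is_cokernel A f c \<longleftrightarrow> f \<in> Arr A \<and> c \<in> Arr A \<and> Dom A c = Cod A f \<and>
     c \<cdot>\<^bsub>A\<^esub> f = Zero A (Dom A f) (Cod A c) \<and>
     (\<forall>b. \<forall>g \<in> Hom A (Cod A f) b. g \<cdot>\<^bsub>A\<^esub> f = Zero A (Dom A f) b \<longrightarrow>
        (\<exists>!h. h \<in> Hom A (Cod A c) b \<and> h \<cdot>\<^bsub>A\<^esub> c = g))"

definition is_biproduct ::
  "('o, 'm, 'z) ab_cat_scheme \<Rightarrow> 'o \<Rightarrow> 'o \<Rightarrow> 'o \<Rightarrow> 'm \<Rightarrow> 'm \<Rightarrow> 'm \<Rightarrow> 'm \<Rightarrow> bool" where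
  "is_biproduct A a b p i\<^sub>1 i\<^sub>2 p\<^sub>1 p\<^sub>2 \<longleftrightarrow>
     i\<^sub>1 \<in> Hom A a p \<and> i\<^sub>2 \<in> Hom A b p \<and> p\<^sub>1 \<in> Hom A p a \<and> p\<^sub>2 \<in> Hom A p b \<and>
     p\<^sub>1 \<cdot>\<^bsub>A\<^esub> i\<^sub>1 = Idt A a \<and> p\<^sub>2 \<cdot>\<^bsub>A\<^esub> i\<^sub>2 = Idt A b \<and>
     Plus A (i\<^sub>1 \<cdot>\<^bsub>A\<^esub> p\<^sub>1) (i\<^sub>2 \<cdot>\<^bsub>A\<^esub> p\<^sub>2) = Idt A p"

locale abelian_category = preadditive_category A
  for A :: "('o, 'm, 'z) ab_cat_scheme" (structure) +
  assumes ex_zero_obj: "\<exists>z. is_zero_obj A z"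
    and ex_biproduct: "\<lbrakk>a \<in> Obj A; b \<in> Obj A\<rbrakk>
      \<Longrightarrow> \<exists>p \<in> Obj A. \<exists>i\<^sub>1 i\<^sub>2 p\<^sub>1 p\<^sub>2. is_biproduct A a b p i\<^sub>1 i\<^sub>2 p\<^sub>1 p\<^sub>2"
    and ex_kernel: "f \<in> Arr A \<Longrightarrow> \<exists>k. is_kernel A f k"
    and ex_cokernel: "f \<in> Arr A \<Longrightarrow> \<exists>c. is_cokernel A f c"
    and mono_normal: "is_mono A f \<Longrightarrow> \<exists>g. is_kernel A g f"
    and epi_normal: "is_epi A f \<Longrightarrow> \<exists>g. is_cokernel A g f"

definition is_coproduct ::
  "('o, 'm, 'z) cat_scheme \<Rightarrow> 'i set \<Rightarrow> ('i \<Rightarrow> 'o) \<Rightarrow> 'o \<Rightarrow> ('i \<Rightarrow> 'm) \<Rightarrow> bool" where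
  "is_coproduct C I a p \<iota> \<longleftrightarrow> p \<in> Obj C \<and>
     (\<forall>i \<in> I. \<iota> i \<in> Hom C (a i) p) \<and>
     (\<forall>b \<in> Obj C. \<forall>g. (\<forall>i \<in> I. g i \<in> Hom C (a i) b) \<longrightarrow>
        (\<exists>!h. h \<in> Hom C p b \<and> (\<forall>i \<in> I. h \<cdot>\<^bsub>C\<^esub> \<iota> i = g i)))"

text \<open>Coproducts, kernels and cokernels are chosen once and for all.\<close>

definition coprod ::
  "('o, 'm, 'z) cat_scheme \<Rightarrow> 'i set \<Rightarrow> ('i \<Rightarrow> 'o) \<Rightarrow> 'o \<times> ('i \<Rightarrow> 'm)" where
  "coprod C I a = (SOME c. is_coproduct C I a (fst c) (snd c))"

definition coprod_obj :: "('o, 'm, 'z) cat_scheme \<Rightarrow> 'i set \<Rightarrow> ('i \<Rightarrow> 'o) \<Rightarrow> 'o" where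
  "coprod_obj C I a = fst (coprod C I a)"

definition coprod_in :: "('o, 'm, 'z) cat_scheme \<Rightarrow> 'i set \<Rightarrow> ('i \<Rightarrow> 'o) \<Rightarrow> 'i \<Rightarrow> 'm" where
  "coprod_in C I a = snd (coprod C I a)"

definition copair ::
  "('o, 'm, 'z) cat_scheme \<Rightarrow> 'i set \<Rightarrow> ('i \<Rightarrow> 'o) \<Rightarrow> 'o \<Rightarrow> ('i \<Rightarrow> 'm) \<Rightarrow> 'm" where
  "copair C I a b g =
     (THE h. h \<in> Hom C (coprod_obj C I a) b \<and> (\<forall>i \<in> I. h \<cdot>\<^bsub>C\<^esub> coprod_in C I a i = g i))"

definition coprod_map ::
  "('o, 'm, 'z) cat_scheme \<Rightarrow> 'i set \<Rightarrow> ('i \<Rightarrow> 'o) \<Rightarrow> ('i \<Rightarrow> 'o) \<Rightarrow> ('i \<Rightarrow> 'm) \<Rightarrow> 'm" where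
  "coprod_map C I a b f =
     copair C I a (coprod_obj C I b) (\<lambda>i. coprod_in C I b i \<cdot>\<^bsub>C\<^esub> f i)"

definition zero_obj :: "('o, 'm, 'z) cat_scheme \<Rightarrow> 'o" where
  "zero_obj C = (SOME z. is_zero_obj C z)"

definition ker :: "('o, 'm, 'z) ab_cat_scheme \<Rightarrow> 'm \<Rightarrow> 'm" where
  "ker A f = (SOME k. is_kernel A f k)"

definition coker :: "('o, 'm, 'z) ab_cat_scheme \<Rightarrow> 'm \<Rightarrow> 'm" where
  "coker A f = (SOME c. is_cokernel A f c)"

definition short_exact :: "('o, 'm, 'z) ab_cat_scheme \<Rightarrow> 'm \<Rightarrow> 'm \<Rightarrow> bool" where
  "short_exact A f g \<longleftrightarrow> is_kernel A g f \<and> is_cokernel A f g"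

text \<open>HOL cannot quantify over all small sets; the type \<open>'u\<close> plays the role of the universe,
  so that the small sets are the sets of type \<open>'u set\<close>. For an infinite \<open>'u\<close> they are, up to bijection,
  closed under products with countable sets.\<close>

locale ab4_category = abelian_category A
  for U :: "'u itself" and A :: "('o, 'm, 'z) ab_cat_scheme" (structure) +
  assumes ex_coproduct: "\<And>(I :: 'u set) a. (\<forall>i \<in> I. a i \<in> Obj A)
      \<Longrightarrow> \<exists>p \<iota>. is_coproduct A I a p \<iota>"
    and coproducts_exact: "\<And>(I :: 'u set) a b c f g.
      (\<forall>i \<in> I. f i \<in> Hom A (a i) (b i) \<and> g i \<in> Hom A (b i) (c i) \<and> short_exact A (f i) (g i))
      \<Longrightarrow> short_exact A (coprod_map A I a b f) (coprod_map A I b c g)"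


section \<open>Cube categories\<close>

definition cube :: "nat \<Rightarrow> bool list set" where
  "cube n = {xs. length xs = n}"

text \<open>A map \<open>f\<close> from the \<open>m\<close>-cube to the \<open>n\<close>-cube is the triple \<open>(m, f, n)\<close>, with \<open>f\<close>
  extensional on \<open>cube m\<close>; the cube of dimension \<open>n\<close> is represented as an object by \<open>n\<close>.\<close>

type_synonym cube_map = "nat \<times> (bool list \<Rightarrow> bool list) \<times> nat"

definition cube_id :: "nat \<Rightarrow> cube_map" where
  "cube_id n = (n, (\<lambda>xs \<in> cube n. xs), n)"

definition cube_comp :: "cube_map \<Rightarrow> cube_map \<Rightarrow> cube_map" where
  "cube_comp = (\<lambda>(n', g, p) (m, f, n). (m, compose (cube m) g f, p))"

definition face :: "nat \<Rightarrow> nat \<Rightarrow> bool \<Rightarrow> cube_map" where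
  "face k i \<epsilon> = (k - 1, (\<lambda>xs \<in> cube (k - 1). take (i - 1) xs @ [\<epsilon>] @ drop (i - 1) xs), k)"

definition degen :: "nat \<Rightarrow> nat \<Rightarrow> cube_map" where
  "degen k i = (k, (\<lambda>xs \<in> cube k. take (i - 1) xs @ drop i xs), k - 1)"

inductive_set box_arr :: "cube_map set" where
  id: "cube_id n \<in> box_arr"
| face: "\<lbrakk>1 \<le> i; i \<le> k\<rbrakk> \<Longrightarrow> face k i \<epsilon> \<in> box_arr"
| degen: "\<lbrakk>1 \<le> i; i \<le> k\<rbrakk> \<Longrightarrow> degen k i \<in> box_arr"
| comp: "\<lbrakk>(m, f, n) \<in> box_arr; (n, g, p) \<in> box_arr\<rbrakk>
    \<Longrightarrow> cube_comp (n, g, p) (m, f, n) \<in> box_arr"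

definition Box :: "(nat, cube_map) cat" where
  "Box = \<lparr>Obj = UNIV, Arr = box_arr, Dom = (\<lambda>(m, f, n). m), Cod = (\<lambda>(m, f, n). n),
     Idt = cube_id, Comp = cube_comp\<rparr>"

definition Box_plus :: "(nat, cube_map) cat" where
  "Box_plus = Box\<lparr>Arr := {f. is_mono Box f}\<rparr>"

abbreviation semicubical_set :: "(nat, cube_map, 'x) psh \<Rightarrow> bool" where
  "semicubical_set \<equiv> is_presheaf Box_plus"

text \<open>\<open>epi_part \<alpha>\<close> is \<open>i(\<alpha>)\<close> and \<open>mono_part \<alpha>\<close> is \<open>i\<^sub>\<alpha>\<close>.\<close>

definition is_factorization :: "cube_map \<Rightarrow> cube_map \<Rightarrow> cube_map \<Rightarrow> bool" where
  "is_factorization \<alpha> m e \<longleftrightarrow>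
     is_mono Box m \<and> is_epi Box e \<and> Cod Box e = Dom Box m \<and> m \<cdot>\<^bsub>Box\<^esub> e = \<alpha>"

definition epi_part :: "cube_map \<Rightarrow> cube_map" where
  "epi_part \<alpha> = (THE e. \<exists>m. is_factorization \<alpha> m e)"

definition mono_part :: "cube_map \<Rightarrow> cube_map" where
  "mono_part \<alpha> = (THE m. \<exists>e. is_factorization \<alpha> m e)"

text \<open>The left Kan extension of \<open>X\<close> along the opposite of the inclusion of \<open>Box_plus\<close> into
  \<open>Box\<close>, in its explicit form.\<close>

definition Lan :: "(nat, cube_map, 'x) psh \<Rightarrow> (nat, cube_map, cube_map \<times> 'x) psh" where
  "Lan X =
    \<lparr>At = (\<lambda>n. {(\<gamma>, x). is_epi Box \<gamma> \<and> Dom Box \<gamma> = n \<and> x \<in> At X (Cod Box \<gamma>)}),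
     Act = (\<lambda>\<alpha> (\<gamma>, x). (epi_part (\<gamma> \<cdot>\<^bsub>Box\<^esub> \<alpha>), Act X (mono_part (\<gamma> \<cdot>\<^bsub>Box\<^esub> \<alpha>)) x))\<rparr>"

text \<open>The functor \<open>S : Box/Lan X \<rightarrow> Box_plus/X\<close>. An arrow \<open>(\<beta>, y) \<rightarrow> (\<gamma>, x)\<close> is recorded in
  \<open>elements Box (Lan X)\<close> by \<open>\<alpha>\<close> alone; the component \<open>\<mu>\<close> of the pair \<open>(\<alpha>, \<mu>)\<close> is determined
  by \<open>\<alpha>\<close>, since \<open>\<beta>\<close> is an epimorphism.\<close>

definition S_functor :: "(nat, cube_map, 'x) psh \<Rightarrow>
    (nat \<times> (cube_map \<times> 'x),
     (nat \<times> (cube_map \<times> 'x)) \<times> cube_map \<times> (nat \<times> (cube_map \<times> 'x)),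
     nat \<times> 'x,
     (nat \<times> 'x) \<times> cube_map \<times> (nat \<times> 'x)) fctr" where
  "S_functor X =
    \<lparr>Fobj = (\<lambda>(n, \<gamma>, x). (Cod Box \<gamma>, x)),
     Farr = (\<lambda>((m, \<beta>, y), \<alpha>, (n, \<gamma>, x)).
       ((Cod Box \<beta>, y),
        (THE \<mu>. is_mono Box \<mu> \<and> \<mu> \<in> Hom Box (Cod Box \<beta>) (Cod Box \<gamma>) \<and>
           \<mu> \<cdot>\<^bsub>Box\<^esub> \<beta> = \<gamma> \<cdot>\<^bsub>Box\<^esub> \<alpha> \<and> Act X \<mu> x = y),
        (Cod Box \<gamma>, x)))\<rparr>"


section \<open>Homology of chain complexes\<close>

text \<open>\<open>Diff K n\<close> is the differential from degree \<open>n\<close> to degree \<open>n - 1\<close>, for \<open>n \<ge> 1\<close>. In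
  negative degrees the complex is zero; \<open>Diff K 0\<close> is not used.\<close>

record ('o, 'm) chain_cx =
  Ch :: "nat \<Rightarrow> 'o"
  Diff :: "nat \<Rightarrow> 'm"

definition cycles :: "('o, 'm, 'z) ab_cat_scheme \<Rightarrow> ('o, 'm) chain_cx \<Rightarrow> nat \<Rightarrow> 'm" where
  "cycles A K n = ker A (if n = 0 then Zero A (Ch K 0) (zero_obj A) else Diff K n)"

definition to_cycles :: "('o, 'm, 'z) ab_cat_scheme \<Rightarrow> ('o, 'm) chain_cx \<Rightarrow> nat \<Rightarrow> 'm" where
  "to_cycles A K n =
     (THE l. l \<in> Hom A (Ch K (n + 1)) (Dom A (cycles A K n)) \<and>
        cycles A K n \<cdot>\<^bsub>A\<^esub> l = Diff K (n + 1))"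

definition homology_proj :: "('o, 'm, 'z) ab_cat_scheme \<Rightarrow> ('o, 'm) chain_cx \<Rightarrow> nat \<Rightarrow> 'm" where
  "homology_proj A K n = coker A (to_cycles A K n)"

definition homology :: "('o, 'm, 'z) ab_cat_scheme \<Rightarrow> ('o, 'm) chain_cx \<Rightarrow> nat \<Rightarrow> 'o" where
  "homology A K n = Cod A (homology_proj A K n)"

definition cycles_map ::
  "('o, 'm, 'z) ab_cat_scheme \<Rightarrow> ('o, 'm) chain_cx \<Rightarrow> ('o, 'm) chain_cx \<Rightarrow> (nat \<Rightarrow> 'm) \<Rightarrow>
   nat \<Rightarrow> 'm" where
  "cycles_map A K L f n =
     (THE k. k \<in> Hom A (Dom A (cycles A K n)) (Dom A (cycles A L n)) \<and>
        cycles A L n \<cdot>\<^bsub>A\<^esub> k = f n \<cdot>\<^bsub>A\<^esub> cycles A K n)"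

definition homology_map ::
  "('o, 'm, 'z) ab_cat_scheme \<Rightarrow> ('o, 'm) chain_cx \<Rightarrow> ('o, 'm) chain_cx \<Rightarrow> (nat \<Rightarrow> 'm) \<Rightarrow>
   nat \<Rightarrow> 'm" where
  "homology_map A K L f n =
     (THE h. h \<in> Hom A (homology A K n) (homology A L n) \<and>
        h \<cdot>\<^bsub>A\<^esub> homology_proj A K n = homology_proj A L n \<cdot>\<^bsub>A\<^esub> cycles_map A K L f n)"


section \<open>Homology of cubical and semi-cubical sets\<close>

text \<open>The coefficients \<open>G\<close> are a contravariant functor on \<open>Box/Y\<close> or \<open>Box_plus/Y\<close>; the
  formulas for the chain objects and the face operators are the same in both cases.\<close>

type_synonym ('x, 'o, 'm) coeff =
  "(nat \<times> 'x, (nat \<times> 'x) \<times> cube_map \<times> (nat \<times> 'x), 'o, 'm) fctr"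

definition chain :: "('o, 'm, 'z) ab_cat_scheme \<Rightarrow> (nat, cube_map, 'x) psh \<Rightarrow>
    ('x, 'o, 'm) coeff \<Rightarrow> nat \<Rightarrow> 'o" where
  "chain A Y G n = coprod_obj A (At Y n) (\<lambda>x. Fobj G (n, x))"

definition chain_in :: "('o, 'm, 'z) ab_cat_scheme \<Rightarrow> (nat, cube_map, 'x) psh \<Rightarrow>
    ('x, 'o, 'm) coeff \<Rightarrow> nat \<Rightarrow> 'x \<Rightarrow> 'm" where
  "chain_in A Y G n = coprod_in A (At Y n) (\<lambda>x. Fobj G (n, x))"

definition face_op :: "('o, 'm, 'z) ab_cat_scheme \<Rightarrow> (nat, cube_map, 'x) psh \<Rightarrow>
    ('x, 'o, 'm) coeff \<Rightarrow> nat \<Rightarrow> nat \<Rightarrow> bool \<Rightarrow> 'm" where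
  "face_op A Y G n i \<epsilon> =
     copair A (At Y n) (\<lambda>x. Fobj G (n, x)) (chain A Y G (n - 1))
       (\<lambda>x. let y = Act Y (face n i \<epsilon>) x in
          chain_in A Y G (n - 1) y \<cdot>\<^bsub>A\<^esub> Farr G ((n - 1, y), face n i \<epsilon>, (n, x)))"

definition degen_op :: "('o, 'm, 'z) ab_cat_scheme \<Rightarrow> (nat, cube_map, 'x) psh \<Rightarrow>
    ('x, 'o, 'm) coeff \<Rightarrow> nat \<Rightarrow> nat \<Rightarrow> 'm" where
  "degen_op A Y G n i =
     copair A (At Y (n - 1)) (\<lambda>x. Fobj G (n - 1, x)) (chain A Y G n)
       (\<lambda>x. let y = Act Y (degen n i) x in
          chain_in A Y G n y \<cdot>\<^bsub>A\<^esub> Farr G ((n, y), degen n i, (n - 1, x)))"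

text \<open>\<open>\<Sum>\<^sub>i (-1)\<^sup>i (d\<^sub>i\<^sup>0 - d\<^sub>i\<^sup>1)\<close>, written in \<open>hom_group\<close>.\<close>

definition chain_diff :: "('o, 'm, 'z) ab_cat_scheme \<Rightarrow> (nat, cube_map, 'x) psh \<Rightarrow>
    ('x, 'o, 'm) coeff \<Rightarrow> nat \<Rightarrow> 'm" where
  "chain_diff A Y G n =
     (let H = hom_group A (chain A Y G n) (chain A Y G (n - 1)) in
      finprod H
        (\<lambda>i. (face_op A Y G n i False \<otimes>\<^bsub>H\<^esub> inv\<^bsub>H\<^esub> face_op A Y G n i True)
               [^]\<^bsub>H\<^esub> ((- 1) ^ i :: int))
        {1..n})"

definition chain_map :: "('o, 'm, 'z) ab_cat_scheme \<Rightarrow> (nat, cube_map, 'x) psh \<Rightarrow>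
    ('x, 'o, 'm) coeff \<Rightarrow> ('x, 'o, 'm) coeff \<Rightarrow> (nat \<times> 'x \<Rightarrow> 'm) \<Rightarrow> nat \<Rightarrow> 'm" where
  "chain_map A Y G G' \<tau> n =
     coprod_map A (At Y n) (\<lambda>x. Fobj G (n, x)) (\<lambda>x. Fobj G' (n, x)) (\<lambda>x. \<tau> (n, x))"

definition norm_proj :: "('o, 'm, 'z) ab_cat_scheme \<Rightarrow> (nat, cube_map, 'x) psh \<Rightarrow>
    ('x, 'o, 'm) coeff \<Rightarrow> nat \<Rightarrow> 'm" where
  "norm_proj A Y G n =
     coker A (copair A {1..n} (\<lambda>i. chain A Y G (n - 1)) (chain A Y G n)
       (\<lambda>i. degen_op A Y G n i))"

definition norm_cx :: "('o, 'm, 'z) ab_cat_scheme \<Rightarrow> (nat, cube_map, 'x) psh \<Rightarrow>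
    ('x, 'o, 'm) coeff \<Rightarrow> ('o, 'm) chain_cx" where
  "norm_cx A Y G =
    \<lparr>Ch = (\<lambda>n. Cod A (norm_proj A Y G n)),
     Diff = (\<lambda>n. THE d.
       d \<in> Hom A (Cod A (norm_proj A Y G n)) (Cod A (norm_proj A Y G (n - 1))) \<and>
       d \<cdot>\<^bsub>A\<^esub> norm_proj A Y G n = norm_proj A Y G (n - 1) \<cdot>\<^bsub>A\<^esub> chain_diff A Y G n)\<rparr>"

definition norm_map :: "('o, 'm, 'z) ab_cat_scheme \<Rightarrow> (nat, cube_map, 'x) psh \<Rightarrow>
    ('x, 'o, 'm) coeff \<Rightarrow> ('x, 'o, 'm) coeff \<Rightarrow> (nat \<times> 'x \<Rightarrow> 'm) \<Rightarrow> nat \<Rightarrow> 'm" where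
  "norm_map A Y G G' \<tau> n =
     (THE h. h \<in> Hom A (Cod A (norm_proj A Y G n)) (Cod A (norm_proj A Y G' n)) \<and>
        h \<cdot>\<^bsub>A\<^esub> norm_proj A Y G n = norm_proj A Y G' n \<cdot>\<^bsub>A\<^esub> chain_map A Y G G' \<tau> n)"

definition plus_cx :: "('o, 'm, 'z) ab_cat_scheme \<Rightarrow> (nat, cube_map, 'x) psh \<Rightarrow>
    ('x, 'o, 'm) coeff \<Rightarrow> ('o, 'm) chain_cx" where
  "plus_cx A X F = \<lparr>Ch = chain A X F, Diff = chain_diff A X F\<rparr>"

definition cub_homology :: "('o, 'm, 'z) ab_cat_scheme \<Rightarrow> nat \<Rightarrow> (nat, cube_map, 'x) psh \<Rightarrow>
    ('x, 'o, 'm) coeff \<Rightarrow> 'o" where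
  "cub_homology A n Y G = homology A (norm_cx A Y G) n"

definition cub_homology_map :: "('o, 'm, 'z) ab_cat_scheme \<Rightarrow> nat \<Rightarrow>
    (nat, cube_map, 'x) psh \<Rightarrow> ('x, 'o, 'm) coeff \<Rightarrow> ('x, 'o, 'm) coeff \<Rightarrow>
    (nat \<times> 'x \<Rightarrow> 'm) \<Rightarrow> 'm" where
  "cub_homology_map A n Y G G' \<tau> =
     homology_map A (norm_cx A Y G) (norm_cx A Y G') (norm_map A Y G G' \<tau>) n"

definition semicub_homology :: "('o, 'm, 'z) ab_cat_scheme \<Rightarrow> nat \<Rightarrow>
    (nat, cube_map, 'x) psh \<Rightarrow> ('x, 'o, 'm) coeff \<Rightarrow> 'o" where
  "semicub_homology A n X F = homology A (plus_cx A X F) n"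

definition semicub_homology_map :: "('o, 'm, 'z) ab_cat_scheme \<Rightarrow> nat \<Rightarrow>
    (nat, cube_map, 'x) psh \<Rightarrow> ('x, 'o, 'm) coeff \<Rightarrow> ('x, 'o, 'm) coeff \<Rightarrow>
    (nat \<times> 'x \<Rightarrow> 'm) \<Rightarrow> 'm" where
  "semicub_homology_map A n X F F' \<tau> =
     homology_map A (plus_cx A X F) (plus_cx A X F') (chain_map A X F F' \<tau>) n"

end

theory Submission
  imports Defs "HOL-Library.Equipollence"
begin

text \<open>A degeneracy \<open>\<sigma>\<^sub>i\<close> sends \<open>(\<gamma>, x)\<close> to \<open>(\<gamma>\<sigma>\<^sub>i, x)\<close>, and \<open>F \<circ> S\<close> maps the arrow belonging to it to an identity.
  Every epimorphism other than an identity is of the form \<open>\<gamma>\<sigma>\<^sub>i\<close>, so the cokernel of all degeneracies is the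
  projection of \<open>C\<^sub>n(Lan X, F \<circ> S)\<close> onto the summands \<open>F(x)\<close> with \<open>\<gamma>\<close> an identity, that is, onto
  \<open>C\<^sub>n(X, F)\<close>. The projection commutes with \<open>d\<^sub>i\<^sup>0 - d\<^sub>i\<^sup>1\<close> for each \<open>i\<close>: if \<open>\<gamma> = \<beta>\<sigma>\<^sub>j\<close>, then \<open>\<gamma>\<delta>\<^sub>j\<^sup>\<epsilon> = \<beta>\<close> for both
  \<open>\<epsilon>\<close> and the two faces cancel, while for \<open>i \<noteq> j\<close> the epimorphic part of \<open>\<gamma>\<delta>\<^sub>i\<^sup>\<epsilon>\<close> is not an identity and the
  projection kills both faces. Hence the normalized complex of \<open>Lan X\<close> is isomorphic to the complex
  of \<open>X\<close>, already before passing to homology.\<close>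

section \<open>The cube category\<close>

text \<open>Epimorphisms in \<open>Lan\<close> are defined by cancellation in \<open>Box\<close>,
  and \<open>epi_part\<close> and \<open>mono_part\<close> by definite descriptions. To know that a
  non-identity epimorphism starts with a degeneracy, one needs a normal form of all cube maps:
  degeneracies followed by faces. Factorizations must moreover be unique as pairs of maps, not only
  up to isomorphism, and this holds because \<open>Box\<close> has no isomorphisms besides
  identities. A single face operator does not commute with the projection: on a summand with
  \<open>\<gamma> = \<sigma>\<^sub>j\<close> the operator \<open>d\<^sub>j\<^sup>\<epsilon>\<close>
  lands in an identity summand, while projecting first gives zero. Hence the differences over both
  ends are the units of all calculations. That the differential squares to zero is computed for X
  only and carried over to the normalized complex, whose differential is recognized as a conjugate
  of that of X. There is also a question of size: coproducts are given over subsets of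
  \<open>'u\<close>, but the chains of \<open>Lan X\<close> are indexed by pairs of a cube map and
  an element. Cube maps are countably many, and an infinite universe absorbs a countable
  factor.\<close>

definition list_del :: "nat \<Rightarrow> 'a list \<Rightarrow> 'a list" where
  "list_del j xs = take j xs @ drop (Suc j) xs"

definition list_ins :: "nat \<Rightarrow> 'a \<Rightarrow> 'a list \<Rightarrow> 'a list" where
  "list_ins j e xs = take j xs @ e # drop j xs"

lemma list_del_Cons [simp]:
  "list_del 0 (x # xs) = xs" "list_del (Suc j) (x # xs) = x # list_del j xs"
  by (simp_all add: list_del_def)

lemma list_ins_simps [simp]:
  "list_ins 0 e xs = e # xs" "list_ins (Suc j) e (x # xs) = x # list_ins j e xs"
  by (simp_all add: list_ins_def)

lemma length_list_del [simp]: "j < length xs \<Longrightarrow> length (list_del j xs) = length xs - 1"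
  by (simp add: list_del_def)

lemma length_list_ins [simp]: "length (list_ins j e xs) = Suc (length xs)"
  by (simp add: list_ins_def)

lemma del_ins_same: "j \<le> length xs \<Longrightarrow> list_del j (list_ins j e xs) = xs"
  by (simp add: list_ins_def list_del_def)

text \<open>The cocubical relations on coordinates. The index that shifts is written with
  \<open>Suc\<close> instead of a subtraction, so that induction can strip the head of the list and
  lower both indices together.\<close>

lemma del_ins_less:
  "j \<le> i \<Longrightarrow> i < length xs \<Longrightarrow> list_del j (list_ins (Suc i) e xs) = list_ins i e (list_del j xs)"
proof (induction xs arbitrary: i j)
  case (Cons x xs)
  then show ?case by (cases j; cases i) auto
qed simp

lemma del_ins_greater:
  "i \<le> j \<Longrightarrow> j < length xs \<Longrightarrow> list_del (Suc j) (list_ins i e xs) = list_ins i e (list_del j xs)"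
proof (induction xs arbitrary: i j)
  case (Cons x xs)
  then show ?case by (cases i; cases j) auto
qed simp

lemma ins_ins:
  "i \<le> j \<Longrightarrow> j \<le> length xs \<Longrightarrow> list_ins (Suc j) f (list_ins i e xs) = list_ins i e (list_ins j f xs)"
proof (induction xs arbitrary: i j)
  case (Cons x xs)
  then show ?case by (cases i; cases j) auto
qed simp

lemma Box_simps [simp]:
  "Obj Box = UNIV" "Arr Box = box_arr" "Idt Box = cube_id" "Comp Box = cube_comp"
  by (simp_all add: Box_def)

lemma Box_Dom [simp]: "Dom Box (m, f, n) = m" and Box_Cod [simp]: "Cod Box (m, f, n) = n"
  by (simp_all add: Box_def)

lemma Hom_Box: "\<alpha> \<in> Hom Box m n \<longleftrightarrow> \<alpha> \<in> box_arr \<and> (\<exists>f. \<alpha> = (m, f, n))"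
  by (cases \<alpha>) (auto simp: Hom_def)

text \<open>\<open>face\<close> and \<open>degen\<close> count coordinates from 1,
  \<open>list_ins\<close> and \<open>list_del\<close> from 0. With dimension and index both written
  as successors, the subtractions in the two definitions disappear.\<close>

lemma face_eq: "face (Suc n) (Suc j) \<epsilon> = (n, \<lambda>xs \<in> cube n. list_ins j \<epsilon> xs, Suc n)"
  by (simp add: face_def list_ins_def)

lemma degen_eq: "degen (Suc n) (Suc j) = (Suc n, \<lambda>xs \<in> cube (Suc n). list_del j xs, n)"
  by (simp add: degen_def list_del_def)

lemma cube_comp_eq: "cube_comp (n', g, p) (m, f, n) = (m, compose (cube m) g f, p)"
  by (simp add: cube_comp_def)

text \<open>Extensionality survives composition, so a cube map is determined by its values on the
  cube. The identity laws of \<open>Box\<close>, and later the countability of its arrows, rest on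
  this.\<close>

lemma box_arr_PiE: "\<alpha> \<in> box_arr \<Longrightarrow> fst (snd \<alpha>) \<in> cube (fst \<alpha>) \<rightarrow>\<^sub>E cube (snd (snd \<alpha>))"
proof (induction rule: box_arr.induct)
  case (face i k \<epsilon>)
  then show ?case by (auto simp: face_def cube_def PiE_def Pi_def extensional_def)
next
  case (degen i k)
  then show ?case by (auto simp: degen_def cube_def PiE_def Pi_def extensional_def)
next
  case (comp m f n g p)
  then show ?case
    by (auto simp: cube_comp_def PiE_def compose_def extensional_def)
qed (auto simp: cube_id_def PiE_def extensional_def)

lemma Hom_BoxE:
  assumes "\<alpha> \<in> Hom Box m n"
  obtains f where "\<alpha> = (m, f, n)" "\<alpha> \<in> box_arr" "f \<in> cube m \<rightarrow> cube n" "f \<in> extensional (cube m)"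
  using assms box_arr_PiE[of \<alpha>] by (auto simp: Hom_Box PiE_def)

interpretation Box: category Box
proof
  show "Idt Box a \<in> Hom Box a a" for a
    using box_arr.id[of a] by (auto simp: Hom_Box cube_id_def)
  show "g \<cdot>\<^bsub>Box\<^esub> f \<in> Hom Box a c" if "f \<in> Hom Box a b" "g \<in> Hom Box b c" for f g a b c
  proof -
    from that obtain f' g' where "f = (a, f', b)" "g = (b, g', c)" "f \<in> box_arr" "g \<in> box_arr"
      by (auto simp: Hom_Box)
    then show ?thesis
      using box_arr.comp[of a f' b g' c] by (simp add: Hom_Box cube_comp_eq)
  qed
  show "(h \<cdot>\<^bsub>Box\<^esub> g) \<cdot>\<^bsub>Box\<^esub> f = h \<cdot>\<^bsub>Box\<^esub> (g \<cdot>\<^bsub>Box\<^esub> f)"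
    if "f \<in> Hom Box a b" "g \<in> Hom Box b c" "h \<in> Hom Box c d" for f g h a b c d
  proof -
    from that obtain f' g' h' where "f = (a, f', b)" "g = (b, g', c)" "h = (c, h', d)"
      "f' \<in> cube a \<rightarrow> cube b"
      by (metis Hom_BoxE)
    then show ?thesis
      by (simp add: cube_comp_eq compose_assoc)
  qed
  show "Idt Box b \<cdot>\<^bsub>Box\<^esub> f = f" if "f \<in> Hom Box a b" for f a b
    by (rule Hom_BoxE[OF that]) (simp add: cube_comp_eq cube_id_def Id_compose)
  show "f \<cdot>\<^bsub>Box\<^esub> Idt Box a = f" if "f \<in> Hom Box a b" for f a b
    by (rule Hom_BoxE[OF that]) (simp add: cube_comp_eq cube_id_def compose_Id)
qed auto

lemma face_Hom: "1 \<le> i \<Longrightarrow> i \<le> Suc n \<Longrightarrow> face (Suc n) i \<epsilon> \<in> Hom Box n (Suc n)"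
  using box_arr.face[of i "Suc n"] by (auto simp: Hom_Box face_def)

lemma degen_Hom: "1 \<le> i \<Longrightarrow> i \<le> Suc n \<Longrightarrow> degen (Suc n) i \<in> Hom Box (Suc n) n"
  using box_arr.degen[of i "Suc n"] by (auto simp: Hom_Box degen_def)

lemma compose_restrict:
  "compose A (restrict g B) (restrict f A) = restrict h A"
  if "\<And>x. x \<in> A \<Longrightarrow> f x \<in> B" "\<And>x. x \<in> A \<Longrightarrow> g (f x) = h x"
  using that by (auto simp: compose_def restrict_def fun_eq_iff)

lemma compose_restrict_eq:
  "compose A (restrict g B) (restrict f A) = compose A (restrict g' B') (restrict f' A)"
  if "\<And>x. x \<in> A \<Longrightarrow> f x \<in> B" "\<And>x. x \<in> A \<Longrightarrow> f' x \<in> B'" "\<And>x. x \<in> A \<Longrightarrow> g (f x) = g' (f' x)"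
  using that by (auto simp: compose_def restrict_def fun_eq_iff)

section \<open>Cocubical relations between faces and degeneracies\<close>

lemma degen_face_same:
  assumes "1 \<le> i" "i \<le> Suc n"
  shows "cube_comp (degen (Suc n) i) (face (Suc n) i \<epsilon>) = cube_id n"
proof -
  from assms obtain j where "i = Suc j" by (cases i) auto
  with assms show ?thesis
    by (auto simp: cube_comp_eq degen_eq face_eq cube_id_def cube_def del_ins_same intro!: compose_restrict)
qed

lemma degen_face_less:
  assumes "1 \<le> j" "j < i" "i \<le> Suc (Suc n)"
  shows "cube_comp (degen (Suc (Suc n)) j) (face (Suc (Suc n)) i \<epsilon>) =
    cube_comp (face (Suc n) (i - 1) \<epsilon>) (degen (Suc n) j)"
proof -
  from assms obtain j' where j: "j = Suc j'" by (cases j) auto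
  with assms obtain i' where i: "i = Suc (Suc i')" by (metis Suc_le_D less_eq_Suc_le Suc_le_mono)
  show ?thesis
    using assms unfolding i j
    by (auto simp: cube_comp_eq degen_eq face_eq cube_def del_ins_less intro!: compose_restrict_eq)
qed

lemma degen_face_greater:
  assumes "1 \<le> i" "i < j" "j \<le> Suc (Suc n)"
  shows "cube_comp (degen (Suc (Suc n)) j) (face (Suc (Suc n)) i \<epsilon>) =
    cube_comp (face (Suc n) i \<epsilon>) (degen (Suc n) (j - 1))"
proof -
  from assms obtain i' where i: "i = Suc i'" by (cases i) auto
  with assms obtain j' where j: "j = Suc (Suc j')" by (metis Suc_le_D less_eq_Suc_le Suc_le_mono)
  show ?thesis
    using assms unfolding i j
    by (auto simp: cube_comp_eq degen_eq face_eq cube_def del_ins_greater intro!: compose_restrict_eq)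
qed

lemma face_face:
  assumes "1 \<le> i" "i < j" "j \<le> Suc (Suc n)"
  shows "cube_comp (face (Suc (Suc n)) j \<eta>) (face (Suc n) i \<epsilon>) =
    cube_comp (face (Suc (Suc n)) i \<epsilon>) (face (Suc n) (j - 1) \<eta>)"
proof -
  from assms obtain i' where i: "i = Suc i'" by (cases i) auto
  with assms obtain j' where j: "j = Suc (Suc j')" by (metis Suc_le_D less_eq_Suc_le Suc_le_mono)
  show ?thesis
    using assms unfolding i j
    by (auto simp: cube_comp_eq face_eq cube_def ins_ins intro!: compose_restrict_eq)
qed

section \<open>Unique factorization in the cube category\<close>

context category begin

lemma monoI:
  "f \<in> Hom C b c \<Longrightarrow> (\<And>a g h. g \<in> Hom C a b \<Longrightarrow> h \<in> Hom C a b \<Longrightarrow> f \<cdot> g = f \<cdot> h \<Longrightarrow> g = h)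
    \<Longrightarrow> is_mono C f"
  unfolding is_mono_def by (auto simp: Hom_def)

lemma epiI:
  "f \<in> Hom C a b \<Longrightarrow> (\<And>c g h. g \<in> Hom C b c \<Longrightarrow> h \<in> Hom C b c \<Longrightarrow> g \<cdot> f = h \<cdot> f \<Longrightarrow> g = h)
    \<Longrightarrow> is_epi C f"
  unfolding is_epi_def by (auto simp: Hom_def)

lemma monoD:
  "is_mono C f \<Longrightarrow> f \<in> Hom C b c \<Longrightarrow> g \<in> Hom C a b \<Longrightarrow> h \<in> Hom C a b \<Longrightarrow> f \<cdot> g = f \<cdot> h \<Longrightarrow> g = h"
  unfolding is_mono_def by (auto simp: Hom_def)

lemma epiD:
  "is_epi C f \<Longrightarrow> f \<in> Hom C a b \<Longrightarrow> g \<in> Hom C b c \<Longrightarrow> h \<in> Hom C b c \<Longrightarrow> g \<cdot> f = h \<cdot> f \<Longrightarrow> g = h"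
  unfolding is_epi_def by (auto simp: Hom_def)

lemma split_mono:
  assumes "f \<in> Hom C b c" "r \<in> Hom C c b" "r \<cdot> f = Idt C b"
  shows "is_mono C f"
proof (rule monoI[OF assms(1)])
  fix a g h assume *: "g \<in> Hom C a b" "h \<in> Hom C a b" "f \<cdot> g = f \<cdot> h"
  then have "(r \<cdot> f) \<cdot> g = (r \<cdot> f) \<cdot> h"
    by (simp only: comp_assoc[OF *(1) assms(1,2)] comp_assoc[OF *(2) assms(1,2)] *(3))
  then show "g = h" using * assms by (simp add: id_left)
qed

lemma split_epi:
  assumes "f \<in> Hom C a b" "s \<in> Hom C b a" "f \<cdot> s = Idt C b"
  shows "is_epi C f"
proof (rule epiI[OF assms(1)])
  fix c g h assume *: "g \<in> Hom C b c" "h \<in> Hom C b c" "g \<cdot> f = h \<cdot> f"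
  then have "g \<cdot> (f \<cdot> s) = h \<cdot> (f \<cdot> s)"
    by (simp only: comp_assoc[OF assms(2,1), symmetric])
  then show "g = h" using * assms by (simp add: id_right)
qed

lemma mono_cancel:
  assumes f: "f \<in> Hom C a b" and g: "g \<in> Hom C b c" and "is_mono C (g \<cdot> f)"
  shows "is_mono C f"
proof (rule monoI[OF f])
  fix d u v assume u: "u \<in> Hom C d a" and v: "v \<in> Hom C d a" and eq: "f \<cdot> u = f \<cdot> v"
  show "u = v"
    by (rule monoD[OF assms(3) comp_closed[OF f g] u v])
      (simp only: comp_assoc[OF u f g] comp_assoc[OF v f g] eq)
qed

lemma epi_cancel:
  assumes f: "f \<in> Hom C a b" and g: "g \<in> Hom C b c" and "is_epi C (g \<cdot> f)"
  shows "is_epi C g"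
proof (rule epiI[OF g])
  fix d u v assume u: "u \<in> Hom C c d" and v: "v \<in> Hom C c d" and eq: "u \<cdot> g = v \<cdot> g"
  show "u = v"
    by (rule epiD[OF assms(3) comp_closed[OF f g] u v])
      (simp only: comp_assoc[OF f g u, symmetric] comp_assoc[OF f g v, symmetric] eq)
qed

lemma mono_id: "a \<in> Obj C \<Longrightarrow> is_mono C (Idt C a)"
  by (rule split_mono[OF id_closed id_closed]) (auto intro: id_left id_closed)

lemma epi_id: "a \<in> Obj C \<Longrightarrow> is_epi C (Idt C a)"
  by (rule split_epi[OF id_closed id_closed]) (auto intro: id_left id_closed)

end

text \<open>The two images of a vertex differ in the inserted coordinate. This is what prevents a
  degeneracy from being mono and a face from being epi.\<close>

lemma face_neq:
  assumes "1 \<le> i" "i \<le> Suc n"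
  shows "face (Suc n) i (\<not> \<epsilon>) \<noteq> face (Suc n) i \<epsilon>"
proof
  assume "face (Suc n) i (\<not> \<epsilon>) = face (Suc n) i \<epsilon>"
  moreover obtain j where j: "i = Suc j" using assms by (cases i) auto
  ultimately have "(\<lambda>xs \<in> cube n. list_ins j (\<not> \<epsilon>) xs) = (\<lambda>xs \<in> cube n. list_ins j \<epsilon> xs)"
    by (simp add: face_eq)
  then have "list_ins j (\<not> \<epsilon>) (replicate n False) = list_ins j \<epsilon> (replicate n False)"
    by (auto dest: fun_cong[of _ _ "replicate n False"] simp: cube_def)
  then show False by (simp add: list_ins_def)
qed

text \<open>New degeneracies are added on the source side, because the operators on
  \<open>Lan X\<close> act by precomposition: a non-identity member then exhibits the degeneracy it
  comes from. Faces in \<open>iter_face\<close> are added on the target side, where arbitrary cube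
  maps are composed onto a normal form.\<close>

inductive iter_degen :: "nat \<Rightarrow> nat \<Rightarrow> cube_map \<Rightarrow> bool" where
  id: "iter_degen n n (cube_id n)"
| step: "\<lbrakk>iter_degen n k \<gamma>; 1 \<le> i; i \<le> Suc n\<rbrakk>
    \<Longrightarrow> iter_degen (Suc n) k (cube_comp \<gamma> (degen (Suc n) i))"

inductive iter_face :: "nat \<Rightarrow> nat \<Rightarrow> cube_map \<Rightarrow> bool" where
  id: "iter_face m m (cube_id m)"
| step: "\<lbrakk>iter_face m n \<mu>; 1 \<le> i; i \<le> Suc n\<rbrakk>
    \<Longrightarrow> iter_face m (Suc n) (cube_comp (face (Suc n) i \<epsilon>) \<mu>)"

lemmas Box_id_closed [simp] = Box.id_closed[simplified]
lemmas Box_comp_closed = Box.comp_closed[simplified]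
lemmas Box_comp_assoc = Box.comp_assoc[simplified]
lemmas Box_id_left [simp] = Box.id_left[simplified]
lemmas Box_id_right [simp] = Box.id_right[simplified]
lemmas Box_monoD = Box.monoD[simplified]
lemmas Box_epiD = Box.epiD[simplified]

lemma iter_degen_Hom: "iter_degen n k \<gamma> \<Longrightarrow> \<gamma> \<in> Hom Box n k"
proof (induction rule: iter_degen.induct)
  case (step n k \<gamma> i)
  then show ?case by (metis Box_comp_closed degen_Hom)
qed (rule Box_id_closed)

lemma iter_face_Hom: "iter_face m n \<mu> \<Longrightarrow> \<mu> \<in> Hom Box m n"
proof (induction rule: iter_face.induct)
  case (step m n \<mu> i \<epsilon>)
  then show ?case by (metis Box_comp_closed face_Hom)
qed (rule Box_id_closed)

lemma face_mono: "1 \<le> i \<Longrightarrow> i \<le> Suc n \<Longrightarrow> is_mono Box (face (Suc n) i \<epsilon>)"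
  by (rule Box.split_mono[OF face_Hom degen_Hom]) (auto simp: degen_face_same)

text \<open>Each degeneracy has a face as a section, and sections compose in the reverse order. The
  section itself is used again to compare two factorizations of one map.\<close>

lemma iter_degen_split: "iter_degen n k \<gamma> \<Longrightarrow> \<exists>s \<in> Hom Box k n. cube_comp \<gamma> s = cube_id k"
proof (induction rule: iter_degen.induct)
  case (id n)
  show ?case using Box_id_closed Box_id_left by blast
next
  case (step n k \<gamma> i)
  then obtain s where s: "s \<in> Hom Box k n" "cube_comp \<gamma> s = cube_id k" by auto
  note H = iter_degen_Hom[OF step.hyps(1)] degen_Hom[OF step.hyps(2,3)] face_Hom[OF step.hyps(2,3), of False]
  \<comment> \<open>Either end of the interval would give a section; \<open>False\<close> is an
    arbitrary choice.\<close>
  let ?s = "cube_comp (face (Suc n) i False) s"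
  have "cube_comp (cube_comp \<gamma> (degen (Suc n) i)) ?s = cube_comp \<gamma> (cube_comp (degen (Suc n) i) ?s)"
    by (rule Box_comp_assoc[OF Box_comp_closed[OF s(1) H(3)] H(2,1)])
  also have "cube_comp (degen (Suc n) i) ?s = s"
    by (simp only: Box_comp_assoc[OF s(1) H(3,2), symmetric] degen_face_same[OF step.hyps(2,3)]
        Box_id_left[OF s(1)])
  finally show ?case using s(2) by (intro bexI[OF _ Box_comp_closed[OF s(1) H(3)]]) simp
qed

lemma iter_face_split: "iter_face m n \<mu> \<Longrightarrow> \<exists>r \<in> Hom Box n m. cube_comp r \<mu> = cube_id m"
proof (induction rule: iter_face.induct)
  case (id n)
  show ?case using Box_id_closed Box_id_left by blast
next
  case (step m n \<mu> i \<epsilon>)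
  then obtain r where r: "r \<in> Hom Box n m" "cube_comp r \<mu> = cube_id m" by auto
  note H = iter_face_Hom[OF step.hyps(1)] degen_Hom[OF step.hyps(2,3)] face_Hom[OF step.hyps(2,3), of \<epsilon>]
  let ?r = "cube_comp r (degen (Suc n) i)"
  have "cube_comp ?r (cube_comp (face (Suc n) i \<epsilon>) \<mu>) = cube_comp (cube_comp ?r (face (Suc n) i \<epsilon>)) \<mu>"
    by (rule Box_comp_assoc[OF H(1,3) Box_comp_closed[OF H(2) r(1)], symmetric])
  also have "cube_comp ?r (face (Suc n) i \<epsilon>) = r"
    by (simp only: Box_comp_assoc[OF H(3,2) r(1)] degen_face_same[OF step.hyps(2,3)]
        Box_id_right[OF r(1)])
  finally show ?case using r(2) by (intro bexI[OF _ Box_comp_closed[OF H(2) r(1)]]) simp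
qed

lemma iter_degen_epi: "iter_degen n k \<gamma> \<Longrightarrow> is_epi Box \<gamma>"
  using iter_degen_split[of n k \<gamma>] Box.split_epi[OF iter_degen_Hom] by (metis Box_simps(3,4))

lemma iter_face_mono: "iter_face m n \<mu> \<Longrightarrow> is_mono Box \<mu>"
  using iter_face_split[of m n \<mu>] Box.split_mono[OF iter_face_Hom] by (metis Box_simps(3,4))

lemma iter_degen_comp:
  assumes "iter_degen m n \<beta>" "iter_degen n k \<gamma>"
  shows "iter_degen m k (cube_comp \<gamma> \<beta>)"
  using assms
proof (induction rule: iter_degen.induct)
  case (id n)
  then show ?case using Box_id_right[OF iter_degen_Hom] by simp
next
  case (step m n \<beta> i)
  then have "cube_comp \<gamma> (cube_comp \<beta> (degen (Suc m) i)) = cube_comp (cube_comp \<gamma> \<beta>) (degen (Suc m) i)"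
    using Box_comp_assoc[OF degen_Hom iter_degen_Hom iter_degen_Hom] by metis
  then show ?case using iter_degen.step[OF step.IH[OF step.prems] step.hyps(2,3)] by simp
qed

lemma iter_degen_single: "1 \<le> i \<Longrightarrow> i \<le> Suc n \<Longrightarrow> iter_degen (Suc n) n (degen (Suc n) i)"
  using iter_degen.step[OF iter_degen.id, of i n] degen_Hom[of i n] by simp

text \<open>The degeneracy is pushed through the faces from left to right. Either it meets a face of
  its own index and cancels, or it passes all of them with shifted indices and comes out on the
  source side.\<close>

lemma degen_iter_face:
  assumes "iter_face m n \<mu>" "n = Suc n'" "1 \<le> j" "j \<le> n"
  shows "iter_face m n' (cube_comp (degen n j) \<mu>) \<or>
    (\<exists>m' i \<nu>. m = Suc m' \<and> 1 \<le> i \<and> i \<le> m \<and> iter_face m' n' \<nu> \<and>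
      cube_comp (degen n j) \<mu> = cube_comp \<nu> (degen m i))"
  using assms
proof (induction arbitrary: n' j rule: iter_face.induct)
  case (id m)
  then have "cube_comp (degen m j) (cube_id m) = cube_comp (cube_id n') (degen m j)"
    using degen_Hom[of j n'] by simp
  moreover have "iter_face n' n' (cube_id n')" by (rule iter_face.id)
  ultimately show ?case
    using id by (intro disjI2 exI[of _ n'] exI[of _ j] exI[of _ "cube_id n'"] conjI)
next
  case (step m n \<mu> i \<epsilon>)
  then have [simp]: "n' = n" by simp
  note H = iter_face_Hom[OF step.hyps(1)] degen_Hom[OF step.prems(2,3)]
    face_Hom[OF step.hyps(2,3), of \<epsilon>]
  have e: "cube_comp (degen (Suc n) j) (cube_comp (face (Suc n) i \<epsilon>) \<mu>) =
      cube_comp (cube_comp (degen (Suc n) j) (face (Suc n) i \<epsilon>)) \<mu>"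
    by (rule Box_comp_assoc[OF H(1,3,2), symmetric])
  show ?case
  proof (cases "i = j")
    case True
    then have "cube_comp (degen (Suc n) j) (cube_comp (face (Suc n) i \<epsilon>) \<mu>) = \<mu>"
      using e degen_face_same[OF step.hyps(2,3), of \<epsilon>] Box_id_left[OF H(1)] by simp
    then show ?thesis using step.hyps(1) by simp
  next
    case False
    \<comment> \<open>Two different indices between 1 and \<open>Suc n\<close> force
      \<open>n\<close> to be positive, so the relations that exchange a face and a degeneracy apply
      one dimension lower.\<close>
    then obtain n'' where [simp]: "n = Suc n''"
      using step.hyps step.prems by (cases n) auto
    obtain i' j' where ij: "1 \<le> i'" "i' \<le> n" "1 \<le> j'" "j' \<le> n" and
      s: "cube_comp (degen (Suc n) j) (face (Suc n) i \<epsilon>) = cube_comp (face n i' \<epsilon>) (degen n j')"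
    proof (cases "i < j")
      case True
      with step.hyps step.prems show ?thesis
        using degen_face_greater[of i j n'' \<epsilon>] that[of i "j - 1"] by auto
    next
      case False
      with \<open>i \<noteq> j\<close> step.hyps step.prems show ?thesis
        using degen_face_less[of j i n'' \<epsilon>] that[of "i - 1" j] by auto
    qed
    note H' = degen_Hom[of j' n''] face_Hom[of i' n'' \<epsilon>]
    have e': "cube_comp (degen (Suc n) j) (cube_comp (face (Suc n) i \<epsilon>) \<mu>) =
        cube_comp (face n i' \<epsilon>) (cube_comp (degen n j') \<mu>)"
      unfolding e s using Box_comp_assoc H H' ij by auto
    from step.IH[OF \<open>n = Suc n''\<close> ij(3,4)] show ?thesis
    proof (elim disjE exE conjE)
      assume "iter_face m n'' (cube_comp (degen n j') \<mu>)"
      then show ?thesis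
        unfolding e' using iter_face.step ij by auto
    next
      fix m' l \<nu>
      assume m: "m = Suc m'" and l: "1 \<le> l" "l \<le> m" and \<nu>: "iter_face m' n'' \<nu>"
        and eq: "cube_comp (degen n j') \<mu> = cube_comp \<nu> (degen m l)"
      have "cube_comp (face n i' \<epsilon>) (cube_comp \<nu> (degen m l)) =
          cube_comp (cube_comp (face n i' \<epsilon>) \<nu>) (degen m l)"
        using \<nu> m l ij H' degen_Hom[of l m'] iter_face_Hom[OF \<nu>] Box_comp_assoc by auto
      then show ?thesis
        unfolding e' eq using iter_face.step[OF \<nu>, of i' \<epsilon>] ij m l by (metis \<open>n = Suc n''\<close> \<open>n' = n\<close>)
    qed
  qed
qed

section \<open>Existence of the normal form\<close>

lemma face_comp_normal_form:
  assumes "iter_degen m k \<gamma>" "iter_face k n \<mu>" "1 \<le> i" "i \<le> Suc n"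
  shows "\<exists>k \<gamma>' \<mu>'. iter_degen m k \<gamma>' \<and> iter_face k (Suc n) \<mu>' \<and>
    cube_comp (face (Suc n) i \<epsilon>) (cube_comp \<mu> \<gamma>) = cube_comp \<mu>' \<gamma>'"
  using assms Box_comp_assoc[OF iter_degen_Hom[OF assms(1)] iter_face_Hom[OF assms(2)] face_Hom[OF assms(3,4)]]
  by (metis iter_face.step)

lemma degen_comp_normal_form:
  assumes "iter_degen m k \<gamma>" "iter_face k (Suc n) \<mu>" "1 \<le> i" "i \<le> Suc n"
  shows "\<exists>k \<gamma>' \<mu>'. iter_degen m k \<gamma>' \<and> iter_face k n \<mu>' \<and>
    cube_comp (degen (Suc n) i) (cube_comp \<mu> \<gamma>) = cube_comp \<mu>' \<gamma>'"
proof -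
  note H = iter_degen_Hom[OF assms(1)] iter_face_Hom[OF assms(2)] degen_Hom[OF assms(3,4)]
  have e: "cube_comp (degen (Suc n) i) (cube_comp \<mu> \<gamma>) = cube_comp (cube_comp (degen (Suc n) i) \<mu>) \<gamma>"
    by (rule Box_comp_assoc[OF H, symmetric])
  from degen_iter_face[OF assms(2) refl assms(3,4)] show ?thesis
  proof (elim disjE exE conjE)
    assume "iter_face k n (cube_comp (degen (Suc n) i) \<mu>)"
    then show ?thesis using e assms by metis
  next
    fix k' l \<nu>
    assume k: "k = Suc k'" and l: "1 \<le> l" "l \<le> k" and \<nu>: "iter_face k' n \<nu>"
      and eq: "cube_comp (degen (Suc n) i) \<mu> = cube_comp \<nu> (degen k l)"
    have "cube_comp (cube_comp \<nu> (degen k l)) \<gamma> = cube_comp \<nu> (cube_comp (degen k l) \<gamma>)"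
      using k l H iter_face_Hom[OF \<nu>] degen_Hom[of l k'] Box_comp_assoc by auto
    moreover have "iter_degen m k' (cube_comp (degen k l) \<gamma>)"
      using iter_degen_comp[OF assms(1)] iter_degen_single[of l k'] k l by auto
    ultimately show ?thesis unfolding e eq using \<nu> by metis
  qed
qed

text \<open>The claim is about composing \<alpha> onto an arbitrary normal form, not about \<alpha>
  alone. A composite is then handled by applying the two induction hypotheses one after the other,
  and two normal forms never have to be multiplied.\<close>

lemma comp_normal_form:
  assumes "\<alpha> \<in> box_arr" "\<alpha> \<in> Hom Box n p" "iter_degen m k \<gamma>" "iter_face k n \<mu>"
  shows "\<exists>k \<gamma>' \<mu>'. iter_degen m k \<gamma>' \<and> iter_face k p \<mu>' \<and>
    cube_comp \<alpha> (cube_comp \<mu> \<gamma>) = cube_comp \<mu>' \<gamma>'"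
  using assms
proof (induction arbitrary: n p m k \<gamma> \<mu> rule: box_arr.induct)
  case (id l)
  then have [simp]: "l = n" "p = n" by (auto simp: Hom_Box cube_id_def)
  have "cube_comp \<mu> \<gamma> \<in> Hom Box m n"
    using id iter_degen_Hom iter_face_Hom Box_comp_closed by metis
  then have "cube_comp (cube_id l) (cube_comp \<mu> \<gamma>) = cube_comp \<mu> \<gamma>" by simp
  then show ?case using id.prems(2,3) unfolding \<open>p = n\<close> by metis
next
  case (face i l \<epsilon>)
  then have "l = Suc n" "p = Suc n" by (auto simp: Hom_Box face_def)
  then show ?case using face face_comp_normal_form by metis
next
  case (degen i l)
  then have "l = Suc p" "n = Suc p" by (auto simp: Hom_Box degen_def)
  then show ?case using degen degen_comp_normal_form by metis
next
  case (comp a f b g c)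
  then have ac: "a = n" "c = p" by (auto simp: Hom_Box cube_comp_eq)
  have f: "(a, f, b) \<in> Hom Box n b" and g: "(b, g, c) \<in> Hom Box b p"
    using comp.hyps by (auto simp: Hom_Box ac)
  obtain k1 \<gamma>1 \<mu>1 where 1: "iter_degen m k1 \<gamma>1" "iter_face k1 b \<mu>1"
    "cube_comp (a, f, b) (cube_comp \<mu> \<gamma>) = cube_comp \<mu>1 \<gamma>1"
    using comp.IH(1)[OF f comp.prems(2,3)] that by metis
  obtain k2 \<gamma>2 \<mu>2 where 2: "iter_degen m k2 \<gamma>2" "iter_face k2 p \<mu>2"
    "cube_comp (b, g, c) (cube_comp \<mu>1 \<gamma>1) = cube_comp \<mu>2 \<gamma>2"
    using comp.IH(2)[OF g 1(1,2)] that by metis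
  have "cube_comp (cube_comp (b, g, c) (a, f, b)) (cube_comp \<mu> \<gamma>) =
      cube_comp (b, g, c) (cube_comp (a, f, b) (cube_comp \<mu> \<gamma>))"
    using Box_comp_closed[OF iter_degen_Hom[OF comp.prems(2)] iter_face_Hom[OF comp.prems(3)]]
    by (rule Box_comp_assoc[OF _ f g])
  then show ?case using 1 2 by metis
qed

lemma Box_normal_form:
  assumes "\<alpha> \<in> Hom Box m n"
  obtains k \<gamma> \<mu> where "iter_degen m k \<gamma>" "iter_face k n \<mu>" "\<alpha> = cube_comp \<mu> \<gamma>"
proof -
  \<comment> \<open>The identity is the normal form without faces and degeneracies, and \<alpha> is
    composed onto it.\<close>
  have "cube_comp \<alpha> (cube_comp (cube_id m) (cube_id m)) = \<alpha>"
    using Box_id_right[OF assms] Box_id_left[OF Box_id_closed, of m] by simp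
  moreover have "\<alpha> \<in> box_arr" using assms by (simp add: Hom_Box)
  ultimately show ?thesis
    using comp_normal_form[OF _ assms iter_degen.id iter_face.id] that by metis
qed

text \<open>Otherwise the first degeneracy is mono by cancellation; but the two faces of the same
  index are both sections of it, and a mono would identify them.\<close>

lemma iter_degen_mono_id:
  assumes "iter_degen n k \<gamma>" "is_mono Box \<gamma>"
  shows "n = k \<and> \<gamma> = cube_id n"
  using assms
proof (cases rule: iter_degen.cases)
  case (step n' \<gamma>' i)
  note H = degen_Hom[OF step(4,5)] face_Hom[OF step(4,5)] iter_degen_Hom[OF step(3)]
  have "is_mono Box (degen (Suc n') i)"
    using assms(2) H Box.mono_cancel[OF H(1,3)] step by simp
  then have "face (Suc n') i False = face (Suc n') i True"
    using Box_monoD[OF _ H(1) H(2) H(2)] degen_face_same[OF step(4,5)] by metis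
  then show ?thesis using face_neq[OF step(4,5), of True] by simp
qed auto

text \<open>Otherwise the last face \<delta> is epi by cancellation. With \<sigma> its retraction,
  \<delta>\<sigma>\<delta> = \<delta>, so cancelling \<delta> makes \<delta>\<sigma> the identity.
  Yet \<delta>\<sigma> also sends the opposite face to \<delta>, and the two faces would
  coincide.\<close>

lemma iter_face_epi_id:
  assumes "iter_face k n \<mu>" "is_epi Box \<mu>"
  shows "k = n \<and> \<mu> = cube_id n"
  using assms
proof (cases rule: iter_face.cases)
  case (step n' \<mu>' i \<epsilon>)
  note H = degen_Hom[OF step(4,5)] face_Hom[OF step(4,5)] iter_face_Hom[OF step(3)]
  have epi: "is_epi Box (face (Suc n') i \<epsilon>)"
    using assms(2) H Box.epi_cancel[OF H(3,2)] step by simp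
  let ?e = "cube_comp (face (Suc n') i \<epsilon>) (degen (Suc n') i)"
  have e: "?e \<in> Hom Box (Suc n') (Suc n')" using H Box_comp_closed by metis
  have e_face: "cube_comp ?e (face (Suc n') i \<eta>) = face (Suc n') i \<epsilon>" for \<eta>
    by (simp only: Box_comp_assoc[OF H(2,1) H(2)] degen_face_same[OF step(4,5)] Box_id_right[OF H(2)])
  then have "cube_comp ?e (face (Suc n') i \<epsilon>) = cube_comp (cube_id (Suc n')) (face (Suc n') i \<epsilon>)"
    by (simp only: Box_id_left[OF H(2)])
  from Box_epiD[OF epi H(2) e _ this] have eq: "?e = cube_id (Suc n')" by simp
  have "face (Suc n') i (\<not> \<epsilon>) = cube_comp ?e (face (Suc n') i (\<not> \<epsilon>))"
    by (simp only: eq Box_id_left[OF H(2)])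
  also have "\<dots> = face (Suc n') i \<epsilon>"
    by (rule e_face)
  finally show ?thesis using face_neq[OF step(4,5)] by simp
qed auto

text \<open>The face part of a normal form of an epimorphism is again epi, hence an identity. From
  here on the categorical condition in \<open>Lan\<close> can be treated combinatorially.\<close>

lemma epi_iff_iter_degen:
  assumes "\<alpha> \<in> Hom Box m n"
  shows "is_epi Box \<alpha> \<longleftrightarrow> iter_degen m n \<alpha>"
proof
  assume epi: "is_epi Box \<alpha>"
  from Box_normal_form[OF assms] obtain k \<gamma> \<mu>
    where *: "iter_degen m k \<gamma>" "iter_face k n \<mu>" "\<alpha> = cube_comp \<mu> \<gamma>" .
  then have "is_epi Box \<mu>"
    using Box.epi_cancel[OF iter_degen_Hom iter_face_Hom] epi by auto
  then show "iter_degen m n \<alpha>"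
    using iter_face_epi_id[OF *(2)] * Box_id_left[OF iter_degen_Hom[OF *(1)]] by simp
qed (rule iter_degen_epi)

text \<open>The cube category has no permutations or reversals of coordinates. This makes epi-mono
  factorizations unique on the nose, which the definite descriptions in \<open>epi_part\<close> and
  \<open>mono_part\<close> require.\<close>

lemma iso_Box_id:
  assumes "\<alpha> \<in> Hom Box m n" "is_epi Box \<alpha>" "is_mono Box \<alpha>"
  shows "m = n \<and> \<alpha> = cube_id m"
  using iter_degen_mono_id epi_iff_iter_degen assms by metis

text \<open>Composing a section of one epimorphism with the other epimorphism gives maps
  \<open>?u\<close> and \<open>?v\<close> between the two middle cubes. They are compatible with the
  monomorphisms, hence mutually inverse, and an invertible cube map is an identity.\<close>

lemma factorization_unique:
  assumes "is_epi Box e" "e \<in> Hom Box m k" "is_mono Box \<mu>" "\<mu> \<in> Hom Box k n"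
    and "is_epi Box e'" "e' \<in> Hom Box m k'" "is_mono Box \<mu>'" "\<mu>' \<in> Hom Box k' n"
    and eq: "cube_comp \<mu> e = cube_comp \<mu>' e'"
  shows "k = k' \<and> e = e' \<and> \<mu> = \<mu>'"
proof -
  obtain s where s: "s \<in> Hom Box k m" "cube_comp e s = cube_id k"
    using iter_degen_split epi_iff_iter_degen assms by metis
  obtain s' where s': "s' \<in> Hom Box k' m" "cube_comp e' s' = cube_id k'"
    using iter_degen_split epi_iff_iter_degen assms by metis
  let ?u = "cube_comp e' s" and ?v = "cube_comp e s'"
  have u: "?u \<in> Hom Box k k'" and v: "?v \<in> Hom Box k' k"
    using Box_comp_closed[OF s(1) assms(6)] Box_comp_closed[OF s'(1) assms(2)] by auto
  have 1: "cube_comp \<mu>' ?u = \<mu>"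
    using Box_comp_assoc[OF s(1) assms(6,8)] Box_comp_assoc[OF s(1) assms(2,4)] eq s(2)
      Box_id_right[OF assms(4)] by simp
  have 2: "cube_comp \<mu> ?v = \<mu>'"
    using Box_comp_assoc[OF s'(1) assms(6,8)] Box_comp_assoc[OF s'(1) assms(2,4)] eq s'(2)
      Box_id_right[OF assms(8)] by simp
  have "cube_comp \<mu> (cube_comp ?v ?u) = cube_comp \<mu> (cube_id k)"
    by (simp only: Box_comp_assoc[OF u v assms(4), symmetric] 1 2 Box_id_right[OF assms(4)])
  then have vu: "cube_comp ?v ?u = cube_id k"
    by (rule Box_monoD[OF assms(3,4) Box_comp_closed[OF u v] Box_id_closed])
  have "cube_comp \<mu>' (cube_comp ?u ?v) = cube_comp \<mu>' (cube_id k')"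
    by (simp only: Box_comp_assoc[OF v u assms(8), symmetric] 1 2 Box_id_right[OF assms(8)])
  then have uv: "cube_comp ?u ?v = cube_id k'"
    by (rule Box_monoD[OF assms(7,8) Box_comp_closed[OF v u] Box_id_closed])
  have "k = k' \<and> ?u = cube_id k"
    using iso_Box_id[OF u] Box.split_epi[OF u v] Box.split_mono[OF u v] uv vu by simp
  with 1 have k: "k = k'" and \<mu>: "\<mu> = \<mu>'" using assms by auto
  moreover have "e = e'" using Box_monoD[OF assms(3,4,2)] assms k \<mu> by metis
  ultimately show ?thesis by simp
qed

lemma factorization_exists:
  assumes "\<alpha> \<in> Hom Box m n"
  obtains k \<gamma> \<mu> where "is_epi Box \<gamma>" "\<gamma> \<in> Hom Box m k" "is_mono Box \<mu>" "\<mu> \<in> Hom Box k n"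
    "\<alpha> = cube_comp \<mu> \<gamma>"
  using Box_normal_form[OF assms] iter_degen_epi iter_face_mono iter_degen_Hom iter_face_Hom by metis

lemma factorization_parts:
  assumes "is_epi Box e" "e \<in> Hom Box m k" "is_mono Box \<mu>" "\<mu> \<in> Hom Box k n"
  shows "epi_part (cube_comp \<mu> e) = e" "mono_part (cube_comp \<mu> e) = \<mu>"
proof -
  have uniq: "e' = e \<and> \<mu>' = \<mu>" if "is_factorization (cube_comp \<mu> e) \<mu>' e'" for e' \<mu>'
  proof -
    from that have f: "is_mono Box \<mu>'" "is_epi Box e'" "Cod Box e' = Dom Box \<mu>'"
      "cube_comp \<mu>' e' = cube_comp \<mu> e"
      by (simp_all add: is_factorization_def)
    then have "e' \<in> box_arr" "\<mu>' \<in> box_arr"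
      by (simp_all add: is_mono_def is_epi_def)
    then obtain a b c where h: "e' \<in> Hom Box a b" "\<mu>' \<in> Hom Box b c"
      using f(3) that unfolding Hom_def by force
    \<comment> \<open>\<open>is_factorization\<close> leaves the dimensions open; source and target
      of the competing factorization are read off the common composite.\<close>
    then have "cube_comp \<mu> e \<in> Hom Box a c"
      using f(4) Box_comp_closed by metis
    moreover have "cube_comp \<mu> e \<in> Hom Box m n"
      using assms Box_comp_closed by metis
    ultimately have "a = m" "c = n" by (auto simp: Hom_def)
    then show ?thesis using factorization_unique[OF assms f(2) _ f(1)] h f by metis
  qed
  have fac: "is_factorization (cube_comp \<mu> e) \<mu> e"
    using assms by (auto simp: is_factorization_def Hom_def)
  show "epi_part (cube_comp \<mu> e) = e" "mono_part (cube_comp \<mu> e) = \<mu>"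
    unfolding epi_part_def mono_part_def using fac uniq by blast+
qed

section \<open>Alternating sums and coproducts\<close>

lemma hom_finprod:
  assumes "comm_group G" "comm_group H" "h \<in> hom G H" "f \<in> I \<rightarrow> carrier G"
  shows "h (finprod G f I) = finprod H (\<lambda>i. h (f i)) I"
proof -
  interpret G: comm_group G by fact
  interpret H: comm_group H by fact
  have one: "h \<one>\<^bsub>G\<^esub> = \<one>\<^bsub>H\<^esub>"
    using hom_one[OF assms(3)] by (simp add: G.is_group H.is_group)
  show ?thesis
    using assms(4)
  proof (induction I rule: infinite_finite_induct)
    case (insert i I)
    then have "f \<in> I \<rightarrow> carrier G" "f i \<in> carrier G" by auto
    moreover from this have "(\<lambda>i. h (f i)) \<in> I \<rightarrow> carrier H" "h (f i) \<in> carrier H"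
      using hom_in_carrier[OF assms(3)] by auto
    ultimately show ?case
      using insert hom_mult[OF assms(3)] by (simp add: G.finprod_closed)
  qed (simp_all add: one)
qed

lemma (in comm_group) finprod_int_pow:
  assumes "f \<in> I \<rightarrow> carrier G"
  shows "finprod G f I [^] (k :: int) = finprod G (\<lambda>i. f i [^] k) I"
proof -
  have "(\<lambda>x. x [^] k) \<in> hom G G"
    by (auto simp: hom_def int_pow_distrib)
  from hom_finprod[OF _ _ this assms] show ?thesis
    using comm_group_axioms by auto
qed

text \<open>The terms with \<open>i < j\<close> are paired with those with
  \<open>i \<ge> j\<close> by \<open>(i, j) \<mapsto> (j - 1, i)\<close>, which changes the sign.\<close>

lemma (in comm_group) alternating_double_finprod:
  fixes a :: "nat \<Rightarrow> nat \<Rightarrow> 'a"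
  assumes closed: "\<And>i j. i \<in> {1..n} \<Longrightarrow> j \<in> {1..Suc n} \<Longrightarrow> a i j \<in> carrier G"
    and sym: "\<And>i j. 1 \<le> i \<Longrightarrow> i < j \<Longrightarrow> j \<le> Suc n \<Longrightarrow> a i j = a (j - 1) i"
  shows "finprod G (\<lambda>i. finprod G (\<lambda>j. a i j [^] ((- 1) ^ j :: int)) {1..Suc n} [^] ((- 1) ^ i :: int)) {1..n} = \<one>"
proof -
  define b where "b = (\<lambda>(i, j). a i j [^] ((- 1) ^ (i + j) :: int))"
  let ?P = "{1..n} \<times> {1..Suc n}"
  define P1 where "P1 = {(i, j). 1 \<le> i \<and> i < j \<and> j \<le> Suc n}"
  define P2 where "P2 = {(i, j). 1 \<le> j \<and> j \<le> i \<and> i \<le> n}"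
  define t where "t = (\<lambda>(i :: nat, j :: nat). (j - 1, i))"
  have P: "?P = P1 \<union> P2" "P1 \<inter> P2 = {}" "P2 = t ` P1"
    and P12: "P1 \<subseteq> ?P" "P2 \<subseteq> ?P" and inj: "inj_on t P1"
  proof -
    show "P2 = t ` P1"
    proof (intro equalityI subsetI)
      fix p assume "p \<in> P2"
      then obtain i j where "p = (i, j)" "1 \<le> j" "j \<le> i" "i \<le> n" by (auto simp: P2_def)
      then have "p = t (j, Suc i)" "(j, Suc i) \<in> P1" by (auto simp: t_def P1_def)
      then show "p \<in> t ` P1" by blast
    qed (auto simp: P1_def P2_def t_def)
    show "inj_on t P1" by (auto simp: inj_on_def t_def P1_def)
  qed (auto simp: P1_def P2_def)
  then have fin: "finite P1" "finite P2" by (meson finite_SigmaI finite_atLeastAtMost finite_subset)+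
  have b: "b \<in> ?P \<rightarrow> carrier G" using closed by (auto simp: b_def)
  have b1: "b \<in> P1 \<rightarrow> carrier G" and b2: "b \<in> P2 \<rightarrow> carrier G" using b P12 by auto
  have bt: "b (t p) = inv (b p)" if "p \<in> P1" for p
  proof -
    from that obtain i j where p: "p = (i, j)" "1 \<le> i" "i < j" "j \<le> Suc n" by (auto simp: P1_def)
    then obtain j' where j: "j = Suc j'" by (cases j) auto
    have "a i j \<in> carrier G" using closed p by auto
    then show ?thesis
      using sym[OF p(2-4)] p(1) j
      by (simp add: b_def t_def int_pow_neg[symmetric] add.commute)
  qed
  \<comment> \<open>The outer sign is moved into the inner product, which turns the iterated product
    into a single product of \<open>b\<close> over the rectangle of index pairs.\<close>
  have "finprod G (\<lambda>i. finprod G (\<lambda>j. a i j [^] ((- 1) ^ j :: int)) {1..Suc n} [^] ((- 1) ^ i :: int)) {1..n}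
      = finprod G (\<lambda>i. finprod G b (Pair i ` {1..Suc n})) {1..n}"
  proof (rule finprod_cong')
    fix i assume i: "i \<in> {1..n}"
    then have c: "(\<lambda>j. a i j [^] ((- 1) ^ j :: int)) \<in> {1..Suc n} \<rightarrow> carrier G"
      using closed by auto
    have "finprod G b (Pair i ` {1..Suc n}) = finprod G (\<lambda>j. b (i, j)) {1..Suc n}"
      by (rule finprod_reindex) (use b i in \<open>auto simp: inj_on_def\<close>)
    also have "\<dots> = finprod G (\<lambda>j. (a i j [^] ((- 1) ^ j :: int)) [^] ((- 1) ^ i :: int)) {1..Suc n}"
    proof (rule finprod_cong')
      fix j assume "j \<in> {1..Suc n}"
      then show "b (i, j) = (a i j [^] ((- 1) ^ j :: int)) [^] ((- 1) ^ i :: int)"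
        using closed[OF i] by (simp only: b_def int_pow_pow power_add case_prod_conv mult.commute)
    qed (use closed i in auto)
    finally show "finprod G (\<lambda>j. a i j [^] ((- 1) ^ j :: int)) {1..Suc n} [^] ((- 1) ^ i :: int)
        = finprod G b (Pair i ` {1..Suc n})"
      using finprod_int_pow[OF c] by simp
  next
    show "(\<lambda>i. finprod G b (Pair i ` {1..Suc n})) \<in> {1..n} \<rightarrow> carrier G"
      using b by (auto intro!: finprod_closed)
  qed simp
  also have "\<dots> = finprod G b (\<Union>i \<in> {1..n}. Pair i ` {1..Suc n})"
    by (rule finprod_UN_disjoint[symmetric]) (use b in \<open>auto simp: pairwise_def disjnt_def\<close>)
  also have "(\<Union>i \<in> {1..n}. Pair i ` {1..Suc n}) = P1 \<union> P2"
    unfolding P(1)[symmetric] by auto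
  also have "finprod G b (P1 \<union> P2) = finprod G b P1 \<otimes> finprod G b P2"
    by (rule finprod_Un_disjoint[OF fin P(2) b1 b2])
  also have "finprod G b P2 = finprod G (\<lambda>p. b (t p)) P1"
    using finprod_reindex[OF _ inj, of b] b2 P(3) by simp
  also have "\<dots> = finprod G (\<lambda>p. inv (b p)) P1"
    by (rule finprod_cong') (use bt b1 in auto)
  also have "finprod G b P1 \<otimes> \<dots> = finprod G (\<lambda>p. b p \<otimes> inv (b p)) P1"
    by (rule finprod_multf[symmetric]) (use b1 in auto)
  also have "\<dots> = \<one>"
    by (rule finprod_one_eqI) (use b1 in \<open>auto simp: Pi_iff\<close>)
  finally show ?thesis .
qed

section \<open>Differences and alternating sums of arrows\<close>

lemma hom_group_simps [simp]:
  "carrier (hom_group A a b) = Hom A a b" "mult (hom_group A a b) = Plus A"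
  "one (hom_group A a b) = Zero A a b"
  by (simp_all add: hom_group_def)

definition hom_diff :: "('o, 'm, 'z) ab_cat_scheme \<Rightarrow> 'o \<Rightarrow> 'o \<Rightarrow> 'm \<Rightarrow> 'm \<Rightarrow> 'm" where
  "hom_diff A a b f g = f \<otimes>\<^bsub>hom_group A a b\<^esub> inv\<^bsub>hom_group A a b\<^esub> g"

text \<open>The shape of \<open>chain_diff\<close> with a free summand. Composition with an arrow is
  a homomorphism of hom-groups, so it can be moved under the sum once and for all.\<close>

definition alt_sum :: "('o, 'm, 'z) ab_cat_scheme \<Rightarrow> 'o \<Rightarrow> 'o \<Rightarrow> (nat \<Rightarrow> 'm) \<Rightarrow> nat \<Rightarrow> 'm" where
  "alt_sum A a b u n = finprod (hom_group A a b) (\<lambda>i. u i [^]\<^bsub>hom_group A a b\<^esub> ((- 1) ^ i :: int)) {1..n}"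

context category begin

lemma Hom_Obj: "f \<in> Hom C a b \<Longrightarrow> a \<in> Obj C" "f \<in> Hom C a b \<Longrightarrow> b \<in> Obj C"
  using dom_closed cod_closed by (auto simp: Hom_def)

lemma is_isomorphismI:
  "f \<in> Hom C a b \<Longrightarrow> g \<in> Hom C b a \<Longrightarrow> g \<cdot> f = Idt C a \<Longrightarrow> f \<cdot> g = Idt C b \<Longrightarrow> is_isomorphism C f"
  unfolding is_isomorphism_def by (auto simp: Hom_def)

end

context preadditive_category begin

lemma hom_comm_group_Hom: "f \<in> Hom A a b \<Longrightarrow> comm_group (hom_group A a b)"
  using hom_comm_group Hom_Obj by blast

lemma hom_group_Hom: "f \<in> Hom A a b \<Longrightarrow> group (hom_group A a b)"
  using hom_comm_group_Hom comm_group.axioms(2) by blast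

lemma comp_left_hom:
  "h \<in> Hom A b c \<Longrightarrow> (\<lambda>u. h \<cdot> u) \<in> hom (hom_group A a b) (hom_group A a c)"
  by (rule homI) (auto simp: comp_plus_right comp_closed)

lemma comp_right_hom:
  "h \<in> Hom A a b \<Longrightarrow> (\<lambda>u. u \<cdot> h) \<in> hom (hom_group A b c) (hom_group A a c)"
  by (rule homI) (auto simp: comp_plus_left comp_closed)

lemma zero_closed: "a \<in> Obj A \<Longrightarrow> b \<in> Obj A \<Longrightarrow> Zero A a b \<in> Hom A a b"
  using group.is_monoid[OF comm_group.axioms(2)[OF hom_comm_group], of a b] monoid.one_closed by fastforce

lemma zero_right:
  assumes "f \<in> Hom A b c" "a \<in> Obj A"
  shows "f \<cdot> Zero A a b = Zero A a c"
proof -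
  have "group (hom_group A a b)" "group (hom_group A a c)"
    using assms hom_comm_group[THEN comm_group.axioms(2)] Hom_Obj by auto
  then show ?thesis using hom_one[OF comp_left_hom[OF assms(1), of a]] by simp
qed

lemma zero_left:
  assumes "f \<in> Hom A a b" "c \<in> Obj A"
  shows "Zero A b c \<cdot> f = Zero A a c"
proof -
  have "group (hom_group A b c)" "group (hom_group A a c)"
    using assms hom_comm_group[THEN comm_group.axioms(2)] Hom_Obj by auto
  then show ?thesis using hom_one[OF comp_right_hom[OF assms(1), of c]] by simp
qed

lemma hom_diff_closed: "f \<in> Hom A a b \<Longrightarrow> g \<in> Hom A a b \<Longrightarrow> hom_diff A a b f g \<in> Hom A a b"
  using group.inv_closed[OF hom_group_Hom] monoid.m_closed[OF group.is_monoid[OF hom_group_Hom]]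
  unfolding hom_diff_def by fastforce

lemma hom_diff_self: "f \<in> Hom A a b \<Longrightarrow> hom_diff A a b f f = Zero A a b"
  using group.r_inv[OF hom_group_Hom] unfolding hom_diff_def by fastforce

lemma hom_hom_diff:
  assumes "h \<in> hom (hom_group A a b) (hom_group A c d)" "f \<in> Hom A a b" "g \<in> Hom A a b"
    "c \<in> Obj A" "d \<in> Obj A"
  shows "h (hom_diff A a b f g) = hom_diff A c d (h f) (h g)"
proof -
  interpret group_hom "hom_group A a b" "hom_group A c d" h
    using assms hom_group_Hom hom_comm_group[THEN comm_group.axioms(2)]
    by (auto simp: group_hom_def group_hom_axioms_def)
  show ?thesis
    using assms hom_mult[of f "inv\<^bsub>hom_group A a b\<^esub> g"] hom_inv[of g] G.inv_closed[of g]
    by (simp add: hom_diff_def)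
qed

lemma comp_hom_diff:
  "h \<in> Hom A b c \<Longrightarrow> f \<in> Hom A a b \<Longrightarrow> g \<in> Hom A a b \<Longrightarrow>
    h \<cdot> hom_diff A a b f g = hom_diff A a c (h \<cdot> f) (h \<cdot> g)"
  by (rule hom_hom_diff[OF comp_left_hom]) (auto dest: Hom_Obj)

lemma hom_diff_comp:
  "h \<in> Hom A a b \<Longrightarrow> f \<in> Hom A b c \<Longrightarrow> g \<in> Hom A b c \<Longrightarrow>
    hom_diff A b c f g \<cdot> h = hom_diff A a c (f \<cdot> h) (g \<cdot> h)"
  by (rule hom_hom_diff[OF comp_right_hom]) (auto dest: Hom_Obj)

text \<open>In a product of two face differences this interchanges which end value belongs to the
  inner and which to the outer difference; the cubical relations reverse the order of the two faces
  and call for that.\<close>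

lemma hom_diff_exchange:
  assumes "p \<in> Hom A a b" "q \<in> Hom A a b" "r \<in> Hom A a b" "s \<in> Hom A a b"
  shows "hom_diff A a b (hom_diff A a b p q) (hom_diff A a b r s) =
    hom_diff A a b (hom_diff A a b p r) (hom_diff A a b q s)"
proof -
  interpret comm_group "hom_group A a b" using assms hom_comm_group_Hom by blast
  note [simp del] = hom_group_simps
  have "p \<in> carrier (hom_group A a b)" "q \<in> carrier (hom_group A a b)"
    "r \<in> carrier (hom_group A a b)" "s \<in> carrier (hom_group A a b)"
    using assms by (simp_all add: hom_group_simps)
  then show ?thesis by (simp add: hom_diff_def inv_mult m_ac)
qed

lemma alt_sum_cong:
  assumes "a \<in> Obj A" "b \<in> Obj A" "\<And>i. i \<in> {1..n} \<Longrightarrow> u i = v i" "\<And>i. i \<in> {1..n} \<Longrightarrow> v i \<in> Hom A a b"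
  shows "alt_sum A a b u n = alt_sum A a b v n"
proof -
  interpret comm_group "hom_group A a b" using assms hom_comm_group by blast
  show ?thesis
    unfolding alt_sum_def
    by (rule finprod_cong') (use assms(3,4) int_pow_closed in auto)
qed

lemma alt_sum_closed:
  assumes "a \<in> Obj A" "b \<in> Obj A" "\<And>i. i \<in> {1..n} \<Longrightarrow> u i \<in> Hom A a b"
  shows "alt_sum A a b u n \<in> Hom A a b"
proof -
  interpret comm_group "hom_group A a b" using assms hom_comm_group by blast
  have "(\<lambda>i. u i [^]\<^bsub>hom_group A a b\<^esub> ((- 1) ^ i :: int)) \<in> {1..n} \<rightarrow> carrier (hom_group A a b)"
    using assms(3) int_pow_closed by auto
  from finprod_closed[OF this] show ?thesis
    unfolding alt_sum_def by simp
qed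

lemma hom_alt_sum:
  assumes h: "h \<in> hom (hom_group A a b) (hom_group A c d)" and u: "\<And>i. i \<in> {1..n} \<Longrightarrow> u i \<in> Hom A a b"
    and Obj: "a \<in> Obj A" "b \<in> Obj A" "c \<in> Obj A" "d \<in> Obj A"
  shows "h (alt_sum A a b u n) = alt_sum A c d (\<lambda>i. h (u i)) n"
proof -
  interpret G: comm_group "hom_group A a b" using Obj hom_comm_group by blast
  interpret H: comm_group "hom_group A c d" using Obj hom_comm_group by blast
  have pow: "h (u i [^]\<^bsub>hom_group A a b\<^esub> k) = h (u i) [^]\<^bsub>hom_group A c d\<^esub> k"
    if "i \<in> {1..n}" for i and k :: int
    using hom_int_pow[OF h _ G.is_group H.is_group] u that by simp
  have u': "u i [^]\<^bsub>hom_group A a b\<^esub> k \<in> Hom A a b" if "i \<in> {1..n}" for i and k :: int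
    using u that G.int_pow_closed by simp
  have "h (alt_sum A a b u n) =
      finprod (hom_group A c d) (\<lambda>i. h (u i [^]\<^bsub>hom_group A a b\<^esub> ((- 1) ^ i :: int))) {1..n}"
    unfolding alt_sum_def
    by (rule hom_finprod[OF G.comm_group_axioms H.comm_group_axioms h]) (use u' in auto)
  also have "\<dots> = alt_sum A c d (\<lambda>i. h (u i)) n"
    unfolding alt_sum_def
    by (rule H.finprod_cong') (use pow u hom_in_carrier[OF h] H.int_pow_closed in auto)
  finally show ?thesis .
qed

lemma comp_alt_sum:
  "h \<in> Hom A b c \<Longrightarrow> a \<in> Obj A \<Longrightarrow> (\<And>i. i \<in> {1..n} \<Longrightarrow> u i \<in> Hom A a b) \<Longrightarrow>
    h \<cdot> alt_sum A a b u n = alt_sum A a c (\<lambda>i. h \<cdot> u i) n"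
  by (rule hom_alt_sum[OF comp_left_hom]) (auto dest: Hom_Obj)

lemma alt_sum_comp:
  "h \<in> Hom A a b \<Longrightarrow> c \<in> Obj A \<Longrightarrow> (\<And>i. i \<in> {1..n} \<Longrightarrow> u i \<in> Hom A b c) \<Longrightarrow>
    alt_sum A b c u n \<cdot> h = alt_sum A a c (\<lambda>i. u i \<cdot> h) n"
  by (rule hom_alt_sum[OF comp_right_hom]) (auto dest: Hom_Obj)

lemma alt_sum_alt_sum:
  assumes "a \<in> Obj A" "b \<in> Obj A"
    and "\<And>i j. i \<in> {1..n} \<Longrightarrow> j \<in> {1..Suc n} \<Longrightarrow> u i j \<in> Hom A a b"
    and "\<And>i j. 1 \<le> i \<Longrightarrow> i < j \<Longrightarrow> j \<le> Suc n \<Longrightarrow> u i j = u (j - 1) i"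
  shows "alt_sum A a b (\<lambda>i. alt_sum A a b (u i) (Suc n)) n = Zero A a b"
  unfolding alt_sum_def
  using comm_group.alternating_double_finprod[OF hom_comm_group[OF assms(1,2)], of n u] assms(3,4)
  by simp

end

text \<open>The axiom \<open>ex_coproduct\<close> concerns index sets of type \<open>'u set\<close>
  only, whereas coproducts here are also indexed by natural numbers and by pairs of a cube map and
  an element. Existence is therefore a condition of its own, established separately for each index
  type.\<close>

definition has_coprod :: "('o, 'm, 'z) cat_scheme \<Rightarrow> 'i set \<Rightarrow> ('i \<Rightarrow> 'o) \<Rightarrow> bool" where
  "has_coprod C I a \<longleftrightarrow> (\<exists>p \<iota>. is_coproduct C I a p \<iota>)"

context category begin

lemma coproduct_ext:
  assumes "is_coproduct C I a p \<iota>" "f \<in> Hom C p b" "g \<in> Hom C p b" "\<And>i. i \<in> I \<Longrightarrow> f \<cdot> \<iota> i = g \<cdot> \<iota> i"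
  shows "f = g"
proof -
  have "b \<in> Obj C" using assms(2) by (rule Hom_Obj(2))
  moreover have "\<forall>i \<in> I. g \<cdot> \<iota> i \<in> Hom C (a i) b"
    using assms(1) comp_closed[OF _ assms(3)] by (simp add: is_coproduct_def)
  ultimately have "\<exists>!h. h \<in> Hom C p b \<and> (\<forall>i \<in> I. h \<cdot> \<iota> i = g \<cdot> \<iota> i)"
    using assms(1) by (simp add: is_coproduct_def)
  then show ?thesis using assms(2-4) by blast
qed

lemma coproduct_reindex:
  assumes "is_coproduct C J a p \<iota>" "bij_betw r I J"
  shows "is_coproduct C I (a \<circ> r) p (\<iota> \<circ> r)"
  unfolding is_coproduct_def
proof (intro conjI ballI allI impI)
  have r: "r ` I = J" "inj_on r I" using assms(2) by (auto simp: bij_betw_def)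
  show "p \<in> Obj C" using assms(1) by (simp add: is_coproduct_def)
  show "(\<iota> \<circ> r) i \<in> Hom C ((a \<circ> r) i) p" if "i \<in> I" for i
    using assms(1) r that by (auto simp: is_coproduct_def)
  fix b g assume b: "b \<in> Obj C" and g: "\<forall>i \<in> I. g i \<in> Hom C ((a \<circ> r) i) b"
  then have "\<forall>j \<in> J. g (the_inv_into I r j) \<in> Hom C (a j) b"
    using r by (auto simp: the_inv_into_f_f)
  then have "\<exists>!h. h \<in> Hom C p b \<and> (\<forall>j \<in> J. h \<cdot> \<iota> j = g (the_inv_into I r j))"
    using assms(1) b by (simp add: is_coproduct_def)
  moreover have "(\<forall>j \<in> J. h \<cdot> \<iota> j = g (the_inv_into I r j)) \<longleftrightarrow> (\<forall>i \<in> I. h \<cdot> (\<iota> \<circ> r) i = g i)" for h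
    using r by (auto simp: the_inv_into_f_f)
  ultimately show "\<exists>!h. h \<in> Hom C p b \<and> (\<forall>i \<in> I. h \<cdot> (\<iota> \<circ> r) i = g i)" by simp
qed

lemma is_coproduct_coprod: "has_coprod C I a \<Longrightarrow> is_coproduct C I a (coprod_obj C I a) (coprod_in C I a)"
  unfolding has_coprod_def coprod_obj_def coprod_in_def coprod_def
  by (rule someI_ex) auto

lemma coprod_obj_closed: "has_coprod C I a \<Longrightarrow> coprod_obj C I a \<in> Obj C"
  using is_coproduct_coprod unfolding is_coproduct_def by blast

lemma coprod_in_closed: "has_coprod C I a \<Longrightarrow> i \<in> I \<Longrightarrow> coprod_in C I a i \<in> Hom C (a i) (coprod_obj C I a)"
  using is_coproduct_coprod unfolding is_coproduct_def by blast

lemma coprod_ext: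
  "has_coprod C I a \<Longrightarrow> f \<in> Hom C (coprod_obj C I a) b \<Longrightarrow> g \<in> Hom C (coprod_obj C I a) b \<Longrightarrow>
    (\<And>i. i \<in> I \<Longrightarrow> f \<cdot> coprod_in C I a i = g \<cdot> coprod_in C I a i) \<Longrightarrow> f = g"
  using coproduct_ext[OF is_coproduct_coprod] by blast

lemma copair:
  assumes "has_coprod C I a" "b \<in> Obj C" "\<And>i. i \<in> I \<Longrightarrow> g i \<in> Hom C (a i) b"
  shows copair_closed: "copair C I a b g \<in> Hom C (coprod_obj C I a) b"
    and copair_in: "i \<in> I \<Longrightarrow> copair C I a b g \<cdot> coprod_in C I a i = g i"
proof -
  have "\<exists>!h. h \<in> Hom C (coprod_obj C I a) b \<and> (\<forall>i \<in> I. h \<cdot> coprod_in C I a i = g i)"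
    using is_coproduct_coprod[OF assms(1)] assms(2,3) unfolding is_coproduct_def by blast
  from theI'[OF this] show "copair C I a b g \<in> Hom C (coprod_obj C I a) b"
    "i \<in> I \<Longrightarrow> copair C I a b g \<cdot> coprod_in C I a i = g i"
    unfolding copair_def by auto
qed

end

text \<open>Smallness up to bijection: the family is moved to the image of \<open>r\<close> inside
  the universe, and the coproduct found there is pulled back along \<open>r\<close>.\<close>

lemma (in ab4_category) has_coprod_inj:
  fixes r :: "'i \<Rightarrow> 'u"
  assumes "inj_on r I" "\<And>i. i \<in> I \<Longrightarrow> a i \<in> Obj A"
  shows "has_coprod A I a"
proof -
  have "\<forall>j \<in> r ` I. (a \<circ> the_inv_into I r) j \<in> Obj A"
    using assms by (auto simp: the_inv_into_f_f)
  then obtain p \<iota> where "is_coproduct A (r ` I) (a \<circ> the_inv_into I r) p \<iota>"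
    using ex_coproduct by blast
  from coproduct_reindex[OF this, of r I]
  have *: "is_coproduct A I ((a \<circ> the_inv_into I r) \<circ> r) p (\<iota> \<circ> r)"
    using assms(1) by (simp add: bij_betw_def)
  have "((a \<circ> the_inv_into I r) \<circ> r) i = a i" if "i \<in> I" for i
    using that assms(1) by (simp add: the_inv_into_f_f)
  then have "is_coproduct A I a p (\<iota> \<circ> r)"
    using * unfolding is_coproduct_def by auto
  then show ?thesis unfolding has_coprod_def by blast
qed

section \<open>Functoriality of homology\<close>

context category begin

text \<open>Two adjacent commuting squares are pasted. Compatibility of cycles and homology with
  composition, and transport of a differential, are instances.\<close>

lemma commuting_squares:
  assumes "f \<in> Hom C a b" "g \<in> Hom C b c" "f' \<in> Hom C a' b'" "g' \<in> Hom C b' c'"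
    and "u \<in> Hom C a a'" "v \<in> Hom C b b'" "w \<in> Hom C c c'"
    and "v \<cdot> f = f' \<cdot> u" "w \<cdot> g = g' \<cdot> v"
  shows "w \<cdot> (g \<cdot> f) = (g' \<cdot> f') \<cdot> u"
proof -
  have "w \<cdot> (g \<cdot> f) = (w \<cdot> g) \<cdot> f" by (rule comp_assoc[OF assms(1,2,7), symmetric])
  also have "\<dots> = g' \<cdot> (v \<cdot> f)" using comp_assoc[OF assms(1,6,4)] assms(9) by simp
  also have "\<dots> = (g' \<cdot> f') \<cdot> u" using comp_assoc[OF assms(5,3,4)] assms(8) by simp
  finally show ?thesis .
qed

end

context preadditive_category begin

lemma kernel_closed:
  "is_kernel A f k \<Longrightarrow> f \<in> Hom A a b \<Longrightarrow> k \<in> Hom A (Dom A k) a"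
  by (auto simp: is_kernel_def Hom_def)

lemma kernel_comp: "is_kernel A f k \<Longrightarrow> f \<in> Hom A a b \<Longrightarrow> f \<cdot> k = Zero A (Dom A k) b"
  by (auto simp: is_kernel_def Hom_def)

lemma kernel_lift:
  assumes "is_kernel A f k" "f \<in> Hom A a b" "g \<in> Hom A c a" "f \<cdot> g = Zero A c b"
  shows "\<exists>!h. h \<in> Hom A c (Dom A k) \<and> k \<cdot> h = g"
proof -
  have f: "Dom A f = a" "Cod A f = b" using assms(2) by (simp_all add: Hom_def)
  show ?thesis using assms(1,3,4) unfolding is_kernel_def f by blast
qed

lemma kernel_ext:
  assumes "is_kernel A f k" "u \<in> Hom A c (Dom A k)" "v \<in> Hom A c (Dom A k)" "k \<cdot> u = k \<cdot> v"
  shows "u = v"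
proof -
  from assms(1) have f: "f \<in> Hom A (Dom A f) (Cod A f)" by (simp add: is_kernel_def Hom_def)
  note k = kernel_closed[OF assms(1) f]
  have "f \<cdot> (k \<cdot> v) = Zero A c (Cod A f)"
    using comp_assoc[OF assms(3) k f] kernel_comp[OF assms(1) f] zero_left[OF assms(3)] Hom_Obj[OF f] by simp
  from kernel_lift[OF assms(1) f comp_closed[OF assms(3) k] this] show ?thesis
    using assms by blast
qed

lemma cokernel_closed:
  "is_cokernel A f c \<Longrightarrow> f \<in> Hom A a b \<Longrightarrow> c \<in> Hom A b (Cod A c)"
  by (auto simp: is_cokernel_def Hom_def)

lemma cokernel_comp: "is_cokernel A f c \<Longrightarrow> f \<in> Hom A a b \<Longrightarrow> c \<cdot> f = Zero A a (Cod A c)"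
  by (auto simp: is_cokernel_def Hom_def)

lemma cokernel_desc:
  assumes "is_cokernel A f c" "f \<in> Hom A a b" "g \<in> Hom A b d" "g \<cdot> f = Zero A a d"
  shows "\<exists>!h. h \<in> Hom A (Cod A c) d \<and> h \<cdot> c = g"
proof -
  have f: "Dom A f = a" "Cod A f = b" using assms(2) by (simp_all add: Hom_def)
  show ?thesis using assms(1,3,4) unfolding is_cokernel_def f by blast
qed

lemma cokernel_ext:
  assumes "is_cokernel A f c" "u \<in> Hom A (Cod A c) d" "v \<in> Hom A (Cod A c) d" "u \<cdot> c = v \<cdot> c"
  shows "u = v"
proof -
  from assms(1) have f: "f \<in> Hom A (Dom A f) (Cod A f)" by (simp add: is_cokernel_def Hom_def)
  note c = cokernel_closed[OF assms(1) f]
  have "(v \<cdot> c) \<cdot> f = Zero A (Dom A f) d"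
    using comp_assoc[OF f c assms(3)] cokernel_comp[OF assms(1) f] zero_right[OF assms(3)] Hom_Obj[OF f] by simp
  from cokernel_desc[OF assms(1) f comp_closed[OF c assms(3)] this] show ?thesis
    using assms by blast
qed

end

context abelian_category begin

lemma is_kernel_ker: "f \<in> Hom A a b \<Longrightarrow> is_kernel A f (ker A f)"
  unfolding ker_def by (rule someI_ex[OF ex_kernel]) (simp add: Hom_def)

lemma is_cokernel_coker: "f \<in> Hom A a b \<Longrightarrow> is_cokernel A f (coker A f)"
  unfolding coker_def by (rule someI_ex[OF ex_cokernel]) (simp add: Hom_def)

lemma zero_obj_closed: "zero_obj A \<in> Obj A"
  using someI_ex[OF ex_zero_obj] by (simp add: zero_obj_def is_zero_obj_def)

end

text \<open>Completes the differential in degree 0 by the arrow to the zero object, exactly as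
  \<open>cycles\<close> does, so that cycles are kernels of one kind of arrow in all
  degrees.\<close>

definition boundary :: "('o, 'm, 'z) ab_cat_scheme \<Rightarrow> ('o, 'm) chain_cx \<Rightarrow> nat \<Rightarrow> 'm" where
  "boundary A K n = (if n = 0 then Zero A (Ch K 0) (zero_obj A) else Diff K n)"

definition boundary_obj :: "('o, 'm, 'z) ab_cat_scheme \<Rightarrow> ('o, 'm) chain_cx \<Rightarrow> nat \<Rightarrow> 'o" where
  "boundary_obj A K n = (if n = 0 then zero_obj A else Ch K (n - 1))"

definition is_complex :: "('o, 'm, 'z) ab_cat_scheme \<Rightarrow> ('o, 'm) chain_cx \<Rightarrow> bool" where
  "is_complex A K \<longleftrightarrow> (\<forall>n. Ch K n \<in> Obj A) \<and> (\<forall>n. Diff K (Suc n) \<in> Hom A (Ch K (Suc n)) (Ch K n)) \<and>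
     (\<forall>n. Diff K (Suc n) \<cdot>\<^bsub>A\<^esub> Diff K (Suc (Suc n)) = Zero A (Ch K (Suc (Suc n))) (Ch K n))"

definition is_chain_map ::
  "('o, 'm, 'z) ab_cat_scheme \<Rightarrow> ('o, 'm) chain_cx \<Rightarrow> ('o, 'm) chain_cx \<Rightarrow> (nat \<Rightarrow> 'm) \<Rightarrow> bool" where
  "is_chain_map A K L f \<longleftrightarrow> (\<forall>n. f n \<in> Hom A (Ch K n) (Ch L n)) \<and>
     (\<forall>n. f n \<cdot>\<^bsub>A\<^esub> Diff K (Suc n) = Diff L (Suc n) \<cdot>\<^bsub>A\<^esub> f (Suc n))"

context abelian_category begin

context
  fixes K assumes K: "is_complex A K"
begin

lemma complex_simps:
  shows Ch_closed: "Ch K n \<in> Obj A"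
    and Diff_closed: "Diff K (Suc n) \<in> Hom A (Ch K (Suc n)) (Ch K n)"
    and Diff_Diff: "Diff K (Suc n) \<cdot> Diff K (Suc (Suc n)) = Zero A (Ch K (Suc (Suc n))) (Ch K n)"
  using K by (auto simp: is_complex_def)

lemma boundary_closed: "boundary A K n \<in> Hom A (Ch K n) (boundary_obj A K n)"
  using Diff_closed[of "n - 1"] zero_closed Ch_closed zero_obj_closed
  by (cases n) (auto simp: boundary_def boundary_obj_def)

lemma boundary_Diff: "boundary A K n \<cdot> Diff K (Suc n) = Zero A (Ch K (Suc n)) (boundary_obj A K n)"
  using zero_left[OF Diff_closed zero_obj_closed, of 0] Diff_Diff
  by (cases n) (auto simp: boundary_def boundary_obj_def)

lemma is_kernel_cycles: "is_kernel A (boundary A K n) (cycles A K n)"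
  using is_kernel_ker[OF boundary_closed] by (simp add: cycles_def boundary_def)

lemmas cycles_closed = kernel_closed[OF is_kernel_cycles boundary_closed]
lemmas boundary_cycles = kernel_comp[OF is_kernel_cycles boundary_closed]

lemma to_cycles:
  shows to_cycles_closed: "to_cycles A K n \<in> Hom A (Ch K (Suc n)) (Dom A (cycles A K n))"
    and cycles_to_cycles: "cycles A K n \<cdot> to_cycles A K n = Diff K (Suc n)"
  using theI'[OF kernel_lift[OF is_kernel_cycles boundary_closed Diff_closed boundary_Diff]]
  unfolding to_cycles_def by auto

lemma is_cokernel_homology_proj: "is_cokernel A (to_cycles A K n) (homology_proj A K n)"
  unfolding homology_proj_def by (rule is_cokernel_coker[OF to_cycles_closed])

lemma homology_proj_closed: "homology_proj A K n \<in> Hom A (Dom A (cycles A K n)) (homology A K n)"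
  using cokernel_closed[OF is_cokernel_homology_proj to_cycles_closed] by (simp add: homology_def)

lemma homology_proj_to_cycles:
  "homology_proj A K n \<cdot> to_cycles A K n = Zero A (Ch K (Suc n)) (homology A K n)"
  using cokernel_comp[OF is_cokernel_homology_proj to_cycles_closed] by (simp add: homology_def)

end

lemma chain_map_simps:
  assumes "is_chain_map A K L f"
  shows chain_map_closed: "f n \<in> Hom A (Ch K n) (Ch L n)"
    and chain_map_Diff: "f n \<cdot> Diff K (Suc n) = Diff L (Suc n) \<cdot> f (Suc n)"
  using assms by (auto simp: is_chain_map_def)

context
  fixes K L f assumes K: "is_complex A K" and L: "is_complex A L" and f: "is_chain_map A K L f"
begin

lemma boundary_chain_map_cycles:
  "boundary A L n \<cdot> (f n \<cdot> cycles A K n) = Zero A (Dom A (cycles A K n)) (boundary_obj A L n)"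
proof (cases n)
  case 0
  then show ?thesis
    using zero_left[OF comp_closed[OF cycles_closed[OF K] chain_map_closed[OF f], of 0] zero_obj_closed]
    by (simp add: boundary_def boundary_obj_def)
next
  case (Suc m)
  note c = cycles_closed[OF K, of n]
  have "boundary A L n \<cdot> (f n \<cdot> cycles A K n) = (boundary A L n \<cdot> f n) \<cdot> cycles A K n"
    by (rule comp_assoc[OF c chain_map_closed[OF f] boundary_closed[OF L], symmetric])
  also have "boundary A L n \<cdot> f n = f m \<cdot> boundary A K n"
    using chain_map_Diff[OF f, of m] Suc by (simp add: boundary_def)
  also have "\<dots> \<cdot> cycles A K n = f m \<cdot> (boundary A K n \<cdot> cycles A K n)"
    using comp_assoc[OF c boundary_closed[OF K, of n]] chain_map_closed[OF f, of m] Suc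
    by (simp add: boundary_obj_def)
  also have "\<dots> = Zero A (Dom A (cycles A K n)) (boundary_obj A L n)"
    using zero_right[OF chain_map_closed[OF f] Hom_Obj(1)[OF c], of m] boundary_cycles[OF K, of n] Suc
    by (simp add: boundary_obj_def)
  finally show ?thesis .
qed

lemma cycles_map:
  shows cycles_map_closed: "cycles_map A K L f n \<in> Hom A (Dom A (cycles A K n)) (Dom A (cycles A L n))"
    and cycles_cycles_map: "cycles A L n \<cdot> cycles_map A K L f n = f n \<cdot> cycles A K n"
  using theI'[OF kernel_lift[OF is_kernel_cycles[OF L] boundary_closed[OF L]
        comp_closed[OF cycles_closed[OF K] chain_map_closed[OF f]] boundary_chain_map_cycles]]
  unfolding cycles_map_def by auto

lemma cycles_map_to_cycles:
  "cycles_map A K L f n \<cdot> to_cycles A K n = to_cycles A L n \<cdot> f (Suc n)"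
proof (rule kernel_ext[OF is_kernel_cycles[OF L]])
  note cK = cycles_closed[OF K] and cL = cycles_closed[OF L]
    and tK = to_cycles_closed[OF K] and tL = to_cycles_closed[OF L]
  show "cycles_map A K L f n \<cdot> to_cycles A K n \<in> Hom A (Ch K (Suc n)) (Dom A (cycles A L n))"
    by (rule comp_closed[OF tK cycles_map_closed])
  show "to_cycles A L n \<cdot> f (Suc n) \<in> Hom A (Ch K (Suc n)) (Dom A (cycles A L n))"
    by (rule comp_closed[OF chain_map_closed[OF f] tL])
  have "cycles A L n \<cdot> (cycles_map A K L f n \<cdot> to_cycles A K n) =
      (cycles A L n \<cdot> cycles_map A K L f n) \<cdot> to_cycles A K n"
    by (rule comp_assoc[OF tK cycles_map_closed cL, symmetric])
  also have "\<dots> = f n \<cdot> Diff K (Suc n)"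
    by (simp only: cycles_cycles_map comp_assoc[OF tK cK chain_map_closed[OF f]] cycles_to_cycles[OF K])
  also have "\<dots> = cycles A L n \<cdot> (to_cycles A L n \<cdot> f (Suc n))"
    by (simp only: chain_map_Diff[OF f] comp_assoc[OF chain_map_closed[OF f] tL cL, symmetric] cycles_to_cycles[OF L])
  finally show "cycles A L n \<cdot> (cycles_map A K L f n \<cdot> to_cycles A K n) =
      cycles A L n \<cdot> (to_cycles A L n \<cdot> f (Suc n))" .
qed

lemma homology_map:
  shows homology_map_closed: "homology_map A K L f n \<in> Hom A (homology A K n) (homology A L n)"
    and homology_map_proj:
      "homology_map A K L f n \<cdot> homology_proj A K n = homology_proj A L n \<cdot> cycles_map A K L f n"
proof -
  note tK = to_cycles_closed[OF K] and tL = to_cycles_closed[OF L] and pL = homology_proj_closed[OF L]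
  have "(homology_proj A L n \<cdot> cycles_map A K L f n) \<cdot> to_cycles A K n =
      (homology_proj A L n \<cdot> to_cycles A L n) \<cdot> f (Suc n)"
    by (simp only: comp_assoc[OF tK cycles_map_closed pL] cycles_map_to_cycles
        comp_assoc[OF chain_map_closed[OF f] tL pL])
  also have "\<dots> = Zero A (Ch K (Suc n)) (homology A L n)"
    using zero_left[OF chain_map_closed[OF f] Hom_Obj(2)[OF pL]] homology_proj_to_cycles[OF L] by simp
  finally show "homology_map A K L f n \<in> Hom A (homology A K n) (homology A L n)"
      "homology_map A K L f n \<cdot> homology_proj A K n = homology_proj A L n \<cdot> cycles_map A K L f n"
    using theI'[OF cokernel_desc[OF is_cokernel_homology_proj[OF K] tK comp_closed[OF cycles_map_closed pL]]]
    unfolding homology_map_def homology_def by auto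
qed

text \<open>Both descriptions behind \<open>homology_map\<close> are resolved at once: lifts to a
  kernel and descents from a cokernel are unique, so any pair of arrows on cycles and on homology
  that fits the two squares is the right one.\<close>

lemma homology_map_eqI:
  assumes "h \<in> Hom A (homology A K n) (homology A L n)"
    and "k \<in> Hom A (Dom A (cycles A K n)) (Dom A (cycles A L n))"
    and "cycles A L n \<cdot> k = f n \<cdot> cycles A K n"
    and "h \<cdot> homology_proj A K n = homology_proj A L n \<cdot> k"
  shows "homology_map A K L f n = h"
proof -
  have "cycles_map A K L f n = k"
    by (rule kernel_ext[OF is_kernel_cycles[OF L] cycles_map_closed assms(2)])
      (simp add: cycles_cycles_map assms(3))
  then show ?thesis
    using cokernel_ext[OF is_cokernel_homology_proj[OF K], folded homology_def, OF homology_map_closed assms(1)]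
      homology_map_proj assms(4) by simp
qed

end

lemma chain_map_comp:
  assumes "is_complex A K" "is_complex A L" "is_complex A M" "is_chain_map A K L f" "is_chain_map A L M g"
  shows "is_chain_map A K M (\<lambda>n. g n \<cdot> f n)"
  unfolding is_chain_map_def
proof (intro conjI allI)
  note f = chain_map_simps[OF assms(4)] and g = chain_map_simps[OF assms(5)]
  note dK = Diff_closed[OF assms(1)] and dL = Diff_closed[OF assms(2)] and dM = Diff_closed[OF assms(3)]
  show "g n \<cdot> f n \<in> Hom A (Ch K n) (Ch M n)" for n
    by (rule comp_closed[OF f(1) g(1)])
  show "(g n \<cdot> f n) \<cdot> Diff K (Suc n) = Diff M (Suc n) \<cdot> (g (Suc n) \<cdot> f (Suc n))" for n
    by (rule commuting_squares[OF f(1) g(1) f(1) g(1) dK dL dM f(2)[symmetric] g(2)[symmetric], symmetric])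
qed

lemma chain_map_id: "is_complex A K \<Longrightarrow> is_chain_map A K K (\<lambda>n. Idt A (Ch K n))"
  unfolding is_chain_map_def
  using id_closed[OF Ch_closed] id_left[OF Diff_closed] id_right[OF Diff_closed] by simp

lemma homology_map_comp:
  assumes "is_complex A K" "is_complex A L" "is_complex A M" "is_chain_map A K L f" "is_chain_map A L M g"
  shows "homology_map A K M (\<lambda>n. g n \<cdot> f n) n = homology_map A L M g n \<cdot> homology_map A K L f n"
proof (rule homology_map_eqI[OF assms(1,3) chain_map_comp[OF assms]])
  note f = assms(1,2,4) and g = assms(2,3,5)
  note cf = cycles_map_closed[OF f] and cg = cycles_map_closed[OF g]
  note hf = homology_map_closed[OF f] and hg = homology_map_closed[OF g]
  show "homology_map A L M g n \<cdot> homology_map A K L f n \<in> Hom A (homology A K n) (homology A M n)"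
    by (rule comp_closed[OF hf hg])
  show "cycles_map A L M g n \<cdot> cycles_map A K L f n \<in> Hom A (Dom A (cycles A K n)) (Dom A (cycles A M n))"
    by (rule comp_closed[OF cf cg])
  show "cycles A M n \<cdot> (cycles_map A L M g n \<cdot> cycles_map A K L f n) = (g n \<cdot> f n) \<cdot> cycles A K n"
    by (rule commuting_squares[OF cf cg chain_map_closed[OF assms(4)] chain_map_closed[OF assms(5)]
          cycles_closed[OF assms(1)] cycles_closed[OF assms(2)] cycles_closed[OF assms(3)]
          cycles_cycles_map[OF f] cycles_cycles_map[OF g]])
  show "(homology_map A L M g n \<cdot> homology_map A K L f n) \<cdot> homology_proj A K n =
      homology_proj A M n \<cdot> (cycles_map A L M g n \<cdot> cycles_map A K L f n)"
    by (rule commuting_squares[OF cf cg hf hg homology_proj_closed[OF assms(1)]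
          homology_proj_closed[OF assms(2)] homology_proj_closed[OF assms(3)]
          homology_map_proj[OF f, symmetric] homology_map_proj[OF g, symmetric], symmetric])
qed

lemma homology_map_id:
  assumes "is_complex A K"
  shows "homology_map A K K (\<lambda>n. Idt A (Ch K n)) n = Idt A (homology A K n)"
  by (rule homology_map_eqI[OF assms assms chain_map_id[OF assms], where k = "Idt A (Dom A (cycles A K n))"])
    (use cycles_closed[OF assms, of n] homology_proj_closed[OF assms, of n] in
      \<open>auto simp: id_left id_right intro: id_closed Hom_Obj\<close>)

text \<open>The descriptions mention the chain map in degree \<open>n\<close> only, so agreement in
  that single degree is enough.\<close>

lemma homology_map_cong:
  "f n = g n \<Longrightarrow> homology_map A K L f n = homology_map A K L g n"
  by (simp add: homology_map_def cycles_map_def)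

lemma homology_map_iso:
  assumes "is_complex A K" "is_complex A L" "is_chain_map A K L f" "is_chain_map A L K g"
    and "\<And>n. g n \<cdot> f n = Idt A (Ch K n)" "\<And>n. f n \<cdot> g n = Idt A (Ch L n)"
  shows "is_isomorphism A (homology_map A K L f n)"
proof (rule is_isomorphismI)
  show "homology_map A L K g n \<cdot> homology_map A K L f n = Idt A (homology A K n)"
    using homology_map_comp[OF assms(1,2,1,3,4), of n] homology_map_id[OF assms(1)] assms(5) by simp
  show "homology_map A K L f n \<cdot> homology_map A L K g n = Idt A (homology A L n)"
    using homology_map_comp[OF assms(2,1,2,4,3), of n] homology_map_id[OF assms(2)] assms(6) by simp
qed (rule homology_map_closed[OF assms(1,2,3)] homology_map_closed[OF assms(2,1,4)])+

end

section \<open>Chains with coefficients\<close>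

text \<open>Common ground of X with coefficients F and of \<open>Lan X\<close> with the induced
  coefficients. It asks for the chain coproducts and for well-placed face arrows, which is what the
  differential is made of; relations between faces enter later as hypotheses.\<close>

locale face_coefficients = abelian_category A
  for A :: "('o, 'm, 'z) ab_cat_scheme" (structure) +
  fixes Y :: "(nat, cube_map, 'x) psh" and G :: "('x, 'o, 'm) coeff"
  assumes has_chain: "has_coprod A (At Y n) (\<lambda>x. Fobj G (n, x))"
    and face_at: "\<lbrakk>1 \<le> i; i \<le> Suc n; x \<in> At Y (Suc n)\<rbrakk> \<Longrightarrow> Act Y (face (Suc n) i \<epsilon>) x \<in> At Y n"
    and face_arr: "\<lbrakk>1 \<le> i; i \<le> Suc n; x \<in> At Y (Suc n)\<rbrakk> \<Longrightarrow>
      Farr G ((n, Act Y (face (Suc n) i \<epsilon>) x), face (Suc n) i \<epsilon>, (Suc n, x))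
      \<in> Hom A (Fobj G (Suc n, x)) (Fobj G (n, Act Y (face (Suc n) i \<epsilon>) x))"
begin

lemma chain_closed: "chain A Y G n \<in> Obj A"
  unfolding chain_def by (rule coprod_obj_closed[OF has_chain])

lemma chain_in_closed: "x \<in> At Y n \<Longrightarrow> chain_in A Y G n x \<in> Hom A (Fobj G (n, x)) (chain A Y G n)"
  unfolding chain_def chain_in_def by (rule coprod_in_closed[OF has_chain])

lemma chain_ext:
  assumes "f \<in> Hom A (chain A Y G n) b" "g \<in> Hom A (chain A Y G n) b"
    and "\<And>x. x \<in> At Y n \<Longrightarrow> f \<cdot> chain_in A Y G n x = g \<cdot> chain_in A Y G n x"
  shows "f = g"
  using coprod_ext[OF has_chain] assms unfolding chain_def chain_in_def by blast

lemma chain_copair: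
  assumes "b \<in> Obj A" "\<And>x. x \<in> At Y n \<Longrightarrow> g x \<in> Hom A (Fobj G (n, x)) b"
  shows chain_copair_closed: "copair A (At Y n) (\<lambda>x. Fobj G (n, x)) b g \<in> Hom A (chain A Y G n) b"
    and chain_copair_in: "x \<in> At Y n \<Longrightarrow>
      copair A (At Y n) (\<lambda>x. Fobj G (n, x)) b g \<cdot> chain_in A Y G n x = g x"
  using copair[OF has_chain assms] unfolding chain_def chain_in_def by blast+

lemma face_op:
  assumes "1 \<le> i" "i \<le> Suc n"
  shows face_op_closed: "face_op A Y G (Suc n) i \<epsilon> \<in> Hom A (chain A Y G (Suc n)) (chain A Y G n)"
    and face_op_in: "x \<in> At Y (Suc n) \<Longrightarrow> face_op A Y G (Suc n) i \<epsilon> \<cdot> chain_in A Y G (Suc n) x =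
      chain_in A Y G n (Act Y (face (Suc n) i \<epsilon>) x) \<cdot>
        Farr G ((n, Act Y (face (Suc n) i \<epsilon>) x), face (Suc n) i \<epsilon>, (Suc n, x))"
proof -
  have "chain_in A Y G n (Act Y (face (Suc n) i \<epsilon>) x) \<cdot>
        Farr G ((n, Act Y (face (Suc n) i \<epsilon>) x), face (Suc n) i \<epsilon>, (Suc n, x))
      \<in> Hom A (Fobj G (Suc n, x)) (chain A Y G n)" if "x \<in> At Y (Suc n)" for x
    by (rule comp_closed[OF face_arr chain_in_closed[OF face_at]]) (use assms that in auto)
  from chain_copair[OF chain_closed this]
  show "face_op A Y G (Suc n) i \<epsilon> \<in> Hom A (chain A Y G (Suc n)) (chain A Y G n)"
    "x \<in> At Y (Suc n) \<Longrightarrow> face_op A Y G (Suc n) i \<epsilon> \<cdot> chain_in A Y G (Suc n) x =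
      chain_in A Y G n (Act Y (face (Suc n) i \<epsilon>) x) \<cdot>
        Farr G ((n, Act Y (face (Suc n) i \<epsilon>) x), face (Suc n) i \<epsilon>, (Suc n, x))"
    unfolding face_op_def by (simp_all add: Let_def)
qed

text \<open>Kept as a unit because the projection from the chains of \<open>Lan X\<close> respects
  this difference, but in general neither of its two terms.\<close>

definition face_diff :: "nat \<Rightarrow> nat \<Rightarrow> 'm" where
  "face_diff n i = hom_diff A (chain A Y G (Suc n)) (chain A Y G n)
     (face_op A Y G (Suc n) i False) (face_op A Y G (Suc n) i True)"

lemma face_diff_closed:
  "1 \<le> i \<Longrightarrow> i \<le> Suc n \<Longrightarrow> face_diff n i \<in> Hom A (chain A Y G (Suc n)) (chain A Y G n)"
  unfolding face_diff_def by (intro hom_diff_closed face_op_closed)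

lemma chain_diff_eq:
  "chain_diff A Y G (Suc n) = alt_sum A (chain A Y G (Suc n)) (chain A Y G n) (face_diff n) (Suc n)"
  by (simp add: chain_diff_def alt_sum_def hom_diff_def face_diff_def Let_def)

lemma chain_diff_closed: "chain_diff A Y G (Suc n) \<in> Hom A (chain A Y G (Suc n)) (chain A Y G n)"
  unfolding chain_diff_eq by (intro alt_sum_closed chain_closed face_diff_closed) auto

lemma comp_face_diff:
  assumes "1 \<le> i" "i \<le> Suc n" "h \<in> Hom A (chain A Y G n) b"
  shows "h \<cdot> face_diff n i = hom_diff A (chain A Y G (Suc n)) b
    (h \<cdot> face_op A Y G (Suc n) i False) (h \<cdot> face_op A Y G (Suc n) i True)"
  unfolding face_diff_def by (intro comp_hom_diff assms face_op_closed)

lemma face_diff_comp: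
  assumes "1 \<le> i" "i \<le> Suc n" "h \<in> Hom A a (chain A Y G (Suc n))"
  shows "face_diff n i \<cdot> h = hom_diff A a (chain A Y G n)
    (face_op A Y G (Suc n) i False \<cdot> h) (face_op A Y G (Suc n) i True \<cdot> h)"
  unfolding face_diff_def by (intro hom_diff_comp assms face_op_closed)

lemma chain_diff_chain_diff:
  assumes cubical: "\<And>i j \<epsilon> \<eta>. 1 \<le> i \<Longrightarrow> i < j \<Longrightarrow> j \<le> Suc (Suc n) \<Longrightarrow>
      face_op A Y G (Suc n) i \<epsilon> \<cdot> face_op A Y G (Suc (Suc n)) j \<eta> =
      face_op A Y G (Suc n) (j - 1) \<eta> \<cdot> face_op A Y G (Suc (Suc n)) i \<epsilon>"
  shows "chain_diff A Y G (Suc n) \<cdot> chain_diff A Y G (Suc (Suc n)) =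
    Zero A (chain A Y G (Suc (Suc n))) (chain A Y G n)"
proof -
  let ?C = "chain A Y G" and ?a = "chain A Y G (Suc (Suc n))" and ?b = "chain A Y G n"
  define u where "u i j = face_diff n i \<cdot> face_diff (Suc n) j" for i j
  have u: "u i j \<in> Hom A ?a ?b" if "i \<in> {1..Suc n}" "j \<in> {1..Suc (Suc n)}" for i j
    unfolding u_def using that by (intro comp_closed[OF face_diff_closed face_diff_closed]) auto
  have "chain_diff A Y G (Suc n) \<cdot> chain_diff A Y G (Suc (Suc n)) =
      alt_sum A ?a ?b (\<lambda>i. face_diff n i \<cdot> chain_diff A Y G (Suc (Suc n))) (Suc n)"
    unfolding chain_diff_eq[of n]
    by (rule alt_sum_comp[OF chain_diff_closed chain_closed face_diff_closed]) auto
  also have "\<dots> = alt_sum A ?a ?b (\<lambda>i. alt_sum A ?a ?b (u i) (Suc (Suc n))) (Suc n)"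
  proof (rule alt_sum_cong[OF chain_closed chain_closed])
    fix i assume i: "i \<in> {1..Suc n}"
    show "face_diff n i \<cdot> chain_diff A Y G (Suc (Suc n)) = alt_sum A ?a ?b (u i) (Suc (Suc n))"
      unfolding chain_diff_eq[of "Suc n"] u_def
      by (rule comp_alt_sum[OF face_diff_closed chain_closed face_diff_closed]) (use i in auto)
    show "alt_sum A ?a ?b (u i) (Suc (Suc n)) \<in> Hom A ?a ?b"
      by (rule alt_sum_closed[OF chain_closed chain_closed]) (use u i in auto)
  qed
  also have "\<dots> = Zero A ?a ?b"
  proof (rule alt_sum_alt_sum[OF chain_closed chain_closed u])
    fix i j assume ij: "1 \<le> i" "i < j" "j \<le> Suc (Suc n)"
    then have i: "i \<le> Suc n" "i \<le> Suc (Suc n)" and j: "1 \<le> j - 1" "j - 1 \<le> Suc n" "1 \<le> j" by auto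
    let ?f = "\<lambda>\<epsilon> \<eta>. face_op A Y G (Suc n) i \<epsilon> \<cdot> face_op A Y G (Suc (Suc n)) j \<eta>"
    have f: "?f \<epsilon> \<eta> \<in> Hom A ?a ?b" for \<epsilon> \<eta>
      by (rule comp_closed[OF face_op_closed[OF j(3) ij(3)] face_op_closed[OF ij(1) i(1)]])
    \<comment> \<open>Here the outer difference belongs to \<open>j\<close> and the inner one to
      \<open>i\<close>. After the exchange it is the other way round, which is how the product for
      \<open>j - 1\<close> and \<open>i\<close> expands.\<close>
    have "u i j = hom_diff A ?a ?b (hom_diff A ?a ?b (?f False False) (?f True False))
        (hom_diff A ?a ?b (?f False True) (?f True True))"
      unfolding u_def
      by (simp only: comp_face_diff[OF j(3) ij(3) face_diff_closed[OF ij(1) i(1)]]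
          face_diff_comp[OF ij(1) i(1) face_op_closed[OF j(3) ij(3)]])
    also have "\<dots> = hom_diff A ?a ?b (hom_diff A ?a ?b (?f False False) (?f False True))
        (hom_diff A ?a ?b (?f True False) (?f True True))"
      by (rule hom_diff_exchange[OF f f f f])
    also have "\<dots> = u (j - 1) i"
      unfolding u_def
      by (simp only: comp_face_diff[OF ij(1) i(2) face_diff_closed[OF j(1,2)]]
          face_diff_comp[OF j(1,2) face_op_closed[OF ij(1) i(2)]] cubical[OF ij])
    finally show "u i j = u (j - 1) i" .
  qed auto
  finally show ?thesis .
qed

end

text \<open>The two differentials are alternating sums over the same index range, so commutation can
  be checked one index at a time. It serves for the projection and for the maps induced by a
  transformation of coefficients.\<close>

lemma chain_diff_natural:
  assumes "face_coefficients A Y G" "face_coefficients A Z H"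
    and f: "f \<in> Hom A (chain A Y G n) (chain A Z H n)"
    and g: "g \<in> Hom A (chain A Y G (Suc n)) (chain A Z H (Suc n))"
    and eq: "\<And>i. 1 \<le> i \<Longrightarrow> i \<le> Suc n \<Longrightarrow>
      f \<cdot>\<^bsub>A\<^esub> face_coefficients.face_diff A Y G n i = face_coefficients.face_diff A Z H n i \<cdot>\<^bsub>A\<^esub> g"
  shows "f \<cdot>\<^bsub>A\<^esub> chain_diff A Y G (Suc n) = chain_diff A Z H (Suc n) \<cdot>\<^bsub>A\<^esub> g"
proof -
  interpret Y: face_coefficients A Y G by fact
  interpret Z: face_coefficients A Z H by fact
  let ?a = "chain A Y G (Suc n)" and ?b = "chain A Z H n"
  have "f \<cdot>\<^bsub>A\<^esub> chain_diff A Y G (Suc n) = alt_sum A ?a ?b (\<lambda>i. f \<cdot>\<^bsub>A\<^esub> Y.face_diff n i) (Suc n)"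
    unfolding Y.chain_diff_eq by (rule Y.comp_alt_sum[OF f Y.chain_closed Y.face_diff_closed]) auto
  also have "\<dots> = alt_sum A ?a ?b (\<lambda>i. Z.face_diff n i \<cdot>\<^bsub>A\<^esub> g) (Suc n)"
    by (rule Y.alt_sum_cong[OF Y.chain_closed Z.chain_closed])
      (use eq Y.comp_closed[OF g Z.face_diff_closed] in auto)
  also have "\<dots> = chain_diff A Z H (Suc n) \<cdot>\<^bsub>A\<^esub> g"
    unfolding Z.chain_diff_eq by (rule Y.alt_sum_comp[OF g Z.chain_closed Z.face_diff_closed, symmetric]) auto
  finally show ?thesis .
qed

section \<open>Smallness of the index sets\<close>

lemma countable_box_arr: "countable box_arr"
proof -
  have "finite (cube n)" for n
    using finite_lists_length_eq[of "UNIV :: bool set" n] by (simp add: cube_def)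
  then have "countable (\<Union>m. \<Union>n. {m} \<times> (cube m \<rightarrow>\<^sub>E cube n) \<times> {n})"
    by (intro countable_UN countable_SIGMA) (auto intro!: countable_finite finite_PiE)
  moreover have "box_arr \<subseteq> (\<Union>m. \<Union>n. {m} \<times> (cube m \<rightarrow>\<^sub>E cube n) \<times> {n})"
    using box_arr_PiE by fastforce
  ultimately show ?thesis by (rule countable_subset[rotated])
qed

text \<open>A countable set embeds into the infinite universe, and an infinite set is equipotent to
  its square. With cube maps as the countable factor this makes the index sets of
  \<open>Lan X\<close> small.\<close>

lemma countable_times_inj:
  assumes "infinite (UNIV :: 'u set)" "countable (B :: 'b set)"
  obtains r :: "'b \<times> 'u \<Rightarrow> 'u" where "inj_on r (B \<times> UNIV)"
proof -
  have "B \<lesssim> (UNIV :: nat set)"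
    using assms(2) unfolding countable_def lepoll_def by auto
  also have "(UNIV :: nat set) \<lesssim> (UNIV :: 'u set)"
    using assms(1) infinite_le_lepoll by blast
  finally have "B \<times> (UNIV :: 'u set) \<lesssim> (UNIV :: 'u set) \<times> (UNIV :: 'u set)"
    by (intro times_lepoll_mono lepoll_refl)
  also have "(UNIV :: 'u set) \<times> (UNIV :: 'u set) \<approx> (UNIV :: 'u set)"
    using card_of_Times_same_infinite[OF assms(1)] by (simp add: eqpoll_iff_card_of_ordIso)
  finally show ?thesis using that unfolding lepoll_def by blast
qed

text \<open>The combinatorial core. Write \<gamma> as \<beta> after a degeneracy. A face of the same
  index cancels it and leaves \<beta> for both ends. For another index the degeneracy moves to the
  source side, survives in the epimorphic part and lowers its target dimension.\<close>

lemma face_of_noniso_epi: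
  assumes "is_epi Box \<gamma>" "\<gamma> \<in> Hom Box (Suc n) k" "\<gamma> \<noteq> cube_id (Suc n)" "1 \<le> i" "i \<le> Suc n"
  shows "cube_comp \<gamma> (face (Suc n) i False) = cube_comp \<gamma> (face (Suc n) i True) \<or>
    (\<forall>\<epsilon>. epi_part (cube_comp \<gamma> (face (Suc n) i \<epsilon>)) \<noteq> cube_id n)"
proof -
  have "iter_degen (Suc n) k \<gamma>" using assms epi_iff_iter_degen by blast
  then obtain \<beta> j where \<beta>: "iter_degen n k \<beta>" and j: "1 \<le> j" "j \<le> Suc n"
    and \<gamma>: "\<gamma> = cube_comp \<beta> (degen (Suc n) j)"
    using assms(3) by (cases rule: iter_degen.cases) auto
  note H = iter_degen_Hom[OF \<beta>] degen_Hom[OF j] face_Hom[OF assms(4,5)]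
  have eq: "cube_comp \<gamma> (face (Suc n) i \<epsilon>) = cube_comp \<beta> (cube_comp (degen (Suc n) j) (face (Suc n) i \<epsilon>))"
    for \<epsilon> unfolding \<gamma> by (rule Box_comp_assoc[OF H(3,2,1)])
  show ?thesis
  proof (cases "i = j")
    case True
    then show ?thesis using eq degen_face_same[OF j] by simp
  next
    case False
    then obtain m where m: "n = Suc m" using assms(4,5) j by (cases n) auto
    have "epi_part (cube_comp \<gamma> (face (Suc n) i \<epsilon>)) \<noteq> cube_id n" for \<epsilon>
    proof -
      obtain i' j' where ij: "1 \<le> i'" "i' \<le> Suc m" "1 \<le> j'" "j' \<le> Suc m" and
        s: "cube_comp (degen (Suc n) j) (face (Suc n) i \<epsilon>) = cube_comp (face n i' \<epsilon>) (degen n j')"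
      proof (cases "i < j")
        case True
        with assms(4,5) j m show ?thesis
          using degen_face_greater[of i j m \<epsilon>] that[of i "j - 1"] by auto
      next
        case False
        with \<open>i \<noteq> j\<close> assms(4,5) j m show ?thesis
          using degen_face_less[of j i m \<epsilon>] that[of "i - 1" j] by auto
      qed
      note H' = face_Hom[OF ij(1,2), of \<epsilon>, folded m] degen_Hom[OF ij(3,4), folded m]
      \<comment> \<open>The face now stands between \<beta> and the degeneracy. Renormalizing
        \<beta> after the face leaves the degeneracy on the far right, so the epimorphic part of the
        whole is \<delta> after that degeneracy.\<close>
      obtain l \<delta> \<mu> where l: "iter_degen m l \<delta>" "iter_face l k \<mu>"
        "cube_comp \<beta> (face n i' \<epsilon>) = cube_comp \<mu> \<delta>"
        using Box_normal_form[OF Box_comp_closed[OF H'(1) H(1)]] by metis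
      have "cube_comp \<gamma> (face (Suc n) i \<epsilon>) = cube_comp (cube_comp \<beta> (face n i' \<epsilon>)) (degen n j')"
        unfolding eq s by (rule Box_comp_assoc[OF H'(2,1) H(1), symmetric])
      also have "\<dots> = cube_comp \<mu> (cube_comp \<delta> (degen n j'))"
        unfolding l(3) by (rule Box_comp_assoc[OF H'(2) iter_degen_Hom[OF l(1)] iter_face_Hom[OF l(2)]])
      finally have fac: "cube_comp \<gamma> (face (Suc n) i \<epsilon>) = cube_comp \<mu> (cube_comp \<delta> (degen n j'))" .
      have d: "iter_degen n l (cube_comp \<delta> (degen n j'))"
        using iter_degen.step[OF l(1) ij(3,4)] m by simp
      have "epi_part (cube_comp \<gamma> (face (Suc n) i \<epsilon>)) = cube_comp \<delta> (degen n j')"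
        unfolding fac
        by (rule factorization_parts(1)[OF iter_degen_epi[OF d] iter_degen_Hom[OF d]
              iter_face_mono[OF l(2)] iter_face_Hom[OF l(2)]])
      moreover have "cube_comp \<delta> (degen n j') \<noteq> cube_id n"
      proof
        assume "cube_comp \<delta> (degen n j') = cube_id n"
        then have "l = n"
          using iter_degen_Hom[OF d] by (simp add: Hom_Box cube_id_def)
        \<comment> \<open>Iterated degeneracies never raise the dimension, so the target has
          dimension at most \<open>m\<close>, which is less than \<open>n\<close>.\<close>
        moreover have "l \<le> m"
          using l(1) by (induction rule: iter_degen.induct) auto
        ultimately show False using m by simp
      qed
      ultimately show ?thesis by simp
    qed
    then show ?thesis by blast
  qed
qed

lemma noniso_epi_cases:
  assumes "is_epi Box \<gamma>" "\<gamma> \<in> Hom Box n k" "\<gamma> \<noteq> cube_id n"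
  obtains m \<beta> i where "n = Suc m" "is_epi Box \<beta>" "\<beta> \<in> Hom Box m k" "1 \<le> i" "i \<le> Suc m"
    "\<gamma> = cube_comp \<beta> (degen (Suc m) i)"
proof -
  have "iter_degen n k \<gamma>" using assms epi_iff_iter_degen by blast
  then show ?thesis
  proof (cases rule: iter_degen.cases)
    case id
    with assms(3) show ?thesis by simp
  next
    case (step m \<beta> i)
    then show ?thesis using that iter_degen_epi iter_degen_Hom by metis
  qed
qed

text \<open>The converse of \<open>noniso_epi_cases\<close>: a degeneracy lowers the dimension and
  nothing after it raises it again. Together they identify the non-identity summands with those hit
  by degeneracy operators.\<close>

lemma epi_comp_degen:
  assumes "is_epi Box \<beta>" "\<beta> \<in> Hom Box m k" "1 \<le> i" "i \<le> Suc m"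
  shows "is_epi Box (cube_comp \<beta> (degen (Suc m) i))" "cube_comp \<beta> (degen (Suc m) i) \<in> Hom Box (Suc m) k"
    "cube_comp \<beta> (degen (Suc m) i) \<noteq> cube_id (Suc m)"
proof -
  have b: "iter_degen m k \<beta>" using assms epi_iff_iter_degen by blast
  note d = iter_degen.step[OF b assms(3,4)]
  show "is_epi Box (cube_comp \<beta> (degen (Suc m) i))" "cube_comp \<beta> (degen (Suc m) i) \<in> Hom Box (Suc m) k"
    using iter_degen_epi[OF d] iter_degen_Hom[OF d] by auto
  show "cube_comp \<beta> (degen (Suc m) i) \<noteq> cube_id (Suc m)"
  proof
    assume "cube_comp \<beta> (degen (Suc m) i) = cube_id (Suc m)"
    then have "k = Suc m"
      using iter_degen_Hom[OF d] by (simp add: Hom_Box cube_id_def)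
    moreover have "k \<le> m"
      using b by (induction rule: iter_degen.induct) auto
    ultimately show False by simp
  qed
qed

section \<open>The universal cubical set\<close>

lemma Box_plus_simps [simp]:
  "Obj Box_plus = UNIV" "Arr Box_plus = {f. is_mono Box f}" "Dom Box_plus = Dom Box"
  "Cod Box_plus = Cod Box" "Idt Box_plus = cube_id" "Comp Box_plus = cube_comp"
  by (simp_all add: Box_plus_def)

lemma Hom_Box_plus: "\<mu> \<in> Hom Box_plus m n \<longleftrightarrow> \<mu> \<in> Hom Box m n \<and> is_mono Box \<mu>"
  by (auto simp: Hom_def is_mono_def)

lemma Hom_Box_Cod: "\<alpha> \<in> Hom Box m n \<Longrightarrow> Cod Box \<alpha> = n"
  by (simp add: Hom_def)

lemma Cod_cube_id [simp]: "Cod Box (cube_id n) = n"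
  by (simp add: cube_id_def)

lemma cube_id_mono: "is_mono Box (cube_id n)" and cube_id_epi: "is_epi Box (cube_id n)"
  using Box.mono_id[of n] Box.epi_id[of n] by simp_all

context
  fixes X :: "(nat, cube_map, 'x) psh"
  assumes X: "semicubical_set X"
begin

lemma semicubical_act_closed:
  assumes "is_mono Box \<mu>" "\<mu> \<in> Hom Box m n" "x \<in> At X n"
  shows "Act X \<mu> x \<in> At X m"
proof -
  obtain f where "\<mu> = (m, f, n)" using assms(2) by (auto simp: Hom_Box)
  then show ?thesis using X assms unfolding is_presheaf_def by auto
qed

lemma semicubical_act_id: "x \<in> At X n \<Longrightarrow> Act X (cube_id n) x = x"
  using X unfolding is_presheaf_def by auto

lemma semicubical_act_comp:
  assumes "is_mono Box \<mu>" "\<mu> \<in> Hom Box l m" "is_mono Box \<nu>" "\<nu> \<in> Hom Box m n" "x \<in> At X n"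
  shows "Act X (cube_comp \<nu> \<mu>) x = Act X \<mu> (Act X \<nu> x)"
proof -
  obtain f g where "\<mu> = (l, f, m)" "\<nu> = (m, g, n)"
    using assms(2,4) by (auto simp: Hom_Box)
  then show ?thesis using X assms unfolding is_presheaf_def by auto
qed

end

lemma At_Lan: "(\<gamma>, x) \<in> At (Lan X) n \<longleftrightarrow>
    is_epi Box \<gamma> \<and> \<gamma> \<in> Hom Box n (Cod Box \<gamma>) \<and> x \<in> At X (Cod Box \<gamma>)"
  by (auto simp: Lan_def Hom_def is_epi_def)

text \<open>By uniqueness of factorizations any exhibited one may replace the pair picked by the
  descriptions; all later calculations in \<open>Lan X\<close> go through this rule.\<close>

lemma Act_Lan:
  assumes "is_epi Box e" "e \<in> Hom Box m l" "is_mono Box \<mu>" "\<mu> \<in> Hom Box l k"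
    "cube_comp \<gamma> \<alpha> = cube_comp \<mu> e"
  shows "Act (Lan X) \<alpha> (\<gamma>, x) = (e, Act X \<mu> x)"
  using factorization_parts[OF assms(1-4)] assms(5) by (simp add: Lan_def)

text \<open>The monomorphism in the description is unique because the epimorphism \<open>e\<close>
  can be cancelled.\<close>

lemma S_functor_arr:
  assumes "is_epi Box e" "e \<in> Hom Box m l" "is_mono Box \<mu>" "\<mu> \<in> Hom Box l k"
    "cube_comp \<gamma> \<alpha> = cube_comp \<mu> e" "Cod Box \<gamma> = k"
  shows "Farr (S_functor X) ((m, e, Act X \<mu> x), \<alpha>, (n, \<gamma>, x)) = ((l, Act X \<mu> x), \<mu>, (k, x))"
proof -
  have "(THE \<nu>. is_mono Box \<nu> \<and> \<nu> \<in> Hom Box l k \<and> cube_comp \<nu> e = cube_comp \<gamma> \<alpha> \<and>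
      Act X \<nu> x = Act X \<mu> x) = \<mu>"
    using assms(3-5) Box_epiD[OF assms(1,2) _ assms(4)] by (intro the_equality) auto
  then show ?thesis
    using Hom_Box_Cod[OF assms(2)] assms(6) by (simp add: S_functor_def)
qed

context preadditive_category begin

lemma inverse_of_cokernels:
  assumes f: "f \<in> Hom A a b" and c: "is_cokernel A f c" "c \<in> Hom A b d" and c': "is_cokernel A f c'" "c' \<in> Hom A b d'"
    and u: "u \<in> Hom A d d'" "u \<cdot> c = c'" and v: "v \<in> Hom A d' d" "v \<cdot> c' = c"
  shows "v \<cdot> u = Idt A d"
proof (rule cokernel_ext[OF c(1)])
  have [simp]: "Cod A c = d" using c(2) by (simp add: Hom_def)
  show "v \<cdot> u \<in> Hom A (Cod A c) d" using comp_closed[OF u(1) v(1)] by simp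
  show "Idt A d \<in> Hom A (Cod A c) d" using id_closed[OF Hom_Obj(2)[OF c(2)]] by simp
  show "(v \<cdot> u) \<cdot> c = Idt A d \<cdot> c"
    using comp_assoc[OF c(2) u(1) v(1)] u(2) v(2) id_left[OF c(2)] by simp
qed

end

context abelian_category begin

text \<open>Degreewise isomorphisms commuting with the differentials carry the relation that the
  differential squares to zero from L back to K. This spares the cubical relations for the face
  operators of \<open>Lan X\<close>.\<close>

lemma transport_complex:
  assumes Ch: "\<And>n. Ch K n \<in> Obj A" and L: "is_complex A L"
    and D: "\<And>n. Diff K (Suc n) \<in> Hom A (Ch K (Suc n)) (Ch K n)"
    and f: "\<And>n. f n \<in> Hom A (Ch K n) (Ch L n)" and g: "\<And>n. g n \<in> Hom A (Ch L n) (Ch K n)"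
    and gf: "\<And>n. g n \<cdot> f n = Idt A (Ch K n)" and fg: "\<And>n. f n \<cdot> g n = Idt A (Ch L n)"
    and fD: "\<And>n. f n \<cdot> Diff K (Suc n) = Diff L (Suc n) \<cdot> f (Suc n)"
  shows "is_complex A K" "is_chain_map A K L f" "is_chain_map A L K g"
proof -
  note DL = Diff_closed[OF L]
  have DD: "Diff K (Suc n) \<cdot> Diff K (Suc (Suc n)) = Zero A (Ch K (Suc (Suc n))) (Ch K n)" for n
  proof -
    let ?DD = "Diff K (Suc n) \<cdot> Diff K (Suc (Suc n))"
    have "f n \<cdot> ?DD = (Diff L (Suc n) \<cdot> Diff L (Suc (Suc n))) \<cdot> f (Suc (Suc n))"
      by (rule commuting_squares[OF D D DL DL f f f fD fD])
    also have "\<dots> = Zero A (Ch K (Suc (Suc n))) (Ch L n)"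
      using zero_left[OF f Ch_closed[OF L]] Diff_Diff[OF L] by simp
    finally have "g n \<cdot> (f n \<cdot> ?DD) = Zero A (Ch K (Suc (Suc n))) (Ch K n)"
      using zero_right[OF g Ch] by simp
    then show ?thesis
      using comp_assoc[OF comp_closed[OF D D] f g, of n] gf id_left[OF comp_closed[OF D D], of n] by simp
  qed
  then show "is_complex A K" using Ch D by (simp add: is_complex_def)
  show "is_chain_map A K L f" using f fD by (simp add: is_chain_map_def)
  have "g n \<cdot> Diff L (Suc n) = Diff K (Suc n) \<cdot> g (Suc n)" for n
  proof -
    have "g n \<cdot> Diff L (Suc n) = g n \<cdot> (Diff L (Suc n) \<cdot> (f (Suc n) \<cdot> g (Suc n)))"
      using fg id_right[OF DL] by simp
    also have "Diff L (Suc n) \<cdot> (f (Suc n) \<cdot> g (Suc n)) = f n \<cdot> (Diff K (Suc n) \<cdot> g (Suc n))"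
      by (simp only: comp_assoc[OF g f DL, symmetric] fD[symmetric] comp_assoc[OF g D f])
    also have "g n \<cdot> \<dots> = Diff K (Suc n) \<cdot> g (Suc n)"
      by (simp only: comp_assoc[OF comp_closed[OF g D] f g, symmetric] gf id_left[OF comp_closed[OF g D]])
    finally show ?thesis .
  qed
  then show "is_chain_map A L K g" using g by (simp add: is_chain_map_def)
qed

end

locale universal_cubical_set = ab4_category U A
  for U :: "'u itself" and A :: "('o, 'm, 'z) ab_cat_scheme" (structure) +
  fixes X :: "(nat, cube_map, 'u) psh"
  assumes infinite_universe: "infinite (UNIV :: 'u set)"
    and semicubical: "semicubical_set X"
begin

lemmas act_closed = semicubical_act_closed[OF semicubical]
lemmas act_id = semicubical_act_id[OF semicubical]
lemmas act_comp = semicubical_act_comp[OF semicubical]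

lemma has_coprod_small: "(\<And>x. x \<in> I \<Longrightarrow> a x \<in> Obj A) \<Longrightarrow> has_coprod A (I :: 'u set) a"
  by (rule has_coprod_inj[where r = id]) auto

text \<open>For the sums over \<open>{1..n}\<close> on which the degeneracies act jointly: an
  infinite universe contains a copy of the natural numbers.\<close>

lemma has_coprod_nat:
  assumes "\<And>i. i \<in> I \<Longrightarrow> a i \<in> Obj A"
  shows "has_coprod A (I :: nat set) a"
proof -
  obtain r :: "nat \<Rightarrow> 'u" where "inj r"
    using infinite_countable_subset[OF infinite_universe] by blast
  then show ?thesis
    using has_coprod_inj[of r I a] assms inj_on_subset by blast
qed

lemma has_coprod_Lan:
  assumes "\<And>c. c \<in> At (Lan X) n \<Longrightarrow> a c \<in> Obj A"
  shows "has_coprod A (At (Lan X) n) a"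
proof -
  obtain r :: "cube_map \<times> 'u \<Rightarrow> 'u" where "inj_on r (box_arr \<times> UNIV)"
    using countable_times_inj[OF infinite_universe countable_box_arr] .
  moreover have "At (Lan X) n \<subseteq> box_arr \<times> UNIV"
    by (auto simp: Lan_def is_epi_def)
  ultimately show ?thesis
    using has_coprod_inj[of r] assms inj_on_subset by blast
qed

end

locale universal_coefficients = universal_cubical_set U A X
  for U :: "'u itself" and A :: "('o, 'm, 'z) ab_cat_scheme" (structure)
    and X :: "(nat, cube_map, 'u) psh" +
  fixes F :: "('u, 'o, 'm) coeff"
  assumes coeff_functor: "is_functor (op_cat (elements Box_plus X)) A F"
begin

lemma elements_arr:
  "is_mono Box \<mu> \<Longrightarrow> \<mu> \<in> Hom Box b c \<Longrightarrow> x \<in> At X c \<Longrightarrow>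
    ((b, Act X \<mu> x), \<mu>, (c, x)) \<in> Arr (elements Box_plus X)"
  using act_closed by (auto simp: elements_def Hom_Box_plus)

lemma F_obj: "x \<in> At X n \<Longrightarrow> Fobj F (n, x) \<in> Obj A"
  using coeff_functor by (auto simp: is_functor_def op_cat_def elements_def)

lemma F_arr:
  assumes "is_mono Box \<mu>" "\<mu> \<in> Hom Box b c" "x \<in> At X c"
  shows "Farr F ((b, Act X \<mu> x), \<mu>, (c, x)) \<in> Hom A (Fobj F (c, x)) (Fobj F (b, Act X \<mu> x))"
proof -
  have "\<forall>f \<in> Arr (elements Box_plus X). Farr F f \<in> Hom A (Fobj F (Cod (elements Box_plus X) f))
      (Fobj F (Dom (elements Box_plus X) f))"
    using coeff_functor by (simp add: is_functor_def op_cat_def)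
  from bspec[OF this elements_arr[OF assms]] show ?thesis by (simp add: elements_def)
qed

lemma F_id:
  assumes "x \<in> At X n"
  shows "Farr F ((n, x), cube_id n, (n, x)) = Idt A (Fobj F (n, x))"
proof -
  have "(n, x) \<in> Obj (op_cat (elements Box_plus X))"
    using assms by (simp add: op_cat_def elements_def)
  then have "Farr F (Idt (op_cat (elements Box_plus X)) (n, x)) = Idt A (Fobj F (n, x))"
    using coeff_functor unfolding is_functor_def by blast
  then show ?thesis by (simp add: op_cat_def elements_def)
qed

lemma F_comp:
  assumes "is_mono Box \<mu>" "\<mu> \<in> Hom Box l m" "is_mono Box \<nu>" "\<nu> \<in> Hom Box m n" "x \<in> At X n"
  shows "Farr F ((l, Act X (cube_comp \<nu> \<mu>) x), cube_comp \<nu> \<mu>, (n, x)) =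
    Farr F ((l, Act X \<mu> (Act X \<nu> x)), \<mu>, (m, Act X \<nu> x)) \<cdot> Farr F ((m, Act X \<nu> x), \<nu>, (n, x))"
proof -
  let ?E = "op_cat (elements Box_plus X)"
  have comp: "\<forall>f \<in> Arr ?E. \<forall>g \<in> Arr ?E. Cod ?E f = Dom ?E g \<longrightarrow> Farr F (g \<cdot>\<^bsub>?E\<^esub> f) = Farr F g \<cdot> Farr F f"
    using coeff_functor unfolding is_functor_def by blast
  have \<nu>: "((m, Act X \<nu> x), \<nu>, (n, x)) \<in> Arr ?E"
    using elements_arr[OF assms(3,4,5)] by (simp add: op_cat_def)
  have \<mu>: "((l, Act X \<mu> (Act X \<nu> x)), \<mu>, (m, Act X \<nu> x)) \<in> Arr ?E"
    using elements_arr[OF assms(1,2) act_closed[OF assms(3,4,5)]] by (simp add: op_cat_def)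
  have "Cod ?E ((m, Act X \<nu> x), \<nu>, (n, x)) = Dom ?E ((l, Act X \<mu> (Act X \<nu> x)), \<mu>, (m, Act X \<nu> x))"
    by (simp add: op_cat_def elements_def)
  with bspec[OF bspec[OF comp \<nu>] \<mu>]
  have "Farr F (((l, Act X \<mu> (Act X \<nu> x)), \<mu>, (m, Act X \<nu> x)) \<cdot>\<^bsub>?E\<^esub> ((m, Act X \<nu> x), \<nu>, (n, x))) =
    Farr F ((l, Act X \<mu> (Act X \<nu> x)), \<mu>, (m, Act X \<nu> x)) \<cdot> Farr F ((m, Act X \<nu> x), \<nu>, (n, x))"
    by blast
  then show ?thesis
    using act_comp[OF assms] by (simp add: op_cat_def elements_def)
qed

section \<open>The complex of the semi-cubical set\<close>

sublocale P: face_coefficients A X F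
proof
  show "has_coprod A (At X n) (\<lambda>x. Fobj F (n, x))" for n
    by (rule has_coprod_small) (rule F_obj)
qed (use act_closed[OF face_mono face_Hom] F_arr[OF face_mono face_Hom] in blast)+

text \<open>Functoriality merges two successive faces into one arrow along the composite cube map,
  so relations between face operators reduce to equations between cube maps.\<close>

lemma face_op_face_op_in:
  fixes \<epsilon> \<eta>
  assumes i: "1 \<le> i" "i \<le> Suc n" and j: "1 \<le> j" "j \<le> Suc (Suc n)" and x: "x \<in> At X (Suc (Suc n))"
  defines "\<mu> \<equiv> cube_comp (face (Suc (Suc n)) j \<eta>) (face (Suc n) i \<epsilon>)"
  shows "(face_op A X F (Suc n) i \<epsilon> \<cdot> face_op A X F (Suc (Suc n)) j \<eta>) \<cdot> chain_in A X F (Suc (Suc n)) x =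
    chain_in A X F n (Act X \<mu> x) \<cdot> Farr F ((n, Act X \<mu> x), \<mu>, (Suc (Suc n), x))"
proof -
  let ?y = "Act X (face (Suc (Suc n)) j \<eta>) x"
  let ?z = "Act X (face (Suc n) i \<epsilon>) ?y"
  let ?f = "Farr F ((n, ?z), face (Suc n) i \<epsilon>, (Suc n, ?y))"
  let ?g = "Farr F ((Suc n, ?y), face (Suc (Suc n)) j \<eta>, (Suc (Suc n), x))"
  note y = P.face_at[OF j x, of \<eta>] note z = P.face_at[OF i y, of \<epsilon>]
  note fo = P.face_op_closed[OF i] P.face_op_closed[OF j]
  note fi = face_mono[OF i] face_Hom[OF i] and fj = face_mono[OF j] face_Hom[OF j]
  have "(face_op A X F (Suc n) i \<epsilon> \<cdot> face_op A X F (Suc (Suc n)) j \<eta>) \<cdot> chain_in A X F (Suc (Suc n)) x =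
      face_op A X F (Suc n) i \<epsilon> \<cdot> (chain_in A X F (Suc n) ?y \<cdot> ?g)"
    by (simp only: comp_assoc[OF P.chain_in_closed[OF x] fo(2,1)] P.face_op_in[OF j x])
  also have "\<dots> = chain_in A X F n ?z \<cdot> (?f \<cdot> ?g)"
    by (simp only: comp_assoc[OF P.face_arr[OF j x] P.chain_in_closed[OF y] fo(1), symmetric]
        P.face_op_in[OF i y] comp_assoc[OF P.face_arr[OF j x] P.face_arr[OF i y] P.chain_in_closed[OF z]])
  also have "?f \<cdot> ?g = Farr F ((n, Act X \<mu> x), \<mu>, (Suc (Suc n), x))"
    unfolding \<mu>_def by (rule F_comp[OF fi fj x, symmetric])
  also have "?z = Act X \<mu> x"
    unfolding \<mu>_def by (rule act_comp[OF fi fj x, symmetric])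
  finally show ?thesis .
qed

lemma face_op_cubical:
  assumes "1 \<le> i" "i < j" "j \<le> Suc (Suc n)"
  shows "face_op A X F (Suc n) i \<epsilon> \<cdot> face_op A X F (Suc (Suc n)) j \<eta> =
      face_op A X F (Suc n) (j - 1) \<eta> \<cdot> face_op A X F (Suc (Suc n)) i \<epsilon>"
proof -
  have i: "i \<le> Suc n" "i \<le> Suc (Suc n)" and j: "1 \<le> j - 1" "j - 1 \<le> Suc n" "1 \<le> j" using assms by auto
  show ?thesis
    by (rule P.chain_ext[OF comp_closed[OF P.face_op_closed[OF j(3) assms(3)] P.face_op_closed[OF assms(1) i(1)]]
          comp_closed[OF P.face_op_closed[OF assms(1) i(2)] P.face_op_closed[OF j(1,2)]]])
      (simp only: face_op_face_op_in[OF assms(1) i(1) j(3) assms(3)]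
        face_op_face_op_in[OF j(1,2) assms(1) i(2)] face_face[OF assms])
qed

lemma plus_complex: "is_complex A (plus_cx A X F)"
  unfolding is_complex_def plus_cx_def
  using P.chain_closed P.chain_diff_closed P.chain_diff_chain_diff[OF face_op_cubical] by simp

definition FS :: "(cube_map \<times> 'u, 'o, 'm) coeff" where
  "FS = fctr_comp F (op_fctr (S_functor X))"

lemma FS_obj: "Fobj FS (n, \<gamma>, x) = Fobj F (Cod Box \<gamma>, x)"
  by (simp add: FS_def fctr_comp_def op_fctr_def S_functor_def)

text \<open>The induced coefficients see only the monomorphic part of \<gamma>\<alpha>. Two
  consequences carry the argument: arrows of degeneracies become identities, and arrows with equal
  \<gamma>\<alpha> have equal values.\<close>

lemma FS_arr:
  assumes "is_epi Box e" "e \<in> Hom Box m l" "is_mono Box \<mu>" "\<mu> \<in> Hom Box l k"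
    "cube_comp \<gamma> \<alpha> = cube_comp \<mu> e" "Cod Box \<gamma> = k"
  shows "Farr FS ((m, e, Act X \<mu> x), \<alpha>, (n, \<gamma>, x)) = Farr F ((l, Act X \<mu> x), \<mu>, (k, x))"
  using S_functor_arr[OF assms, of X x n]
  by (simp add: FS_def fctr_comp_def op_fctr_def)

lemma Lan_arr:
  assumes "c \<in> At (Lan X) n" "\<alpha> \<in> Hom Box m n"
  shows "Act (Lan X) \<alpha> c \<in> At (Lan X) m"
    "Farr FS ((m, Act (Lan X) \<alpha> c), \<alpha>, (n, c)) \<in> Hom A (Fobj FS (n, c)) (Fobj FS (m, Act (Lan X) \<alpha> c))"
proof -
  obtain \<gamma> x where c: "c = (\<gamma>, x)" by (cases c)
  with assms(1) have \<gamma>: "is_epi Box \<gamma>" "\<gamma> \<in> Hom Box n (Cod Box \<gamma>)" "x \<in> At X (Cod Box \<gamma>)"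
    by (auto simp: At_Lan)
  from factorization_exists[OF Box_comp_closed[OF assms(2) \<gamma>(2)]] obtain l e \<mu>
    where f: "is_epi Box e" "e \<in> Hom Box m l" "is_mono Box \<mu>" "\<mu> \<in> Hom Box l (Cod Box \<gamma>)"
      "cube_comp \<gamma> \<alpha> = cube_comp \<mu> e" .
  show "Act (Lan X) \<alpha> c \<in> At (Lan X) m"
    "Farr FS ((m, Act (Lan X) \<alpha> c), \<alpha>, (n, c)) \<in> Hom A (Fobj FS (n, c)) (Fobj FS (m, Act (Lan X) \<alpha> c))"
    unfolding c Act_Lan[OF f] FS_arr[OF f refl]
    using F_arr[OF f(3,4) \<gamma>(3)] act_closed[OF f(3,4) \<gamma>(3)] f Hom_Box_Cod[OF f(2)]
    by (auto simp: At_Lan FS_obj)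
qed

lemma FS_obj_closed: "c \<in> At (Lan X) n \<Longrightarrow> Fobj FS (n, c) \<in> Obj A"
  using F_obj by (cases c) (auto simp: FS_obj At_Lan)

sublocale L: face_coefficients A "Lan X" FS
proof
  show "has_coprod A (At (Lan X) n) (\<lambda>x. Fobj FS (n, x))" for n
    by (rule has_coprod_Lan) (rule FS_obj_closed)
qed (use Lan_arr face_Hom in blast)+

section \<open>The projection onto the identity summands\<close>

abbreviation "chainL \<equiv> chain A (Lan X) FS"
abbreviation "chainP \<equiv> chain A X F"
abbreviation "inL \<equiv> chain_in A (Lan X) FS"
abbreviation "inP \<equiv> chain_in A X F"

lemma Lan_id: "x \<in> At X n \<Longrightarrow> (cube_id n, x) \<in> At (Lan X) n"
  by (simp add: At_Lan cube_id_epi)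

definition projection :: "nat \<Rightarrow> 'm" where
  "projection n = copair A (At (Lan X) n) (\<lambda>c. Fobj FS (n, c)) (chainP n)
     (\<lambda>(\<gamma>, x). if \<gamma> = cube_id n then inP n x else Zero A (Fobj F (Cod Box \<gamma>, x)) (chainP n))"

lemma projection:
  shows projection_closed: "projection n \<in> Hom A (chainL n) (chainP n)"
    and projection_in: "(\<gamma>, x) \<in> At (Lan X) n \<Longrightarrow> projection n \<cdot> inL n (\<gamma>, x) =
      (if \<gamma> = cube_id n then inP n x else Zero A (Fobj F (Cod Box \<gamma>, x)) (chainP n))"
proof -
  have g: "(\<lambda>(\<gamma>, x). if \<gamma> = cube_id n then inP n x else Zero A (Fobj F (Cod Box \<gamma>, x)) (chainP n)) c
      \<in> Hom A (Fobj FS (n, c)) (chainP n)" if "c \<in> At (Lan X) n" for c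
    using that P.chain_in_closed[of "snd c" n] zero_closed[OF F_obj P.chain_closed]
    by (cases c) (auto simp: At_Lan FS_obj)
  show "projection n \<in> Hom A (chainL n) (chainP n)"
    unfolding projection_def by (rule L.chain_copair_closed[OF P.chain_closed g])
  show "(\<gamma>, x) \<in> At (Lan X) n \<Longrightarrow> projection n \<cdot> inL n (\<gamma>, x) =
      (if \<gamma> = cube_id n then inP n x else Zero A (Fobj F (Cod Box \<gamma>, x)) (chainP n))"
    unfolding projection_def by (subst L.chain_copair_in[OF P.chain_closed g]) auto
qed

text \<open>There are two different reasons for equality: either both faces are the same element
  with the same coefficient arrow, or both land in summands that the projection kills.\<close>

lemma projection_face_op_eq:
  assumes "(\<gamma>, x) \<in> At (Lan X) (Suc n)" "\<gamma> \<noteq> cube_id (Suc n)" "1 \<le> i" "i \<le> Suc n"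
  shows "(projection n \<cdot> face_op A (Lan X) FS (Suc n) i False) \<cdot> inL (Suc n) (\<gamma>, x) =
    (projection n \<cdot> face_op A (Lan X) FS (Suc n) i True) \<cdot> inL (Suc n) (\<gamma>, x)"
proof -
  let ?k = "Cod Box \<gamma>" and ?\<delta> = "face (Suc n) i"
  have \<gamma>: "is_epi Box \<gamma>" "\<gamma> \<in> Hom Box (Suc n) ?k" and x: "x \<in> At X ?k"
    using assms(1) by (auto simp: At_Lan)
  note \<delta> = face_Hom[OF assms(3,4)]
  have eq: "(projection n \<cdot> face_op A (Lan X) FS (Suc n) i \<epsilon>) \<cdot> inL (Suc n) (\<gamma>, x) =
      (projection n \<cdot> inL n (Act (Lan X) (?\<delta> \<epsilon>) (\<gamma>, x))) \<cdot>
        Farr FS ((n, Act (Lan X) (?\<delta> \<epsilon>) (\<gamma>, x)), ?\<delta> \<epsilon>, (Suc n, \<gamma>, x))" for \<epsilon>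
    by (simp only: comp_assoc[OF L.chain_in_closed[OF assms(1)] L.face_op_closed[OF assms(3,4)] projection_closed]
        L.face_op_in[OF assms(3,4,1)]
        comp_assoc[OF L.face_arr[OF assms(3,4,1)] L.chain_in_closed[OF L.face_at[OF assms(3,4,1)]] projection_closed])
  from face_of_noniso_epi[OF \<gamma> assms(2-4)] show ?thesis
  proof
    assume same: "cube_comp \<gamma> (?\<delta> False) = cube_comp \<gamma> (?\<delta> True)"
    from factorization_exists[OF Box_comp_closed[OF \<delta> \<gamma>(2)]] obtain l e \<mu>
      where f: "is_epi Box e" "e \<in> Hom Box n l" "is_mono Box \<mu>" "\<mu> \<in> Hom Box l ?k"
        "cube_comp \<gamma> (?\<delta> True) = cube_comp \<mu> e" .
    \<comment> \<open>One factorization serves both ends. The two arrows in the category of elements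
      are different, but the coefficients take the same value on them.\<close>
    note f' = f(1-4) f(5)[folded same]
    show ?thesis
      unfolding eq FS_arr[OF f refl] FS_arr[OF f' refl] Act_Lan[OF f] Act_Lan[OF f'] ..
  next
    assume noniso: "\<forall>\<epsilon>. epi_part (cube_comp \<gamma> (?\<delta> \<epsilon>)) \<noteq> cube_id n"
    have "(projection n \<cdot> face_op A (Lan X) FS (Suc n) i \<epsilon>) \<cdot> inL (Suc n) (\<gamma>, x) =
        Zero A (Fobj F (?k, x)) (chainP n)" for \<epsilon>
    proof -
      obtain e y where c: "Act (Lan X) (?\<delta> \<epsilon>) (\<gamma>, x) = (e, y)" by fastforce
      then have "e \<noteq> cube_id n" using noniso by (auto simp: Lan_def)
      then show ?thesis
        using zero_left[OF L.face_arr[OF assms(3,4,1)] P.chain_closed, of \<epsilon> n]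
          projection_in[of e y n] L.face_at[OF assms(3,4,1), of \<epsilon>]
        unfolding eq c by (simp add: FS_obj)
    qed
    then show ?thesis by simp
  qed
qed

text \<open>A face map is mono, so it factors with the identity as epimorphic part: the face of an
  identity summand is again an identity summand. Here each operator commutes with the projection by
  itself.\<close>

lemma projection_face_op_id:
  assumes x: "x \<in> At X (Suc n)" and i: "1 \<le> i" "i \<le> Suc n"
  shows "(projection n \<cdot> face_op A (Lan X) FS (Suc n) i \<epsilon>) \<cdot> inL (Suc n) (cube_id (Suc n), x) =
    face_op A X F (Suc n) i \<epsilon> \<cdot> inP (Suc n) x"
proof -
  let ?\<delta> = "face (Suc n) i \<epsilon>" and ?c = "(cube_id (Suc n), x)"
  note c = Lan_id[OF x]
  have "cube_comp (cube_id (Suc n)) ?\<delta> = cube_comp ?\<delta> (cube_id n)"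
    using Box_id_left[OF face_Hom[OF i]] Box_id_right[OF face_Hom[OF i]] by simp
  note f = cube_id_epi Box_id_closed face_mono[OF i] face_Hom[OF i] this
  have "(projection n \<cdot> face_op A (Lan X) FS (Suc n) i \<epsilon>) \<cdot> inL (Suc n) ?c =
      (projection n \<cdot> inL n (Act (Lan X) ?\<delta> ?c)) \<cdot> Farr FS ((n, Act (Lan X) ?\<delta> ?c), ?\<delta>, (Suc n, ?c))"
    by (simp only: comp_assoc[OF L.chain_in_closed[OF c] L.face_op_closed[OF i] projection_closed]
        L.face_op_in[OF i c]
        comp_assoc[OF L.face_arr[OF i c] L.chain_in_closed[OF L.face_at[OF i c]] projection_closed])
  also have "\<dots> = inP n (Act X ?\<delta> x) \<cdot> Farr F ((n, Act X ?\<delta> x), ?\<delta>, (Suc n, x))"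
    unfolding FS_arr[OF f Cod_cube_id] Act_Lan[OF f]
    using projection_in[OF Lan_id[OF P.face_at[OF i x]]] by simp
  also have "\<dots> = face_op A X F (Suc n) i \<epsilon> \<cdot> inP (Suc n) x"
    by (rule P.face_op_in[OF i x, symmetric])
  finally show ?thesis .
qed

text \<open>Tested on each summand. On an identity summand the two terms agree separately; on any
  other summand one side is a difference of equal arrows and the other factors through a zero
  arrow.\<close>

lemma projection_face_diff:
  assumes i: "1 \<le> i" "i \<le> Suc n"
  shows "projection n \<cdot> L.face_diff n i = P.face_diff n i \<cdot> projection (Suc n)"
proof (rule L.chain_ext)
  note pf = comp_closed[OF L.face_op_closed[OF i] projection_closed]
  show "projection n \<cdot> L.face_diff n i \<in> Hom A (chainL (Suc n)) (chainP n)"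
    by (rule comp_closed[OF L.face_diff_closed[OF i] projection_closed])
  show "P.face_diff n i \<cdot> projection (Suc n) \<in> Hom A (chainL (Suc n)) (chainP n)"
    by (rule comp_closed[OF projection_closed P.face_diff_closed[OF i]])
  fix c assume c: "c \<in> At (Lan X) (Suc n)"
  obtain \<gamma> x where cx: "c = (\<gamma>, x)" by (cases c)
  note c' = c[unfolded cx]
  then have x: "x \<in> At X (Cod Box \<gamma>)" by (simp add: At_Lan)
  have lhs: "(projection n \<cdot> L.face_diff n i) \<cdot> inL (Suc n) c = hom_diff A (Fobj F (Cod Box \<gamma>, x)) (chainP n)
      ((projection n \<cdot> face_op A (Lan X) FS (Suc n) i False) \<cdot> inL (Suc n) c)
      ((projection n \<cdot> face_op A (Lan X) FS (Suc n) i True) \<cdot> inL (Suc n) c)"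
    unfolding L.comp_face_diff[OF i projection_closed]
    using hom_diff_comp[OF L.chain_in_closed[OF c] pf pf] cx by (simp add: FS_obj)
  have rhs: "(P.face_diff n i \<cdot> projection (Suc n)) \<cdot> inL (Suc n) c =
      P.face_diff n i \<cdot> (projection (Suc n) \<cdot> inL (Suc n) c)"
    by (rule comp_assoc[OF L.chain_in_closed[OF c] projection_closed P.face_diff_closed[OF i]])
  show "(projection n \<cdot> L.face_diff n i) \<cdot> inL (Suc n) c = (P.face_diff n i \<cdot> projection (Suc n)) \<cdot> inL (Suc n) c"
  proof (cases "\<gamma> = cube_id (Suc n)")
    case True
    then have x: "x \<in> At X (Suc n)" using x by simp
    show ?thesis
      unfolding lhs rhs unfolding cx True projection_face_op_id[OF x i]
      using projection_in[OF Lan_id[OF x]] P.face_diff_comp[OF i P.chain_in_closed[OF x]] by simp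
  next
    case False
    have "(projection n \<cdot> L.face_diff n i) \<cdot> inL (Suc n) c = Zero A (Fobj F (Cod Box \<gamma>, x)) (chainP n)"
      unfolding lhs unfolding cx projection_face_op_eq[OF c' False i]
      using hom_diff_self[OF comp_closed[OF L.chain_in_closed[OF c'] pf]] by (simp add: FS_obj)
    moreover have "(P.face_diff n i \<cdot> projection (Suc n)) \<cdot> inL (Suc n) c = Zero A (Fobj F (Cod Box \<gamma>, x)) (chainP n)"
      unfolding rhs unfolding cx using projection_in[OF c'] False zero_right[OF P.face_diff_closed[OF i] F_obj[OF x]] by simp
    ultimately show ?thesis by simp
  qed
qed

lemma projection_chain_diff:
  "projection n \<cdot> chain_diff A (Lan X) FS (Suc n) = chain_diff A X F (Suc n) \<cdot> projection (Suc n)"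
  by (rule chain_diff_natural[OF L.face_coefficients_axioms P.face_coefficients_axioms
        projection_closed projection_closed projection_face_diff])

end

section \<open>The projection as a cokernel of the degeneracies\<close>

context universal_coefficients begin

lemma degen_op:
  assumes i: "1 \<le> i" "i \<le> Suc n"
  shows degen_op_closed: "degen_op A (Lan X) FS (Suc n) i \<in> Hom A (chainL n) (chainL (Suc n))"
    and degen_op_in: "(\<gamma>, x) \<in> At (Lan X) n \<Longrightarrow> degen_op A (Lan X) FS (Suc n) i \<cdot> inL n (\<gamma>, x) =
      inL (Suc n) (cube_comp \<gamma> (degen (Suc n) i), x)"
proof -
  let ?g = "\<lambda>c. inL (Suc n) (Act (Lan X) (degen (Suc n) i) c) \<cdot>
      Farr FS ((Suc n, Act (Lan X) (degen (Suc n) i) c), degen (Suc n) i, (n, c))"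
  have g: "?g c \<in> Hom A (Fobj FS (n, c)) (chainL (Suc n))" if "c \<in> At (Lan X) n" for c
    using comp_closed[OF Lan_arr(2)[OF that degen_Hom[OF i]] L.chain_in_closed[OF Lan_arr(1)[OF that degen_Hom[OF i]]]] .
  show "degen_op A (Lan X) FS (Suc n) i \<in> Hom A (chainL n) (chainL (Suc n))"
    using L.chain_copair_closed[OF L.chain_closed g] by (simp add: degen_op_def Let_def)
  assume c: "(\<gamma>, x) \<in> At (Lan X) n"
  then have \<gamma>: "is_epi Box \<gamma>" "\<gamma> \<in> Hom Box n (Cod Box \<gamma>)" and x: "x \<in> At X (Cod Box \<gamma>)"
    by (auto simp: At_Lan)
  note d = epi_comp_degen[OF \<gamma> i]
  \<comment> \<open>The composite of \<gamma> with the degeneracy is already epi, so its monomorphic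
    part is an identity, on which both X and F act trivially.\<close>
  note f = d(1,2) cube_id_mono Box_id_closed Box_id_left[OF d(2), symmetric]
  note c' = L.chain_in_closed[OF Lan_arr(1)[OF c degen_Hom[OF i]]]
  have "degen_op A (Lan X) FS (Suc n) i \<cdot> inL n (\<gamma>, x) = ?g (\<gamma>, x)"
    using L.chain_copair_in[OF L.chain_closed g c] by (simp add: degen_op_def Let_def)
  also have "\<dots> = inL (Suc n) (cube_comp \<gamma> (degen (Suc n) i), x)"
    using id_right[OF c'] Hom_Box_Cod[OF d(2)]
    unfolding Act_Lan[OF f] FS_arr[OF f refl] unfolding act_id[OF x] F_id[OF x] by (simp add: FS_obj)
  finally show "degen_op A (Lan X) FS (Suc n) i \<cdot> inL n (\<gamma>, x) =
      inL (Suc n) (cube_comp \<gamma> (degen (Suc n) i), x)" .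
qed

abbreviation "degens_obj n \<equiv> coprod_obj A {1..n} (\<lambda>i. chainL (n - 1))"
abbreviation "degens_in n \<equiv> coprod_in A {1..n} (\<lambda>i. chainL (n - 1))"

text \<open>The arrow under \<open>coker\<close> in \<open>norm_proj\<close>. In degree 0 the
  coproduct is empty, so the truncated \<open>n - 1\<close> has no effect there.\<close>

definition degens :: "nat \<Rightarrow> 'm" where
  "degens n = copair A {1..n} (\<lambda>i. chainL (n - 1)) (chainL n) (\<lambda>i. degen_op A (Lan X) FS n i)"

lemma has_degens: "has_coprod A {1..n} (\<lambda>i. chainL (n - 1))"
  by (rule has_coprod_nat) (rule L.chain_closed)

lemma degens:
  shows degens_closed: "degens n \<in> Hom A (degens_obj n) (chainL n)"
    and degens_in: "i \<in> {1..n} \<Longrightarrow> degens n \<cdot> degens_in n i = degen_op A (Lan X) FS n i"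
proof -
  have op: "degen_op A (Lan X) FS n i \<in> Hom A (chainL (n - 1)) (chainL n)" if "i \<in> {1..n}" for i
    using degen_op_closed[of i "n - 1"] that by (cases n) auto
  show "degens n \<in> Hom A (degens_obj n) (chainL n)"
    unfolding degens_def by (rule copair_closed[OF has_degens L.chain_closed op])
  show "degens n \<cdot> degens_in n i = degen_op A (Lan X) FS n i" if "i \<in> {1..n}"
    unfolding degens_def by (rule copair_in[OF has_degens L.chain_closed op]) (use that in auto)
qed

text \<open>A degeneracy operator merely relabels summands, so vanishing on its image means
  vanishing on the summands it reaches. One direction uses that every non-identity epimorphism is
  reached, the other that only those are.\<close>

lemma degens_vanish_iff:
  assumes g: "g \<in> Hom A (chainL n) b"
  shows "g \<cdot> degens n = Zero A (degens_obj n) b \<longleftrightarrow>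
    (\<forall>\<gamma> x. (\<gamma>, x) \<in> At (Lan X) n \<longrightarrow> \<gamma> \<noteq> cube_id n \<longrightarrow> g \<cdot> inL n (\<gamma>, x) = Zero A (Fobj F (Cod Box \<gamma>, x)) b)"
    (is "?L \<longleftrightarrow> ?R")
proof
  note b = Hom_Obj(2)[OF g]
  have gd: "(g \<cdot> degens n) \<cdot> degens_in n i = g \<cdot> degen_op A (Lan X) FS n i" if "i \<in> {1..n}" for i
    using comp_assoc[OF coprod_in_closed[OF has_degens that] degens_closed g] degens_in[OF that] by simp
  show ?R if L: ?L
  proof (intro allI impI)
    fix \<gamma> x assume c: "(\<gamma>, x) \<in> At (Lan X) n" and "\<gamma> \<noteq> cube_id n"
    then have \<gamma>: "is_epi Box \<gamma>" "\<gamma> \<in> Hom Box n (Cod Box \<gamma>)" "\<gamma> \<noteq> cube_id n" and x: "x \<in> At X (Cod Box \<gamma>)"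
      by (auto simp: At_Lan)
    from noniso_epi_cases[OF \<gamma>] obtain m \<beta> i where n: "n = Suc m" and \<beta>: "is_epi Box \<beta>" "\<beta> \<in> Hom Box m (Cod Box \<gamma>)"
      and i: "1 \<le> i" "i \<le> Suc m" and eq: "\<gamma> = cube_comp \<beta> (degen (Suc m) i)" .
    have c': "(\<beta>, x) \<in> At (Lan X) m" using \<beta> x Hom_Box_Cod[OF \<beta>(2)] by (simp add: At_Lan)
    have i': "i \<in> {1..n}" using i n by simp
    note s = degen_op_closed[OF i, folded n] and s_in = degen_op_in[OF i c', folded n, folded eq[folded n]]
    have "g \<cdot> degen_op A (Lan X) FS n i = Zero A (chainL m) b"
      using gd[OF i'] L zero_left[OF coprod_in_closed[OF has_degens i'] b] n by simp
    then have "g \<cdot> inL n (\<gamma>, x) = Zero A (chainL m) b \<cdot> inL m (\<beta>, x)"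
      using comp_assoc[OF L.chain_in_closed[OF c'] s g] s_in by simp
    also have "\<dots> = Zero A (Fobj F (Cod Box \<gamma>, x)) b"
      using zero_left[OF L.chain_in_closed[OF c'] b] Hom_Box_Cod[OF \<beta>(2)] by (simp add: FS_obj)
    finally show "g \<cdot> inL n (\<gamma>, x) = Zero A (Fobj F (Cod Box \<gamma>, x)) b" .
  qed
  show ?L if R: ?R
  proof (rule coprod_ext[OF has_degens])
    show "g \<cdot> degens n \<in> Hom A (degens_obj n) b" by (rule comp_closed[OF degens_closed g])
    show "Zero A (degens_obj n) b \<in> Hom A (degens_obj n) b"
      by (rule zero_closed[OF coprod_obj_closed[OF has_degens] b])
    fix i assume i': "i \<in> {1..n}"
    then obtain m where n: "n = Suc m" by (cases n) auto
    with i' have i: "1 \<le> i" "i \<le> Suc m" by auto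
    note s = degen_op_closed[OF i, folded n]
    have "g \<cdot> degen_op A (Lan X) FS n i = Zero A (chainL m) b"
    proof (rule L.chain_ext[OF comp_closed[OF s g] zero_closed[OF L.chain_closed b]])
      fix c assume c: "c \<in> At (Lan X) m"
      obtain \<beta> x where cx: "c = (\<beta>, x)" by (cases c)
      note c' = c[unfolded cx]
      from c' have \<beta>: "is_epi Box \<beta>" "\<beta> \<in> Hom Box m (Cod Box \<beta>)" and x: "x \<in> At X (Cod Box \<beta>)"
        by (auto simp: At_Lan)
      note d = epi_comp_degen[OF \<beta> i]
      have "(cube_comp \<beta> (degen (Suc m) i), x) \<in> At (Lan X) n"
        using d x Hom_Box_Cod[OF d(2)] n by (simp add: At_Lan)
      then have "g \<cdot> inL n (cube_comp \<beta> (degen (Suc m) i), x) = Zero A (Fobj F (Cod Box \<beta>, x)) b"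
        using R[rule_format, of "cube_comp \<beta> (degen (Suc m) i)" x] d(3) Hom_Box_Cod[OF d(2)] n by simp
      then show "(g \<cdot> degen_op A (Lan X) FS n i) \<cdot> inL m c = Zero A (chainL m) b \<cdot> inL m c"
        using comp_assoc[OF L.chain_in_closed[OF c'] s g] degen_op_in[OF i c', folded n]
          zero_left[OF L.chain_in_closed[OF c'] b] cx n by (simp add: FS_obj)
    qed
    then show "(g \<cdot> degens n) \<cdot> degens_in n i = Zero A (degens_obj n) b \<cdot> degens_in n i"
      using gd[OF i'] zero_left[OF coprod_in_closed[OF has_degens i'] b] n by simp
  qed
qed

lemma is_cokernel_projection: "is_cokernel A (degens n) (projection n)"
proof -
  have dom: "Dom A (degens n) = degens_obj n" "Cod A (degens n) = chainL n" "degens n \<in> Arr A"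
    "Dom A (projection n) = chainL n" "Cod A (projection n) = chainP n" "projection n \<in> Arr A"
    using degens_closed[of n] projection_closed[of n] by (auto simp: Hom_def)
  have "projection n \<cdot> degens n = Zero A (degens_obj n) (chainP n)"
    unfolding degens_vanish_iff[OF projection_closed] using projection_in by simp
  moreover have "\<exists>!h. h \<in> Hom A (chainP n) b \<and> h \<cdot> projection n = g"
    if g: "g \<in> Hom A (chainL n) b" and vanish: "g \<cdot> degens n = Zero A (degens_obj n) b" for b g
  proof -
    note b = Hom_Obj(2)[OF g]
    \<comment> \<open>The factorization is \<open>g\<close> restricted to the identity summands. It
      is the only candidate because the projection restricts to the injections of the chains of X on
      these summands.\<close>
    let ?h = "copair A (At X n) (\<lambda>x. Fobj F (n, x)) b (\<lambda>x. g \<cdot> inL n (cube_id n, x))"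
    have gi: "g \<cdot> inL n (cube_id n, x) \<in> Hom A (Fobj F (n, x)) b" if "x \<in> At X n" for x
      using comp_closed[OF L.chain_in_closed[OF Lan_id[OF that]] g] by (simp add: FS_obj)
    have h: "?h \<in> Hom A (chainP n) b" by (rule P.chain_copair_closed[OF b gi])
    have h_in: "?h \<cdot> inP n x = g \<cdot> inL n (cube_id n, x)" if "x \<in> At X n" for x
      by (rule P.chain_copair_in[OF b gi]) (use that in auto)
    show ?thesis
    proof (rule ex1I[of _ ?h])
      have "?h \<cdot> projection n = g"
      proof (rule L.chain_ext[OF comp_closed[OF projection_closed h] g])
        fix c assume c: "c \<in> At (Lan X) n"
        obtain \<gamma> x where cx: "c = (\<gamma>, x)" by (cases c)
        note c' = c[unfolded cx]
        have x: "x \<in> At X (Cod Box \<gamma>)" using c' by (simp add: At_Lan)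
        have "(?h \<cdot> projection n) \<cdot> inL n c = ?h \<cdot> (projection n \<cdot> inL n c)"
          by (rule comp_assoc[OF L.chain_in_closed[OF c] projection_closed h])
        also have "\<dots> = g \<cdot> inL n c"
        proof (cases "\<gamma> = cube_id n")
          case True
          then show ?thesis using projection_in[OF c'] h_in[of x] x cx by simp
        next
          case False
          then have "g \<cdot> inL n (\<gamma>, x) = Zero A (Fobj F (Cod Box \<gamma>, x)) b"
            using vanish c' unfolding degens_vanish_iff[OF g] by blast
          then show ?thesis
            using False projection_in[OF c'] zero_right[OF h F_obj[OF x]] cx by simp
        qed
        finally show "(?h \<cdot> projection n) \<cdot> inL n c = g \<cdot> inL n c" .
      qed
      then show "?h \<in> Hom A (chainP n) b \<and> ?h \<cdot> projection n = g" using h by blast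
      fix k assume k: "k \<in> Hom A (chainP n) b \<and> k \<cdot> projection n = g"
      show "k = ?h"
      proof (rule P.chain_ext[OF conjunct1[OF k] h])
        fix x assume x: "x \<in> At X n"
        note c = Lan_id[OF x]
        have "k \<cdot> inP n x = k \<cdot> (projection n \<cdot> inL n (cube_id n, x))"
          using projection_in[OF c] by simp
        also have "\<dots> = g \<cdot> inL n (cube_id n, x)"
          using comp_assoc[OF L.chain_in_closed[OF c] projection_closed conjunct1[OF k]] k by simp
        finally show "k \<cdot> inP n x = ?h \<cdot> inP n x" using h_in[OF x] by simp
      qed
    qed
  qed
  ultimately show ?thesis unfolding is_cokernel_def dom using dom by simp
qed

section \<open>The normalized complex is the complex of X\<close>

abbreviation "normL \<equiv> norm_proj A (Lan X) FS"
abbreviation "norm_obj n \<equiv> Cod A (normL n)"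

lemma is_cokernel_norm: "is_cokernel A (degens n) (normL n)"
  unfolding norm_proj_def degens_def[symmetric] by (rule is_cokernel_coker[OF degens_closed])

lemma norm_closed: "normL n \<in> Hom A (chainL n) (norm_obj n)"
  by (rule cokernel_closed[OF is_cokernel_norm degens_closed])

lemma norm_obj_closed: "norm_obj n \<in> Obj A"
  using norm_closed by (rule Hom_Obj(2))

lemma norm_ext:
  "u \<in> Hom A (norm_obj n) b \<Longrightarrow> v \<in> Hom A (norm_obj n) b \<Longrightarrow> u \<cdot> normL n = v \<cdot> normL n \<Longrightarrow> u = v"
  by (rule cokernel_ext[OF is_cokernel_norm])

text \<open>\<open>norm_iso\<close> and \<open>norm_inv\<close> are the canonical arrows between two
  cokernels of \<open>degens n\<close>, the chosen one and the projection; hence they are mutually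
  inverse.\<close>

definition norm_iso :: "nat \<Rightarrow> 'm" where
  "norm_iso n = (THE h. h \<in> Hom A (norm_obj n) (chainP n) \<and> h \<cdot> normL n = projection n)"

definition norm_inv :: "nat \<Rightarrow> 'm" where
  "norm_inv n = (THE h. h \<in> Hom A (chainP n) (norm_obj n) \<and> h \<cdot> projection n = normL n)"

lemma Cod_projection: "Cod A (projection n) = chainP n"
  using projection_closed[of n] by (simp add: Hom_def)

lemma norm_iso:
  shows norm_iso_closed: "norm_iso n \<in> Hom A (norm_obj n) (chainP n)"
    and norm_iso_norm: "norm_iso n \<cdot> normL n = projection n"
  using theI'[OF cokernel_desc[OF is_cokernel_norm degens_closed projection_closed
        cokernel_comp[OF is_cokernel_projection degens_closed, unfolded Cod_projection], of n]]
  unfolding norm_iso_def by auto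

lemma norm_inv:
  shows norm_inv_closed: "norm_inv n \<in> Hom A (chainP n) (norm_obj n)"
    and norm_inv_projection: "norm_inv n \<cdot> projection n = normL n"
  using theI'[OF cokernel_desc[OF is_cokernel_projection degens_closed norm_closed
        cokernel_comp[OF is_cokernel_norm degens_closed], of n]]
  unfolding norm_inv_def Cod_projection by auto

lemma norm_inv_iso: "norm_inv n \<cdot> norm_iso n = Idt A (norm_obj n)"
  by (rule inverse_of_cokernels[OF degens_closed is_cokernel_norm norm_closed is_cokernel_projection
        projection_closed norm_iso norm_inv])

lemma norm_iso_inv: "norm_iso n \<cdot> norm_inv n = Idt A (chainP n)"
  by (rule inverse_of_cokernels[OF degens_closed is_cokernel_projection projection_closed
        is_cokernel_norm norm_closed norm_inv norm_iso])

lemma factor_through_norm: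
  assumes h: "h \<in> Hom A (chainP n) b"
  shows "(h \<cdot> norm_iso n) \<in> Hom A (norm_obj n) b" "(h \<cdot> norm_iso n) \<cdot> normL n = h \<cdot> projection n"
  using comp_closed[OF norm_iso_closed h] comp_assoc[OF norm_closed norm_iso_closed h] norm_iso_norm by auto

abbreviation "normC \<equiv> norm_cx A (Lan X) FS"
abbreviation "plusC \<equiv> plus_cx A X F"

lemma complex_Ch: "Ch normC n = norm_obj n" "Ch plusC n = chainP n"
  "Diff plusC (Suc n) = chain_diff A X F (Suc n)"
  by (simp_all add: norm_cx_def plus_cx_def)

text \<open>The differential of \<open>norm_cx\<close> is a description, so existence has to be
  shown. The differential of X conjugated by the isomorphism is a witness, since the projection
  commutes with differentials; this replaces a check that degenerate chains are preserved.\<close>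

lemma norm_diff_eq: "Diff normC (Suc n) = norm_inv n \<cdot> (chain_diff A X F (Suc n) \<cdot> norm_iso (Suc n))"
  unfolding norm_cx_def chain_cx.simps diff_Suc_1
proof (rule the_equality)
  note dP = P.chain_diff_closed and dL = L.chain_diff_closed
  let ?d = "norm_inv n \<cdot> (chain_diff A X F (Suc n) \<cdot> norm_iso (Suc n))"
  note f = factor_through_norm[OF dP]
  have d: "?d \<in> Hom A (norm_obj (Suc n)) (norm_obj n)"
    by (rule comp_closed[OF f(1) norm_inv_closed])
  have "?d \<cdot> normL (Suc n) = norm_inv n \<cdot> (projection n \<cdot> chain_diff A (Lan X) FS (Suc n))"
    using comp_assoc[OF norm_closed f(1) norm_inv_closed, of n] f(2) projection_chain_diff by simp
  also have "\<dots> = normL n \<cdot> chain_diff A (Lan X) FS (Suc n)"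
    using comp_assoc[OF dL projection_closed norm_inv_closed, of n] norm_inv_projection by simp
  finally have eq: "?d \<cdot> normL (Suc n) = normL n \<cdot> chain_diff A (Lan X) FS (Suc n)" .
  with d show "?d \<in> Hom A (norm_obj (Suc n)) (norm_obj n) \<and>
      ?d \<cdot> normL (Suc n) = normL n \<cdot> chain_diff A (Lan X) FS (Suc n)" ..
  show "d' = ?d" if "d' \<in> Hom A (norm_obj (Suc n)) (norm_obj n) \<and>
      d' \<cdot> normL (Suc n) = normL n \<cdot> chain_diff A (Lan X) FS (Suc n)" for d'
    using that norm_ext[OF _ d] eq by metis
qed

lemma norm_complex:
  shows norm_is_complex: "is_complex A normC" and norm_iso_chain_map: "is_chain_map A normC plusC norm_iso"
    and norm_inv_chain_map: "is_chain_map A plusC normC norm_inv"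
proof -
  note f = factor_through_norm(1)[OF P.chain_diff_closed]
  have D: "Diff normC (Suc n) \<in> Hom A (norm_obj (Suc n)) (norm_obj n)" for n
    unfolding norm_diff_eq by (rule comp_closed[OF f norm_inv_closed])
  have "norm_iso n \<cdot> Diff normC (Suc n) = chain_diff A X F (Suc n) \<cdot> norm_iso (Suc n)" for n
    unfolding norm_diff_eq
    using comp_assoc[OF f norm_inv_closed norm_iso_closed, of n] norm_iso_inv id_left[OF f] by simp
  note t = transport_complex[of normC plusC norm_iso norm_inv, unfolded complex_Ch, OF norm_obj_closed
      plus_complex D norm_iso_closed norm_inv_closed norm_inv_iso norm_iso_inv this]
  show "is_complex A normC" "is_chain_map A normC plusC norm_iso" "is_chain_map A plusC normC norm_inv"
    using t by auto
qed

text \<open>All choices of cokernels, kernels and coproducts are fixed, so this is a single function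
  of the coefficients, as naturality in F presupposes.\<close>

definition comparison :: "nat \<Rightarrow> 'm" where
  "comparison n = homology_map A normC plusC norm_iso n"

lemma comparison_closed: "comparison n \<in> Hom A (homology A normC n) (homology A plusC n)"
  unfolding comparison_def
  by (rule homology_map_closed[OF norm_is_complex plus_complex norm_iso_chain_map])

lemma comparison_iso: "is_isomorphism A (comparison n)"
  unfolding comparison_def
  by (rule homology_map_iso[OF norm_is_complex plus_complex norm_iso_chain_map norm_inv_chain_map])
    (simp_all only: complex_Ch norm_inv_iso norm_iso_inv)

end

section \<open>Naturality in the coefficients\<close>

lemma chain_map:
  assumes "face_coefficients A Y G" "face_coefficients A Y G'"
    and \<tau>: "\<And>x. x \<in> At Y n \<Longrightarrow> \<tau> (n, x) \<in> Hom A (Fobj G (n, x)) (Fobj G' (n, x))"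
  shows chain_map_hom: "chain_map A Y G G' \<tau> n \<in> Hom A (chain A Y G n) (chain A Y G' n)"
    and chain_map_in: "x \<in> At Y n \<Longrightarrow>
      chain_map A Y G G' \<tau> n \<cdot>\<^bsub>A\<^esub> chain_in A Y G n x = chain_in A Y G' n x \<cdot>\<^bsub>A\<^esub> \<tau> (n, x)"
proof -
  interpret G: face_coefficients A Y G by fact
  interpret G': face_coefficients A Y G' by fact
  have g: "chain_in A Y G' n x \<cdot>\<^bsub>A\<^esub> \<tau> (n, x) \<in> Hom A (Fobj G (n, x)) (chain A Y G' n)" if "x \<in> At Y n" for x
    by (rule G.comp_closed[OF \<tau>[OF that] G'.chain_in_closed[OF that]])
  have eq: "chain_map A Y G G' \<tau> n = copair A (At Y n) (\<lambda>x. Fobj G (n, x)) (chain A Y G' n)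
      (\<lambda>x. chain_in A Y G' n x \<cdot>\<^bsub>A\<^esub> \<tau> (n, x))"
    by (simp add: chain_map_def coprod_map_def chain_def chain_in_def)
  show "chain_map A Y G G' \<tau> n \<in> Hom A (chain A Y G n) (chain A Y G' n)"
    unfolding eq by (rule G.chain_copair_closed[OF G'.chain_closed g])
  show "chain_map A Y G G' \<tau> n \<cdot>\<^bsub>A\<^esub> chain_in A Y G n x = chain_in A Y G' n x \<cdot>\<^bsub>A\<^esub> \<tau> (n, x)" if "x \<in> At Y n"
    unfolding eq by (rule G.chain_copair_in[OF G'.chain_closed g that])
qed

locale universal_nat_trans =
  F: universal_coefficients U A X F + F': universal_coefficients U A X F'
  for U :: "'u itself" and A :: "('o, 'm, 'z) ab_cat_scheme" (structure)
    and X :: "(nat, cube_map, 'u) psh" and F F' +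
  fixes \<tau> :: "nat \<times> 'u \<Rightarrow> 'm"
  assumes nat_trans: "is_nat_trans (op_cat (elements Box_plus X)) A F F' \<tau>"
begin

lemma component: "x \<in> At X n \<Longrightarrow> \<tau> (n, x) \<in> Hom A (Fobj F (n, x)) (Fobj F' (n, x))"
  using nat_trans by (auto simp: is_nat_trans_def op_cat_def elements_def)

lemma natural:
  assumes "is_mono Box \<mu>" "\<mu> \<in> Hom Box b c" "x \<in> At X c"
  shows "\<tau> (b, Act X \<mu> x) \<cdot> Farr F ((b, Act X \<mu> x), \<mu>, (c, x)) = Farr F' ((b, Act X \<mu> x), \<mu>, (c, x)) \<cdot> \<tau> (c, x)"
proof -
  have "\<forall>f \<in> Arr (elements Box_plus X). \<tau> (Dom (elements Box_plus X) f) \<cdot> Farr F f =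
      Farr F' f \<cdot> \<tau> (Cod (elements Box_plus X) f)"
    using nat_trans by (simp add: is_nat_trans_def op_cat_def)
  from bspec[OF this F.elements_arr[OF assms]] show ?thesis by (simp add: elements_def)
qed

abbreviation "mapP \<equiv> chain_map A X F F' \<tau>"
abbreviation "whiskered \<equiv> whisker \<tau> (op_fctr (S_functor X))"
abbreviation "mapL \<equiv> chain_map A (Lan X) F.FS F'.FS whiskered"

lemma mapP:
  shows mapP_closed: "mapP n \<in> Hom A (chain A X F n) (chain A X F' n)"
    and mapP_in: "x \<in> At X n \<Longrightarrow> mapP n \<cdot> chain_in A X F n x = chain_in A X F' n x \<cdot> \<tau> (n, x)"
  using chain_map[OF F.P.face_coefficients_axioms F'.P.face_coefficients_axioms, of n \<tau>] component by auto

lemma whiskered: "whiskered (n, \<gamma>, x) = \<tau> (Cod Box \<gamma>, x)"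
  by (simp add: whisker_def op_fctr_def S_functor_def)

lemma whiskered_component:
  "c \<in> At (Lan X) n \<Longrightarrow> whiskered (n, c) \<in> Hom A (Fobj F.FS (n, c)) (Fobj F'.FS (n, c))"
  using component by (cases c) (auto simp: whiskered F.FS_obj F'.FS_obj At_Lan)

lemma mapL:
  shows mapL_closed: "mapL n \<in> Hom A (F.chainL n) (F'.chainL n)"
    and mapL_in: "c \<in> At (Lan X) n \<Longrightarrow> mapL n \<cdot> F.inL n c = F'.inL n c \<cdot> whiskered (n, c)"
  using chain_map[OF F.L.face_coefficients_axioms F'.L.face_coefficients_axioms, of n whiskered]
    whiskered_component by auto

lemma mapP_face_op:
  assumes i: "1 \<le> i" "i \<le> Suc n"
  shows "mapP n \<cdot> face_op A X F (Suc n) i \<epsilon> = face_op A X F' (Suc n) i \<epsilon> \<cdot> mapP (Suc n)"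
proof (rule F.P.chain_ext)
  note fF = F.P.face_op_closed[OF i] and fF' = F'.P.face_op_closed[OF i]
  show "mapP n \<cdot> face_op A X F (Suc n) i \<epsilon> \<in> Hom A (chain A X F (Suc n)) (chain A X F' n)"
    by (rule F.comp_closed[OF fF mapP_closed])
  show "face_op A X F' (Suc n) i \<epsilon> \<cdot> mapP (Suc n) \<in> Hom A (chain A X F (Suc n)) (chain A X F' n)"
    by (rule F.comp_closed[OF mapP_closed fF'])
  fix x assume x: "x \<in> At X (Suc n)"
  let ?y = "Act X (face (Suc n) i \<epsilon>) x"
  let ?f = "Farr F ((n, ?y), face (Suc n) i \<epsilon>, (Suc n, x))" and ?f' = "Farr F' ((n, ?y), face (Suc n) i \<epsilon>, (Suc n, x))"
  note y = F.P.face_at[OF i x, of \<epsilon>]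
  have "(mapP n \<cdot> face_op A X F (Suc n) i \<epsilon>) \<cdot> chain_in A X F (Suc n) x =
      (mapP n \<cdot> chain_in A X F n ?y) \<cdot> ?f"
    by (simp only: F.comp_assoc[OF F.P.chain_in_closed[OF x] fF mapP_closed] F.P.face_op_in[OF i x]
        F.comp_assoc[OF F.P.face_arr[OF i x] F.P.chain_in_closed[OF y] mapP_closed])
  also have "\<dots> = chain_in A X F' n ?y \<cdot> (\<tau> (n, ?y) \<cdot> ?f)"
    by (simp only: mapP_in[OF y]
        F.comp_assoc[OF F.P.face_arr[OF i x] component[OF y] F'.P.chain_in_closed[OF y]])
  also have "\<tau> (n, ?y) \<cdot> ?f = ?f' \<cdot> \<tau> (Suc n, x)"
    by (rule natural[OF face_mono[OF i] face_Hom[OF i] x])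
  also have "chain_in A X F' n ?y \<cdot> (?f' \<cdot> \<tau> (Suc n, x)) = (face_op A X F' (Suc n) i \<epsilon> \<cdot> chain_in A X F' (Suc n) x) \<cdot> \<tau> (Suc n, x)"
    by (simp only: F'.P.face_op_in[OF i x]
        F.comp_assoc[OF component[OF x] F'.P.face_arr[OF i x] F'.P.chain_in_closed[OF y]])
  also have "\<dots> = (face_op A X F' (Suc n) i \<epsilon> \<cdot> mapP (Suc n)) \<cdot> chain_in A X F (Suc n) x"
    by (simp only: F.comp_assoc[OF F.P.chain_in_closed[OF x] mapP_closed fF'] mapP_in[OF x]
        F.comp_assoc[OF component[OF x] F'.P.chain_in_closed[OF x] fF'])
  finally show "(mapP n \<cdot> face_op A X F (Suc n) i \<epsilon>) \<cdot> chain_in A X F (Suc n) x =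
      (face_op A X F' (Suc n) i \<epsilon> \<cdot> mapP (Suc n)) \<cdot> chain_in A X F (Suc n) x" .
qed

lemma mapP_chain_map: "is_chain_map A (plus_cx A X F) (plus_cx A X F') mapP"
proof -
  have "mapP n \<cdot> F.P.face_diff n i = F'.P.face_diff n i \<cdot> mapP (Suc n)" if "1 \<le> i" "i \<le> Suc n" for n i
    by (simp only: F.P.comp_face_diff[OF that mapP_closed] F'.P.face_diff_comp[OF that mapP_closed]
        mapP_face_op[OF that])
  then have "mapP n \<cdot> chain_diff A X F (Suc n) = chain_diff A X F' (Suc n) \<cdot> mapP (Suc n)" for n
    by (intro chain_diff_natural[OF F.P.face_coefficients_axioms F'.P.face_coefficients_axioms] mapP_closed) auto
  then show ?thesis
    unfolding is_chain_map_def F.complex_Ch F'.complex_Ch using mapP_closed by blast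
qed

text \<open>On an identity summand the whiskered transformation at \<open>(cube_id n, x)\<close> is
  \<tau> at \<open>x\<close>; on all other summands both sides vanish.\<close>

lemma projection_natural: "F'.projection n \<cdot> mapL n = mapP n \<cdot> F.projection n"
proof (rule F.L.chain_ext)
  note p = F.projection_closed and p' = F'.projection_closed
  show "F'.projection n \<cdot> mapL n \<in> Hom A (F.chainL n) (F'.chainP n)"
    by (rule F.comp_closed[OF mapL_closed p'])
  show "mapP n \<cdot> F.projection n \<in> Hom A (F.chainL n) (F'.chainP n)"
    by (rule F.comp_closed[OF p mapP_closed])
  fix c assume c: "c \<in> At (Lan X) n"
  obtain \<gamma> x where cx: "c = (\<gamma>, x)" by (cases c)
  note c' = c[unfolded cx]
  have x: "x \<in> At X (Cod Box \<gamma>)" using c' by (simp add: At_Lan)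
  have "(F'.projection n \<cdot> mapL n) \<cdot> F.inL n c = (F'.projection n \<cdot> F'.inL n c) \<cdot> whiskered (n, c)"
    by (simp only: F.comp_assoc[OF F.L.chain_in_closed[OF c] mapL_closed p'] mapL_in[OF c]
        F.comp_assoc[OF whiskered_component[OF c] F'.L.chain_in_closed[OF c] p'])
  also have "\<dots> = mapP n \<cdot> (F.projection n \<cdot> F.inL n c)"
  proof (cases "\<gamma> = cube_id n")
    case True
    then show ?thesis
      using F.projection_in[OF c'] F'.projection_in[OF c'] mapP_in[of x n] x cx
      by (simp add: whiskered)
  next
    case False
    have "Zero A (Fobj F' (Cod Box \<gamma>, x)) (F'.chainP n) \<cdot> \<tau> (Cod Box \<gamma>, x) =
        mapP n \<cdot> Zero A (Fobj F (Cod Box \<gamma>, x)) (F.chainP n)"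
      using F.zero_left[OF component[OF x] F'.P.chain_closed] F.zero_right[OF mapP_closed F.F_obj[OF x], of n] by simp
    with False show ?thesis
      using F.projection_in[OF c'] F'.projection_in[OF c'] cx by (simp add: whiskered)
  qed
  also have "\<dots> = (mapP n \<cdot> F.projection n) \<cdot> F.inL n c"
    by (rule F.comp_assoc[OF F.L.chain_in_closed[OF c] p mapP_closed, symmetric])
  finally show "(F'.projection n \<cdot> mapL n) \<cdot> F.inL n c = (mapP n \<cdot> F.projection n) \<cdot> F.inL n c" .
qed

text \<open>As for the differential, the described map exists because a conjugate satisfies the
  description: here the induced map on the chains of X, conjugated by the isomorphisms for F and
  F'.\<close>

lemma norm_map_eq: "norm_map A (Lan X) F.FS F'.FS whiskered n = F'.norm_inv n \<cdot> (mapP n \<cdot> F.norm_iso n)"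
  unfolding norm_map_def
proof (rule the_equality)
  note mP = mapP_closed and mL = mapL_closed
  let ?h = "F'.norm_inv n \<cdot> (mapP n \<cdot> F.norm_iso n)"
  note f = F.factor_through_norm[OF mP]
  have h: "?h \<in> Hom A (F.norm_obj n) (F'.norm_obj n)"
    by (rule F.comp_closed[OF f(1) F'.norm_inv_closed])
  have "?h \<cdot> F.normL n = F'.norm_inv n \<cdot> (F'.projection n \<cdot> mapL n)"
    using F.comp_assoc[OF F.norm_closed f(1) F'.norm_inv_closed, of n] f(2) projection_natural by simp
  also have "\<dots> = F'.normL n \<cdot> mapL n"
    using F.comp_assoc[OF mL F'.projection_closed F'.norm_inv_closed, of n] F'.norm_inv_projection by simp
  finally have eq: "?h \<cdot> F.normL n = F'.normL n \<cdot> mapL n" .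
  with h show "?h \<in> Hom A (F.norm_obj n) (F'.norm_obj n) \<and> ?h \<cdot> F.normL n = F'.normL n \<cdot> mapL n" ..
  show "h' = ?h" if "h' \<in> Hom A (F.norm_obj n) (F'.norm_obj n) \<and> h' \<cdot> F.normL n = F'.normL n \<cdot> mapL n" for h'
    using that F.norm_ext[OF _ h] eq by metis
qed

text \<open>The square commutes already on chains: both ways around equal \<open>mapP\<close> after
  \<open>norm_iso\<close>. Functoriality of homology does the rest.\<close>

lemma comparison_natural:
  "F'.comparison n \<cdot> homology_map A F.normC F'.normC (norm_map A (Lan X) F.FS F'.FS whiskered) n =
    homology_map A F.plusC F'.plusC mapP n \<cdot> F.comparison n"
proof -
  let ?f = "norm_map A (Lan X) F.FS F'.FS whiskered"
  note mP = mapP_closed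
  note i = F.factor_through_norm(1)[OF mP]
  note PF = F.chain_map_comp[OF F.norm_is_complex F.plus_complex F'.plus_complex F.norm_iso_chain_map mapP_chain_map]
  have "is_chain_map A F.normC F'.normC (\<lambda>n. F'.norm_inv n \<cdot> (mapP n \<cdot> F.norm_iso n))"
    by (rule F.chain_map_comp[OF F.norm_is_complex F'.plus_complex F'.norm_is_complex PF F'.norm_inv_chain_map])
  then have f: "is_chain_map A F.normC F'.normC ?f" by (simp add: norm_map_eq[abs_def])
  have "F'.norm_iso n \<cdot> ?f n = mapP n \<cdot> F.norm_iso n"
    unfolding norm_map_eq
    using F.comp_assoc[OF i F'.norm_inv_closed F'.norm_iso_closed, of n] F'.norm_iso_inv F.id_left[OF i] by simp
  then have "homology_map A F.normC F'.plusC (\<lambda>n. F'.norm_iso n \<cdot> ?f n) n =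
      homology_map A F.normC F'.plusC (\<lambda>n. mapP n \<cdot> F.norm_iso n) n"
    by (rule F.homology_map_cong)
  then show ?thesis
    unfolding F.comparison_def F'.comparison_def
    using F.homology_map_comp[OF F.norm_is_complex F'.norm_is_complex F'.plus_complex f F'.norm_iso_chain_map]
      F.homology_map_comp[OF F.norm_is_complex F.plus_complex F'.plus_complex F.norm_iso_chain_map mapP_chain_map]
    by simp
qed

end

theorem theorem7p7:
  fixes A :: "('o, 'm) ab_cat"
    and X :: "(nat, cube_map, 'u) psh"
  assumes "infinite (UNIV :: 'u set)"
    and "ab4_category TYPE('u) A"
    and "semicubical_set X"
  shows "\<forall>n. \<exists>\<phi> :: ('u, 'o, 'm) coeff \<Rightarrow> 'm.
    (\<forall>F. is_functor (op_cat (elements Box_plus X)) A F \<longrightarrow>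
       \<phi> F \<in> Hom A (cub_homology A n (Lan X) (fctr_comp F (op_fctr (S_functor X))))
                     (semicub_homology A n X F) \<and>
       is_isomorphism A (\<phi> F)) \<and>
    (\<forall>F F' \<tau>. is_nat_trans (op_cat (elements Box_plus X)) A F F' \<tau> \<longrightarrow>
       \<phi> F' \<cdot>\<^bsub>A\<^esub>
         cub_homology_map A n (Lan X)
           (fctr_comp F (op_fctr (S_functor X))) (fctr_comp F' (op_fctr (S_functor X)))
           (whisker \<tau> (op_fctr (S_functor X)))
       = semicub_homology_map A n X F F' \<tau> \<cdot>\<^bsub>A\<^esub> \<phi> F)"
proof
  fix n
  have X: "universal_cubical_set A X"
    using assms by (intro universal_cubical_set.intro universal_cubical_set_axioms.intro)
  have coeff: "universal_coefficients A X F"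
    if "is_functor (op_cat (elements Box_plus X)) A F" for F
    using X that by (intro universal_coefficients.intro universal_coefficients_axioms.intro)
  \<comment> \<open>One function for all coefficients at once, because the naturality clause relates
    its values at F and at F'.\<close>
  let ?\<phi> = "\<lambda>F. universal_coefficients.comparison A X F n"
  show "\<exists>\<phi> :: ('u, 'o, 'm) coeff \<Rightarrow> 'm.
    (\<forall>F. is_functor (op_cat (elements Box_plus X)) A F \<longrightarrow>
       \<phi> F \<in> Hom A (cub_homology A n (Lan X) (fctr_comp F (op_fctr (S_functor X))))
                     (semicub_homology A n X F) \<and>
       is_isomorphism A (\<phi> F)) \<and>
    (\<forall>F F' \<tau>. is_nat_trans (op_cat (elements Box_plus X)) A F F' \<tau> \<longrightarrow>
       \<phi> F' \<cdot>\<^bsub>A\<^esub>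
         cub_homology_map A n (Lan X)
           (fctr_comp F (op_fctr (S_functor X))) (fctr_comp F' (op_fctr (S_functor X)))
           (whisker \<tau> (op_fctr (S_functor X)))
       = semicub_homology_map A n X F F' \<tau> \<cdot>\<^bsub>A\<^esub> \<phi> F)"
  proof (intro exI[of _ ?\<phi>] conjI allI impI)
    fix F :: "('u, 'o, 'm) coeff" assume "is_functor (op_cat (elements Box_plus X)) A F"
    then interpret universal_coefficients "TYPE('u)" A X F by (rule coeff)
    show "?\<phi> F \<in> Hom A (cub_homology A n (Lan X) (fctr_comp F (op_fctr (S_functor X)))) (semicub_homology A n X F)"
      using comparison_closed by (simp add: cub_homology_def semicub_homology_def FS_def)
    show "is_isomorphism A (?\<phi> F)" by (rule comparison_iso)
  next
    fix F F' :: "('u, 'o, 'm) coeff" and \<tau>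
    assume \<tau>: "is_nat_trans (op_cat (elements Box_plus X)) A F F' \<tau>"
    then have "is_functor (op_cat (elements Box_plus X)) A F" "is_functor (op_cat (elements Box_plus X)) A F'"
      by (simp_all add: is_nat_trans_def)
    then interpret universal_nat_trans "TYPE('u)" A X F F' \<tau>
      using \<tau> by (intro universal_nat_trans.intro universal_nat_trans_axioms.intro coeff)
    show "?\<phi> F' \<cdot>\<^bsub>A\<^esub> cub_homology_map A n (Lan X)
           (fctr_comp F (op_fctr (S_functor X))) (fctr_comp F' (op_fctr (S_functor X)))
           (whisker \<tau> (op_fctr (S_functor X)))
       = semicub_homology_map A n X F F' \<tau> \<cdot>\<^bsub>A\<^esub> ?\<phi> F"
      using comparison_natural[of n]
      by (simp add: cub_homology_map_def semicub_homology_map_def F.FS_def F'.FS_def)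
  qed
qed

end
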